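(* For all integers $s\ge2$, $(\widetilde{\mathcal{A}^s},\widetilde{W^s_{\mathcal A}})=(\mathcal{D}^s,W^s_{\mathcal D})$ as quivers with potential. Hence $\Pi^s_{\mathcal D}\cong\eta(\Pi^s_{\mathcal A}\#\mathbb{Z}_3)\eta$ for some idempotent $\eta\in\Pi^s_{\mathcal A}\#\mathbb{Z}_3$.
   Context: Conventions: algebras are over $\mathbb{C}$; $\mathbb{N}$ contains $0$; a product of paths $pq$ means "first $p$, then $q$"; $e_x$ is the trivial path at $x$. A quiver with potential (QP) $(Q,W)$ is a quiver with a linear combination $W$ of cycles (cycles regarded up to cyclic permutation); $\mathcal{J}(Q,W)=\mathbb{C}Q/\langle\partial_\alpha W\mid\alpha\in Q_1\rangle$, where $\partial_\alpha(\alpha_1\cdots\alpha_l)=\sum_{\alpha_i=\alpha}\alpha_{i+1}\cdots\alpha_l\alpha_1\cdots\alpha_{i-1}$. Let $f_0=(-1,1,0)$, $f_1=(0,-1,1)$, $f_2=(1,0,-1)$, $\omega(x_0,x_1,x_2)=(x_1,x_2,x_0)$; for triples $u\sim v$ means $v\in\{u,\omega(u),\omega^2(u)\}$. Let $\succ$ be the strict lexicographic order on $\mathbb{N}^3$; $\zeta=e^{2\pi i/3}$; arrow indices are mod 3. Type A. $\mathcal{A}^s$ has vertices $\{x\in\mathbb{N}^3\mid x_0+x_1+x_2=s-1\}$ and an arrow $e_x\alpha_i\colon x\to x+f_i$ whenever both $x,x+f_i$ are vertices. $W^s_{\mathcal A}=\sum_c\lambda_{\mathcal A}(c)c$ over all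 3-cycles $c=e_x\alpha_{i_0}\alpha_{i_1}\alpha_{i_2}$ (up to rotation), $\lambda_{\mathcal A}(c)=1$ if $(i_0,i_1,i_2)\sim(0,1,2)$, $-1$ if $\sim(0,2,1)$. $\Pi^s_{\mathcal A}=\mathcal{J}(\mathcal{A}^s,W^s_{\mathcal A})$. $\mathbb{Z}_3$ acts via $j\mapsto\omega^j$, where $\omega$ acts by $e_x\mapsto e_{\omega(x)}$, $e_x\alpha_i\mapsto e_{\omega(x)}\alpha_{i-1}$. The skew group algebra $\Lambda\#G$ is $\Lambda\otimes\mathbb{C}G$ with $(a\otimes g)(b\otimes h)=a\,g(b)\otimes gh$. Type D. Let $Q_0=\{x\in\mathbb{N}^3\mid x_0+x_1+x_2=s-1,\ x\succ\omega(x),\ x\succ\omega^2(x)\}$ and let $Q_1$ consist of an arrow $e_x\alpha_{i,j}\colon x\to\omega^j(x)+f_i$ for all $i,j\in\{0,1,2\}$, $x\in Q_0$ with $\omega^j(x)+f_i\in Q_0$; $\alpha_i=\alpha_{i,0}$. If $s\not\equiv1\pmod3$, $\mathcal{D}^s=(Q_0,Q_1)$. If $s=3t+1$, $t\in\mathbb{Z}^+$, let $X=(t,t,t)$; $\mathcal{D}^s$ has vertices $Q_0\cup\{X_0,X_1,X_2\}$ (three copies of $X$) and arrows $Q_1\cup\{\beta_k\colon X-f_0\to X_k,\ \gamma_k\colon X_k\to X+f_2\mid k=0,1,2\}$. $W^s_{\mathcal D}=\sum_c\lambda_{\mathcal D}(c)c$ over all 3-cycles of $\mathcal{D}^s$ (up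 to rotation), where: (1) if $c=e_x\alpha_{i_0,j_0}\alpha_{i_1,j_1}\alpha_{i_2,j_2}$ is a product of three distinct arrows and $j_0+j_1+j_2\equiv0$, then $\lambda_{\mathcal D}(c)=1$ if $(i_0+j_0,i_1-j_2,i_2)\sim(0,1,2)$, $-1$ if $\sim(0,2,1)$, while $\lambda_{\mathcal D}(c)=0$ if $j_0+j_1+j_2\not\equiv0$; (2) if $c=e_x\alpha_{i,j}^3$ for a loop $e_x\alpha_{i,j}$, then $\lambda_{\mathcal D}(c)=\frac13$ if $(i+j,i-j,i)\sim(0,1,2)$, $-\frac13$ if $\sim(0,2,1)$; (3) if $s\equiv1\pmod3$, $\lambda_{\mathcal D}(\alpha_1\beta_k\gamma_k)=-1$, $\lambda_{\mathcal D}(\alpha_{2,1}\beta_k\gamma_k)=\zeta^k$ for $k=0,1,2$. $\Pi^s_{\mathcal D}=\mathcal{J}(\mathcal{D}^s,W^s_{\mathcal D})$. The QP $(\widetilde{\mathcal{A}^s},\widetilde{W^s_{\mathcal A}})$ (Giovannini–Pasquali construction applied to $(\mathcal{A}^s,W^s_{\mathcal A})$ and $\mathbb{Z}_3$). Vertices: let $V_1=\{x\in\mathcal{A}^s_0\mid x\succ\omega(x),\ x\succ\omega^2(x)\}$. The vertex set is $V_1$ if $s\not\equiv1\pmod3$, and $V_1\cup\{X_0,X_1,X_2\}$ if $s=3t+1$, $X=(t,t,t)$. Arrows: (1) for each $\mathbb{Z}_3$-orbit of arrows of $\mathcal{A}^s$ between two vertices not fixed by $\mathbb{Z}_3$, the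 unique arrow of the orbit with target in $V_1$ has the form $\alpha_i\colon\omega^j(x)\to\omega^j(x)+f_i$ with $x\in V_1$, $i,j\in\{0,1,2\}$; it gives an arrow $\alpha_{i,j}\colon x\to\omega^j(x)+f_i$. (2) If $s\equiv1\pmod 3$, the orbit of $\alpha_0\colon X-f_0\to X$ gives arrows $\beta_k\colon X-f_0\to X_k$ and the orbit of $\alpha_2\colon X\to X+f_2$ gives arrows $\gamma_k\colon X_k\to X+f_2$, $k=0,1,2$. Potential: Let $C_1$ be a set of representatives of the $\mathbb{Z}_3$-orbits of 3-cycles of $\mathcal{A}^s$ (up to rotation) not passing through $X$ (all 3-cycles if $s\not\equiv 1$), each chosen to pass through a vertex of $V_1$ and written $c\colon x\xrightarrow{l_0}y'\xrightarrow{l_1}z'\xrightarrow{l_2}x$ with $x\in V_1$, arrow labels $l_0,l_1,l_2$. Let $j_0,j_2\in\{0,1,2\}$ be the unique elements with $y=\omega^{j_0}(y')\in V_1$, $z=\omega^{-j_2}(z')\in V_1$, and put $i_0=l_0-j_0$, $i_1=l_1+j_2$, $i_2=l_2$, $j_1=-(j_0+j_2)$ (mod 3); then $\widetilde c$ is the cycle $x\xrightarrow{\alpha_{i_0,j_0}}y\xrightarrow{\alpha_{i_1,j_1}}z\xrightarrow{\alpha_{i_2,j_2}}x$. If $s\equiv1\pmod3$ let $C_2=\{c^-,c^+\}$, where $c^-=e_{X+f_2}\alpha_1\alpha_0\alpha_2$ (through $X-f_0$, $X$), $c^+=e_{X+f_2}\alpha_0\alpha_1\alpha_2$ (through $X-f_1$,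 $X$), with $\widetilde{c^-_k}=e_{X+f_2}\alpha_1\beta_k\gamma_k$, $\widetilde{c^+_k}=e_{X+f_2}\alpha_{2,1}\beta_k\gamma_k$, $p(c^-)=0$, $p(c^+)=-1$; otherwise $C_2=\emptyset$. Then $$\widetilde{W^s_{\mathcal A}}=\sum_{c\in C_1}\lambda_{\mathcal A}(c)\frac{|\mathbb{Z}_3\cdot c|}{3}\,\widetilde c+\sum_{c\in C_2}\lambda_{\mathcal A}(c)\sum_{k=0}^2\zeta^{-p(c)k}\,\widetilde{c_k},$$ where $\mathbb{Z}_3\cdot c$ is the orbit of $c$ (cycles up to rotation). *)

theory Defs
  imports
    Complex_Main
    "HOL-Algebra.QuotRing"
    "HOL-Algebra.Module"
    "HOL-Algebra.Elementary_Groups"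
    "HOL-Library.Poly_Mapping"
    "HOL-Library.Product_Plus"
    "Graph_Theory.Arc_Walk"
begin

section \<open>Quivers, potentials and Jacobian algebras\<close>

text \<open>
  A quiver is a \<^typ>\<open>('v, 'a) pre_digraph\<close>. A closed walk is a list of arrows, and a cycle up to
  cyclic permutation is the set of all rotations of such a list. A potential is a finitely
  supported function on rotation classes.
\<close>

type_synonym ('v, 'a) quiver = "('v, 'a) pre_digraph"
type_synonym 'a potential = "'a list set \<Rightarrow>\<^sub>0 complex"
type_synonym ('v, 'a) qp = "('v, 'a) quiver \<times> 'a potential"

definition rot_class :: "'a list \<Rightarrow> 'a list set" where
  "rot_class c = range (\<lambda>n. rotate n c)"

definition rot_rep :: "'a list set \<Rightarrow> 'a list" where
  "rot_rep C = (SOME c. c \<in> C)"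

text \<open>All closed walks of length 3, loops allowed.\<close>
definition closed_3_walks :: "('v, 'a) quiver \<Rightarrow> 'a list set" where
  "closed_3_walks Q = {c. length c = 3 \<and> (\<exists>u. pre_digraph.awalk Q u c u)}"

definition three_cycles :: "('v, 'a) quiver \<Rightarrow> 'a list set set" where
  "three_cycles Q = rot_class ` closed_3_walks Q"

text \<open>
  The start vertex is recorded so that the trivial path at \<open>x\<close> is \<open>(x, [])\<close>. Paths compose from
  left to right.
\<close>
type_synonym ('v, 'a) path = "'v \<times> 'a list"

definition paths :: "('v, 'a) quiver \<Rightarrow> ('v, 'a) path set" where
  "paths Q = {(u, p). \<exists>v. pre_digraph.awalk Q u p v}"

definition path_end :: "('v, 'a) quiver \<Rightarrow> ('v, 'a) path \<Rightarrow> 'v" where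
  "path_end Q p = (if snd p = [] then fst p else head Q (last (snd p)))"

definition path_algebra ::
    "('v, 'a) quiver \<Rightarrow> (complex, ('v, 'a) path \<Rightarrow>\<^sub>0 complex) module" where
  "path_algebra Q =
    \<lparr>carrier = {a. Poly_Mapping.keys a \<subseteq> paths Q},
     monoid.mult = (\<lambda>a b. \<Sum>p\<in>Poly_Mapping.keys a. \<Sum>q\<in>Poly_Mapping.keys b.
        if path_end Q p = fst q
        then Poly_Mapping.single (fst p, snd p @ snd q)
               (Poly_Mapping.lookup a p * Poly_Mapping.lookup b q)
        else 0),
     monoid.one = (\<Sum>v\<in>verts Q. Poly_Mapping.single (v, []) 1),
     ring.zero = 0,
     ring.add = (+),
     smult = (\<lambda>z. Poly_Mapping.map ((*) z))\<rparr>"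

definition cyc_deriv ::
    "('v, 'a) quiver \<Rightarrow> 'a \<Rightarrow> 'a list \<Rightarrow> ('v, 'a) path \<Rightarrow>\<^sub>0 complex" where
  "cyc_deriv Q a c = (\<Sum>i | i < length c \<and> c ! i = a.
     Poly_Mapping.single (head Q a, drop (Suc i) c @ take i c) 1)"

lemma cyc_deriv_rotate1: "cyc_deriv Q a (rotate1 c) = cyc_deriv Q a c"
proof (cases c)
  case Nil
  then show ?thesis by simp
next
  case (Cons x xs)
  let ?n = "length xs"
  let ?S = "\<lambda>c i. Poly_Mapping.single (head Q a, drop (Suc i) c @ take i c) (1::complex)"
  have split: "cyc_deriv Q a d = (\<Sum>i<length d. if d ! i = a then ?S d i else 0)" for d
  proof -
    have "{i. i < length d \<and> d ! i = a} = {i\<in>{..<length d}. d ! i = a}" by auto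
    then show ?thesis
      unfolding cyc_deriv_def by (simp only: sum.inter_filter[OF finite_lessThan])
  qed
  have "cyc_deriv Q a (rotate1 c) =
      (\<Sum>i<?n. if (xs @ [x]) ! i = a then ?S (xs @ [x]) i else 0)
      + (if x = a then ?S (xs @ [x]) ?n else 0)"
    unfolding split Cons rotate1.simps by (simp add: nth_append cong: if_cong)
  also have "(\<Sum>i<?n. if (xs @ [x]) ! i = a then ?S (xs @ [x]) i else 0) =
      (\<Sum>i<?n. if (x # xs) ! Suc i = a then ?S (x # xs) (Suc i) else 0)"
    by (rule sum.cong) (auto simp: nth_append)
  finally show ?thesis
    unfolding split Cons by (simp add: sum.lessThan_Suc_shift add.commute del: sum.lessThan_Suc)
qed

text \<open>Hence the derivative of a rotation class does not depend on the representative.\<close>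
lemma cyc_deriv_rot_class: "d \<in> rot_class c \<Longrightarrow> cyc_deriv Q a d = cyc_deriv Q a c"
proof -
  have "cyc_deriv Q a (rotate n c) = cyc_deriv Q a c" for n
    by (induction n) (simp_all add: cyc_deriv_rotate1)
  then show "d \<in> rot_class c \<Longrightarrow> cyc_deriv Q a d = cyc_deriv Q a c"
    by (auto simp: rot_class_def)
qed

definition deriv_potential ::
    "('v, 'a) quiver \<Rightarrow> 'a \<Rightarrow> 'a potential \<Rightarrow> ('v, 'a) path \<Rightarrow>\<^sub>0 complex" where
  "deriv_potential Q a W = (\<Sum>C\<in>Poly_Mapping.keys W.
     Poly_Mapping.map ((*) (Poly_Mapping.lookup W C)) (cyc_deriv Q a (rot_rep C)))"

text \<open>
  \<^locale>\<open>algebra\<close> from HOL-Algebra is commutative, so algebras are represented by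
  the record \<^type>\<open>module_ext\<close> only, the scalars acting on quotients through representatives.
\<close>
definition quotient_algebra ::
    "('k, 'a, 'm) module_scheme \<Rightarrow> 'a set \<Rightarrow> ('k, 'a set) module" where
  "quotient_algebra A I =
    \<lparr>carrier = carrier (A Quot I),
     monoid.mult = monoid.mult (A Quot I),
     monoid.one = monoid.one (A Quot I),
     ring.zero = ring.zero (A Quot I),
     ring.add = ring.add (A Quot I),
     smult = (\<lambda>z Y. \<Union>a\<in>Y. I +>\<^bsub>A\<^esub> (z \<odot>\<^bsub>A\<^esub> a))\<rparr>"

definition jacobian_algebra ::
    "('v, 'a) qp \<Rightarrow> (complex, (('v, 'a) path \<Rightarrow>\<^sub>0 complex) set) module" where
  "jacobian_algebra QW = (case QW of (Q, W) \<Rightarrow>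
     quotient_algebra (path_algebra Q)
       (Idl\<^bsub>path_algebra Q\<^esub> ((\<lambda>a. deriv_potential Q a W) ` arcs Q)))"


section \<open>Skew group algebras, corner algebras, isomorphisms\<close>

text \<open>
  For a finite group \<open>G\<close> the tensor product of \<open>A\<close> with the group algebra is represented by the
  functions from \<open>G\<close> to \<open>A\<close>; the pure tensor of \<open>a\<close> and \<open>g\<close> is the function
  supported at \<open>g\<close> with value \<open>a\<close>. Pure tensors multiply as expected, see \<open>pure_tensor_mult\<close>.
\<close>
definition skew_group_algebra ::
    "('k, 'a, 'm) module_scheme \<Rightarrow> ('g, 'n) monoid_scheme \<Rightarrow> ('g \<Rightarrow> 'a \<Rightarrow> 'a)
      \<Rightarrow> ('k, 'g \<Rightarrow> 'a) module" where
  "skew_group_algebra A G act =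
    \<lparr>carrier = carrier G \<rightarrow>\<^sub>E carrier A,
     monoid.mult = (\<lambda>u v. \<lambda>k\<in>carrier G. \<Oplus>\<^bsub>A\<^esub>g\<in>carrier G.
        u g \<otimes>\<^bsub>A\<^esub> act g (v (inv\<^bsub>G\<^esub> g \<otimes>\<^bsub>G\<^esub> k))),
     monoid.one = (\<lambda>k\<in>carrier G. if k = \<one>\<^bsub>G\<^esub> then \<one>\<^bsub>A\<^esub> else \<zero>\<^bsub>A\<^esub>),
     ring.zero = (\<lambda>k\<in>carrier G. \<zero>\<^bsub>A\<^esub>),
     ring.add = (\<lambda>u v. \<lambda>k\<in>carrier G. u k \<oplus>\<^bsub>A\<^esub> v k),
     smult = (\<lambda>z u. \<lambda>k\<in>carrier G. z \<odot>\<^bsub>A\<^esub> u k)\<rparr>"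

definition pure_tensor ::
    "('k, 'a, 'm) module_scheme \<Rightarrow> ('g, 'n) monoid_scheme \<Rightarrow> 'a \<Rightarrow> 'g \<Rightarrow> 'g \<Rightarrow> 'a" where
  "pure_tensor A G a g = (\<lambda>k\<in>carrier G. if k = g then a else \<zero>\<^bsub>A\<^esub>)"

lemma pure_tensor_mult:
  fixes A :: "('k, 'a, 'm) module_scheme" and G :: "('g, 'n) monoid_scheme"
  assumes A: "ring A" and G: "group G" and fin: "finite (carrier G)"
    and act: "\<And>g. g \<in> carrier G \<Longrightarrow> act g \<in> ring_hom A A"
    and a: "a \<in> carrier A" and b: "b \<in> carrier A" and g: "g \<in> carrier G" and h: "h \<in> carrier G"
  shows "pure_tensor A G a g \<otimes>\<^bsub>skew_group_algebra A G act\<^esub> pure_tensor A G b h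
    = pure_tensor A G (a \<otimes>\<^bsub>A\<^esub> act g b) (g \<otimes>\<^bsub>G\<^esub> h)"
proof -
  interpret A: ring A by (rule A)
  interpret G: group G by (rule G)
  have act0: "act k \<zero>\<^bsub>A\<^esub> = \<zero>\<^bsub>A\<^esub>" if "k \<in> carrier G" for k
    using ring_hom_zero[OF act[OF that] A A] .
  have actb: "act g b \<in> carrier A"
    using ring_hom_closed[OF act[OF g] b] .
  show ?thesis
  proof
    fix k
    show "(pure_tensor A G a g \<otimes>\<^bsub>skew_group_algebra A G act\<^esub> pure_tensor A G b h) k
      = pure_tensor A G (a \<otimes>\<^bsub>A\<^esub> act g b) (g \<otimes>\<^bsub>G\<^esub> h) k"
    proof (cases "k \<in> carrier G")
      case False
      then show ?thesis by (simp add: skew_group_algebra_def pure_tensor_def)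
    next
      case k: True
      have eq: "inv\<^bsub>G\<^esub> g \<otimes>\<^bsub>G\<^esub> k = h \<longleftrightarrow> k = g \<otimes>\<^bsub>G\<^esub> h"
        using g h k by (metis G.inv_solve_left)
      let ?F = "\<lambda>x. pure_tensor A G a g x \<otimes>\<^bsub>A\<^esub> act x (pure_tensor A G b h (inv\<^bsub>G\<^esub> x \<otimes>\<^bsub>G\<^esub> k))"
      let ?v = "if k = g \<otimes>\<^bsub>G\<^esub> h then a \<otimes>\<^bsub>A\<^esub> act g b else \<zero>\<^bsub>A\<^esub>"
      have F: "?F x = (if g = x then ?v else \<zero>\<^bsub>A\<^esub>)" if x: "x \<in> carrier G" for x
      proof (cases "x = g")
        case True
        then show ?thesis using g h k a eq act0[OF g] by (simp add: pure_tensor_def)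
      next
        case False
        have "pure_tensor A G b h (inv\<^bsub>G\<^esub> x \<otimes>\<^bsub>G\<^esub> k) \<in> carrier A"
          using x k b by (simp add: pure_tensor_def)
        then have "act x (pure_tensor A G b h (inv\<^bsub>G\<^esub> x \<otimes>\<^bsub>G\<^esub> k)) \<in> carrier A"
          using ring_hom_closed[OF act[OF x]] by blast
        then show ?thesis using False x by (simp add: pure_tensor_def)
      qed
      have "(\<Oplus>\<^bsub>A\<^esub>x\<in>carrier G. ?F x) = (\<Oplus>\<^bsub>A\<^esub>x\<in>carrier G. if g = x then ?v else \<zero>\<^bsub>A\<^esub>)"
        by (rule A.finsum_cong') (use F a actb in auto)
      also have "\<dots> = ?v"
        by (rule A.finsum_singleton[OF g fin, of "\<lambda>_. ?v"]) (use a actb in auto)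
      finally show ?thesis
        using k by (simp add: skew_group_algebra_def pure_tensor_def)
    qed
  qed
qed

definition idempotent_in :: "('k, 'a, 'm) module_scheme \<Rightarrow> 'a \<Rightarrow> bool" where
  "idempotent_in A e \<longleftrightarrow> e \<in> carrier A \<and> e \<otimes>\<^bsub>A\<^esub> e = e"

definition corner_algebra :: "('k, 'a, 'm) module_scheme \<Rightarrow> 'a \<Rightarrow> ('k, 'a, 'm) module_scheme" where
  "corner_algebra A e =
     A\<lparr>carrier := {e \<otimes>\<^bsub>A\<^esub> a \<otimes>\<^bsub>A\<^esub> e | a. a \<in> carrier A}, monoid.one := e\<rparr>"

definition algebra_iso ::
    "('k, 'a, 'm) module_scheme \<Rightarrow> ('k, 'b, 'n) module_scheme \<Rightarrow> bool" where
  "algebra_iso A B \<longleftrightarrow>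
    (\<exists>h\<in>ring_iso A B. \<forall>z. \<forall>a\<in>carrier A. h (z \<odot>\<^bsub>A\<^esub> a) = z \<odot>\<^bsub>B\<^esub> h a)"


section \<open>Triples\<close>

text \<open>
  Arrow indices, the labels \<open>k\<close> of the three copies of \<open>X\<close>, and exponents of \<open>omega\<close> are integers in
  \<open>{0, 1, 2}\<close>, with arithmetic modulo 3 written out.
\<close>
type_synonym triple = "int \<times> int \<times> int"

definition Ix :: "int set" where
  "Ix = {0, 1, 2}"

definition simplex :: "int \<Rightarrow> triple set" where
  "simplex s = {(a, b, c). 0 \<le> a \<and> 0 \<le> b \<and> 0 \<le> c \<and> a + b + c = s - 1}"

definition fvec :: "int \<Rightarrow> triple" where
  "fvec i = (if i mod 3 = 0 then (-1, 1, 0) else if i mod 3 = 1 then (0, -1, 1) else (1, 0, -1))"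

fun omega :: "triple \<Rightarrow> triple" where
  "omega (a, b, c) = (b, c, a)"

definition omega_pow :: "int \<Rightarrow> triple \<Rightarrow> triple" where
  "omega_pow j = omega ^^ nat (j mod 3)"

fun lex_gt :: "triple \<Rightarrow> triple \<Rightarrow> bool" (infix \<open>\<succ>\<close> 50) where
  "(a, b, c) \<succ> (a', b', c') \<longleftrightarrow> a > a' \<or> (a = a' \<and> (b > b' \<or> (b = b' \<and> c > c')))"

definition rot_sim :: "triple \<Rightarrow> triple \<Rightarrow> bool" where
  "rot_sim u v \<longleftrightarrow> v \<in> {u, omega u, omega (omega u)}"

definition index_sign :: "triple \<Rightarrow> complex" where
  "index_sign u = (if rot_sim u (0, 1, 2) then 1 else if rot_sim u (0, 2, 1) then -1 else 0)"

definition zeta :: complex where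
  "zeta = exp (2 * of_real pi * \<i> / 3)"

text \<open>Only used for \<open>s = 3t + 1\<close>, when it equals \<open>(t, t, t)\<close>.\<close>
definition Xpt :: "int \<Rightarrow> triple" where
  "Xpt s = ((s - 1) div 3, (s - 1) div 3, (s - 1) div 3)"


section \<open>Type A\<close>

text \<open>The pair \<open>(x, i)\<close> is the arrow from \<open>x\<close> to \<open>x + fvec i\<close> labelled \<open>i\<close>.\<close>
type_synonym arrA = "triple \<times> int"

definition quiverA :: "int \<Rightarrow> (triple, arrA) quiver" where
  "quiverA s =
    \<lparr>verts = simplex s,
     arcs = {(x, i). i \<in> Ix \<and> x \<in> simplex s \<and> x + fvec i \<in> simplex s},
     tail = fst,
     head = (\<lambda>(x, i). x + fvec i)\<rparr>"

fun lamA :: "arrA list \<Rightarrow> complex" where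
  "lamA [(_, i0), (_, i1), (_, i2)] = index_sign (i0, i1, i2)"
| "lamA _ = 0"

lemma lamA_rotate1: "lamA (rotate1 c) = lamA c"
proof (cases "length c = 3")
  case True
  then obtain x y z where "c = [x, y, z]" by (auto simp: numeral_3_eq_3 length_Suc_conv)
  then show ?thesis by (cases x; cases y; cases z) (auto simp: index_sign_def rot_sim_def)
next
  case False
  have "lamA d \<noteq> 0 \<Longrightarrow> length d = 3" for d by (cases d rule: lamA.cases) auto
  then show ?thesis using False by (metis length_rotate1)
qed

definition potentialA :: "int \<Rightarrow> arrA potential" where
  "potentialA s = (\<Sum>C\<in>three_cycles (quiverA s). Poly_Mapping.single C (lamA (rot_rep C)))"

definition PiA where
  "PiA s = jacobian_algebra (quiverA s, potentialA s)"

definition act_arr :: "int \<Rightarrow> arrA \<Rightarrow> arrA" where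
  "act_arr j = (\<lambda>(x, i). (omega_pow j x, (i - j) mod 3))"

definition act_path :: "int \<Rightarrow> (triple, arrA) path \<Rightarrow> (triple, arrA) path" where
  "act_path j = (\<lambda>(x, p). (omega_pow j x, map (act_arr j) p))"

definition act_path_algebra ::
    "int \<Rightarrow> ((triple, arrA) path \<Rightarrow>\<^sub>0 complex) \<Rightarrow> (triple, arrA) path \<Rightarrow>\<^sub>0 complex" where
  "act_path_algebra j a = (\<Sum>p\<in>Poly_Mapping.keys a.
     Poly_Mapping.single (act_path j p) (Poly_Mapping.lookup a p))"

text \<open>The action on \<open>PiA\<close> is induced: a coset is sent to its image.\<close>
definition PiA_skew_Z3 where
  "PiA_skew_Z3 s =
     skew_group_algebra (PiA s) (integer_mod_group 3) (\<lambda>j. image (act_path_algebra j))"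


section \<open>Type D\<close>

text \<open>
  \<open>Copy k\<close> is \<open>X\<^sub>k\<close>. The arrow \<open>\<alpha>\<^sub>i\<^sub>,\<^sub>j\<close> starting at \<open>x\<close> is \<open>Alpha x i j\<close>, and \<open>\<alpha>\<^sub>i\<close> is \<open>Alpha x i 0\<close>.
  Vertices and arrows of the Giovannini--Pasquali quiver have the same names and endpoints, so that
  the two quivers can be compared literally.
\<close>
datatype vertD = Pt triple | Copy int
datatype arrD = Alpha triple int int | Beta int | Gamma int

fun tailD :: "int \<Rightarrow> arrD \<Rightarrow> vertD" where
  "tailD s (Alpha x i j) = Pt x"
| "tailD s (Beta k) = Pt (Xpt s - fvec 0)"
| "tailD s (Gamma k) = Copy k"

fun headD :: "int \<Rightarrow> arrD \<Rightarrow> vertD" where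
  "headD s (Alpha x i j) = Pt (omega_pow j x + fvec i)"
| "headD s (Beta k) = Copy k"
| "headD s (Gamma k) = Pt (Xpt s + fvec 2)"

definition Q0_D :: "int \<Rightarrow> triple set" where
  "Q0_D s = {x \<in> simplex s. x \<succ> omega x \<and> x \<succ> omega (omega x)}"

definition Q1_D :: "int \<Rightarrow> arrD set" where
  "Q1_D s = {Alpha x i j | x i j. x \<in> Q0_D s \<and> i \<in> Ix \<and> j \<in> Ix \<and> omega_pow j x + fvec i \<in> Q0_D s}"

definition quiverD :: "int \<Rightarrow> (vertD, arrD) quiver" where
  "quiverD s =
    \<lparr>verts = Pt ` Q0_D s \<union> (if s mod 3 = 1 then Copy ` Ix else {}),
     arcs = Q1_D s \<union> (if s mod 3 = 1 then Beta ` Ix \<union> Gamma ` Ix else {}),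
     tail = tailD s,
     head = headD s\<rparr>"

text \<open>
  Every closed walk of length 3 is covered: two loops at the same vertex coincide, so three arrows
  of type \<open>\<alpha>\<close> are either distinct or all equal. All rotations of a cycle through \<open>X\<^sub>k\<close> are listed,
  because \<open>lamD\<close> is evaluated on representatives.
\<close>
definition lamD_alpha ::
    "triple \<times> int \<times> int \<Rightarrow> triple \<times> int \<times> int \<Rightarrow> triple \<times> int \<times> int \<Rightarrow> complex" where
  "lamD_alpha = (\<lambda>(x0, i0, j0) (x1, i1, j1) (x2, i2, j2).
    if distinct [(x0, i0, j0), (x1, i1, j1), (x2, i2, j2)] then
      (if (j0 + j1 + j2) mod 3 = 0
       then index_sign ((i0 + j0) mod 3, (i1 - j2) mod 3, i2 mod 3) else 0)
    else if (x0, i0, j0) = (x1, i1, j1) \<and> (x1, i1, j1) = (x2, i2, j2) then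
      index_sign ((i0 + j0) mod 3, (i0 - j0) mod 3, i0 mod 3) / 3
    else 0)"

definition lamD_X :: "int \<Rightarrow> int \<Rightarrow> int \<Rightarrow> complex" where
  "lamD_X i j k = (if (i, j) = (1, 0) then -1 else if (i, j) = (2, 1) then zeta powi k else 0)"

fun lamD :: "arrD list \<Rightarrow> complex" where
  "lamD [Alpha x0 i0 j0, Alpha x1 i1 j1, Alpha x2 i2 j2] =
     lamD_alpha (x0, i0, j0) (x1, i1, j1) (x2, i2, j2)"
| "lamD [Alpha x i j, Beta k, Gamma l] = lamD_X i j k"
| "lamD [Beta k, Gamma l, Alpha x i j] = lamD_X i j k"
| "lamD [Gamma l, Alpha x i j, Beta k] = lamD_X i j k"
| "lamD _ = 0"

lemma mod3_cases: "(x::int) mod 3 = 0 \<or> x mod 3 = 1 \<or> x mod 3 = 2" by presburger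

lemma index_sign_shift:
  "index_sign ((u1 + d) mod 3, (u2 + d) mod 3, (u0 + d) mod 3) = index_sign (u0 mod 3, u1 mod 3, u2 mod 3)"
proof -
  have m: "(x + d) mod 3 = (x mod 3 + d mod 3) mod 3" for x by (simp add: mod_add_eq)
  show ?thesis unfolding m using mod3_cases[of u0] mod3_cases[of u1] mod3_cases[of u2] mod3_cases[of d]
    by (elim disjE) (simp_all add: index_sign_def rot_sim_def)
qed

lemma lamD_rotate1: "lamD (rotate1 c) = lamD c"
proof (cases "length c = 3")
  case False
  have "lamD d \<noteq> 0 \<Longrightarrow> length d = 3" for d by (cases d rule: lamD.cases) auto
  then show ?thesis using False by (metis length_rotate1)
next
  case True
  have alpha: "lamD_alpha p1 p2 p0 = lamD_alpha p0 p1 p2" for p0 p1 p2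
  proof -
    obtain x0 i0 j0 x1 i1 j1 x2 i2 j2
      where p: "p0 = (x0, i0, j0)" "p1 = (x1, i1, j1)" "p2 = (x2, i2, j2)"
      by (metis prod_cases3)
    have d: "distinct [p1, p2, p0] = distinct [p0, p1, p2]" by auto
    have j: "j1 + j2 + j0 = j0 + j1 + j2" by simp
    have "index_sign ((i1 + j1) mod 3, (i2 - j0) mod 3, i0 mod 3) =
       index_sign ((i0 + j0) mod 3, (i1 - j2) mod 3, i2 mod 3)" if "(j0 + j1 + j2) mod 3 = 0"
    proof -
      have "(i1 + j1) mod 3 = (i1 - j2 + - j0) mod 3" using that by presburger
      then show ?thesis using index_sign_shift[of "i1 - j2" "-j0" i2 "i0 + j0"] by simp
    qed
    note I = this
    have E: "(if p1 = p2 \<and> p2 = p0 then index_sign ((i1 + j1) mod 3, (i1 - j1) mod 3, i1 mod 3) / 3 else 0)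
      = (if p0 = p1 \<and> p1 = p2 then index_sign ((i0 + j0) mod 3, (i0 - j0) mod 3, i0 mod 3) / 3 else 0)"
      using p by auto
    have 1: "lamD_alpha p1 p2 p0 = (if distinct [p1, p2, p0]
       then (if (j0 + j1 + j2) mod 3 = 0
             then index_sign ((i1 + j1) mod 3, (i2 - j0) mod 3, i0 mod 3) else 0)
       else (if p1 = p2 \<and> p2 = p0 then index_sign ((i1 + j1) mod 3, (i1 - j1) mod 3, i1 mod 3) / 3 else 0))"
      unfolding lamD_alpha_def p prod.case j by (rule refl)
    have 2: "lamD_alpha p0 p1 p2 = (if distinct [p0, p1, p2]
       then (if (j0 + j1 + j2) mod 3 = 0
             then index_sign ((i0 + j0) mod 3, (i1 - j2) mod 3, i2 mod 3) else 0)
       else (if p0 = p1 \<and> p1 = p2 then index_sign ((i0 + j0) mod 3, (i0 - j0) mod 3, i0 mod 3) / 3 else 0))"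
      unfolding lamD_alpha_def p prod.case by (rule refl)
    show ?thesis
      unfolding 1 2 d E using I by (cases "(j0 + j1 + j2) mod 3 = 0") (simp_all only: if_True if_False refl)
  qed
  obtain x y z where "c = [x, y, z]" using True by (auto simp: numeral_3_eq_3 length_Suc_conv)
  then show ?thesis by (cases x; cases y; cases z) (simp_all add: alpha)
qed

definition potentialD :: "int \<Rightarrow> arrD potential" where
  "potentialD s = (\<Sum>C\<in>three_cycles (quiverD s). Poly_Mapping.single C (lamD (rot_rep C)))"

definition PiD where
  "PiD s = jacobian_algebra (quiverD s, potentialD s)"


section \<open>The Giovannini--Pasquali construction for type A\<close>

definition V1_A :: "int \<Rightarrow> triple set" where
  "V1_A s = {x \<in> verts (quiverA s). x \<succ> omega x \<and> x \<succ> omega (omega x)}"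

definition arr_orbit :: "arrA \<Rightarrow> arrA set" where
  "arr_orbit a = (\<lambda>j. act_arr j a) ` Ix"

definition tilde_alphas :: "int \<Rightarrow> arrD set" where
  "tilde_alphas s = {Alpha x i j | x i j.
     \<exists>orb \<in> arr_orbit ` arcs (quiverA s).
       (\<forall>a\<in>orb. omega (tail (quiverA s) a) \<noteq> tail (quiverA s) a
              \<and> omega (head (quiverA s) a) \<noteq> head (quiverA s) a)
       \<and> (\<exists>b\<in>orb. head (quiverA s) b \<in> V1_A s \<and> x \<in> V1_A s \<and> j \<in> Ix \<and> b = (omega_pow j x, i))}"

definition tilde_quiverA :: "int \<Rightarrow> (vertD, arrD) quiver" where
  "tilde_quiverA s =
    \<lparr>verts = Pt ` V1_A s \<union> (if s mod 3 = 1 then Copy ` Ix else {}),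
     arcs = tilde_alphas s \<union> (if s mod 3 = 1 then Beta ` Ix \<union> Gamma ` Ix else {}),
     tail = tailD s,
     head = headD s\<rparr>"

definition through_X :: "int \<Rightarrow> arrA list \<Rightarrow> bool" where
  "through_X s c \<longleftrightarrow> s mod 3 = 1 \<and> (\<exists>a\<in>set c. tail (quiverA s) a = Xpt s)"

definition cycle_orbit :: "arrA list set \<Rightarrow> arrA list set set" where
  "cycle_orbit C = (\<lambda>j. map (act_arr j) ` C) ` Ix"

text \<open>
  Admissible choices of the set \<open>C\<^sub>1\<close>: exactly one closed walk, starting in \<open>V1_A\<close>, for each
  orbit of rotation classes avoiding \<open>X\<close>.
\<close>
definition is_C1 :: "int \<Rightarrow> arrA list set \<Rightarrow> bool" where
  "is_C1 s C1 \<longleftrightarrow>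
     C1 \<subseteq> {c \<in> closed_3_walks (quiverA s). \<not> through_X s c \<and> tail (quiverA s) (hd c) \<in> V1_A s}
     \<and> (\<forall>C\<in>three_cycles (quiverA s). (\<forall>c\<in>C. \<not> through_X s c) \<longrightarrow>
          (\<exists>!c. c \<in> C1 \<and> rot_class c \<in> cycle_orbit C))"

fun tilde_cycle :: "int \<Rightarrow> arrA list \<Rightarrow> arrD list" where
  "tilde_cycle s [(x, l0), (y', l1), (z', l2)] =
    (let j0 = (THE j. j \<in> Ix \<and> omega_pow j y' \<in> V1_A s);
         j2 = (THE j. j \<in> Ix \<and> omega_pow (- j) z' \<in> V1_A s);
         j1 = (- (j0 + j2)) mod 3;
         y = omega_pow j0 y';
         z = omega_pow (- j2) z'
     in [Alpha x ((l0 - j0) mod 3) j0, Alpha y ((l1 + j2) mod 3) j1, Alpha z (l2 mod 3) j2])"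
| "tilde_cycle s _ = []"

definition c_minus :: "int \<Rightarrow> arrA list" where
  "c_minus s = [(Xpt s + fvec 2, 1), (Xpt s - fvec 0, 0), (Xpt s, 2)]"

definition c_plus :: "int \<Rightarrow> arrA list" where
  "c_plus s = [(Xpt s + fvec 2, 0), (Xpt s - fvec 1, 1), (Xpt s, 2)]"

definition cycles_C2 :: "int \<Rightarrow> arrA list set" where
  "cycles_C2 s = (if s mod 3 = 1 then {c_minus s, c_plus s} else {})"

definition p_exp :: "int \<Rightarrow> arrA list \<Rightarrow> int" where
  "p_exp s c = (if c = c_plus s then -1 else 0)"

definition tilde_cycle_X :: "int \<Rightarrow> arrA list \<Rightarrow> int \<Rightarrow> arrD list" where
  "tilde_cycle_X s c k =
    (if c = c_plus s then [Alpha (Xpt s + fvec 2) 2 1, Beta k, Gamma k]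
     else [Alpha (Xpt s + fvec 2) 1 0, Beta k, Gamma k])"

definition tilde_potentialA :: "int \<Rightarrow> arrA list set \<Rightarrow> arrD potential" where
  "tilde_potentialA s C1 =
     (\<Sum>c\<in>C1. Poly_Mapping.single (rot_class (tilde_cycle s c))
        (lamA c * of_nat (card (cycle_orbit (rot_class c))) / 3))
     + (\<Sum>c\<in>cycles_C2 s. \<Sum>k\<in>Ix. Poly_Mapping.single (rot_class (tilde_cycle_X s c k))
        (lamA c * zeta powi (- p_exp s c * k)))"


subsection \<open>Admissible choices of cycle representatives exist\<close>

lemma omega_pow_cases: "omega_pow j x = (if j mod 3 = 0 then x else if j mod 3 = 1 then omega x else omega (omega x))"
  using mod3_cases[of j] by (auto simp: omega_pow_def numeral_2_eq_2)

lemma omega3[simp]: "omega (omega (omega x)) = x" by (cases x) simp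

lemma omega_pow_add: "omega_pow j (omega_pow k x) = omega_pow (j + k) x"
  using mod3_cases[of j] mod3_cases[of k] mod_add_eq[of j 3 k, symmetric]
  by (elim disjE) (simp_all add: omega_pow_cases)

lemma act_arr_add: "act_arr j (act_arr k a) = act_arr (j + k) a"
  by (cases a) (simp add: act_arr_def omega_pow_add mod_diff_left_eq algebra_simps)

lemma act_arr_0: "a \<in> arcs (quiverA s) \<Longrightarrow> act_arr 0 a = a"
  by (auto simp: act_arr_def quiverA_def omega_pow_cases Ix_def)

lemma omega_pow_f: "omega_pow j (x + fvec i) = omega_pow j x + fvec ((i - j) mod 3)"
  using mod3_cases[of j] mod3_cases[of i] mod_diff_eq[of i 3 j, symmetric]
  by (elim disjE) (cases x; simp add: omega_pow_cases fvec_def)+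

lemma omega_pow_simplex: "omega_pow j x \<in> simplex s \<longleftrightarrow> x \<in> simplex s"
  by (cases x) (auto simp: omega_pow_cases simplex_def)

lemma act_arr_arcs: "a \<in> arcs (quiverA s) \<Longrightarrow> act_arr j a \<in> arcs (quiverA s)
  \<and> tail (quiverA s) (act_arr j a) = omega_pow j (tail (quiverA s) a)
  \<and> head (quiverA s) (act_arr j a) = omega_pow j (head (quiverA s) a)"
proof -
  assume a: "a \<in> arcs (quiverA s)"
  have "(i - j) mod 3 \<in> Ix" for i using mod3_cases[of "i - j"] by (auto simp: Ix_def)
  then show ?thesis using a
    by (cases a) (simp add: quiverA_def act_arr_def omega_pow_f[symmetric] omega_pow_simplex)
qed

lemma act_walk: "pre_digraph.awalk (quiverA s) u c v \<Longrightarrow>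
   pre_digraph.awalk (quiverA s) (omega_pow j u) (map (act_arr j) c) (omega_pow j v)"
proof -
  have "set c \<subseteq> arcs (quiverA s) \<Longrightarrow> pre_digraph.cas (quiverA s) u c v \<Longrightarrow> pre_digraph.cas (quiverA s) (omega_pow j u) (map (act_arr j) c) (omega_pow j v)"
    by (induction c arbitrary: u) (auto simp: pre_digraph.cas.simps act_arr_arcs)
  moreover have "verts (quiverA s) = simplex s" by (simp add: quiverA_def)
  ultimately show "pre_digraph.awalk (quiverA s) u c v \<Longrightarrow> ?thesis"
    using act_arr_arcs[of _ s j] omega_pow_simplex[of j u s]
    by (auto simp only: pre_digraph.awalk_def set_map)
qed

lemma orbit_walk: "cycle_orbit (rot_class c) = (\<lambda>j. rot_class (map (act_arr j) c)) ` Ix"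
  by (auto simp: cycle_orbit_def rot_class_def image_image rotate_map)

lemma act_mod: "act_arr (j mod 3) a = act_arr j a"
  by (cases a) (simp add: act_arr_def omega_pow_def mod_diff_right_eq)

lemma orbit_UNIV: "cycle_orbit (rot_class c) = range (\<lambda>j. rot_class (map (act_arr j) c))"
proof
  show "range (\<lambda>j. rot_class (map (act_arr j) c)) \<subseteq> cycle_orbit (rot_class c)"
  proof
    fix C assume "C \<in> range (\<lambda>j. rot_class (map (act_arr j) c))"
    then obtain j where C: "C = rot_class (map (act_arr j) c)" by blast
    have "act_arr j = act_arr (j mod 3)" by (rule ext) (simp add: act_mod)
    moreover have "j mod 3 \<in> Ix" using mod3_cases[of j] by (auto simp: Ix_def)
    ultimately show "C \<in> cycle_orbit (rot_class c)" unfolding C orbit_walk by simp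
  qed
qed (auto simp: orbit_walk)

lemma orbit_eq:
  assumes "C \<in> cycle_orbit (rot_class c)"
  shows "cycle_orbit C = cycle_orbit (rot_class c)"
proof -
  obtain k where k: "C = rot_class (map (act_arr k) c)" using assms by (auto simp: orbit_UNIV)
  have "cycle_orbit C = (\<lambda>j. rot_class (map (act_arr j) c)) ` range (\<lambda>j. j + k)"
    by (simp only: k orbit_UNIV image_image map_map o_def act_arr_add)
  also have "range (\<lambda>j. j + k) = UNIV" by (rule surjI[of _ "\<lambda>j. j - k"]) simp
  finally show ?thesis by (simp add: orbit_UNIV)
qed

lemma V1_ex: assumes "x \<in> simplex s" "\<not> (s mod 3 = 1 \<and> x = Xpt s)"
  shows "\<exists>j\<in>Ix. omega_pow j x \<in> V1_A s"
proof -
  obtain a b c where x: "x = (a,b,c)" by (cases x)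
  have "\<not> (a = b \<and> b = c)"
  proof
    assume h: "a = b \<and> b = c"
    then have "s = 3 * a + 1" using assms x by (simp add: simplex_def)
    then show False using assms h x by (simp add: Xpt_def)
  qed
  then show ?thesis using assms(1) unfolding x V1_A_def
    by (simp add: Ix_def omega_pow_cases quiverA_def simplex_def) (smt (verit))
qed

lemma C1_exists: "\<exists>C1. is_C1 s C1"
proof -
  let ?Q = "quiverA s"
  define good where "good = {c \<in> closed_3_walks ?Q. \<not> through_X s c \<and> tail ?Q (hd c) \<in> V1_A s}"
  define T where "T = {C \<in> three_cycles ?Q. \<forall>c\<in>C. \<not> through_X s c}"
  have ex: "\<exists>c\<in>good. rot_class c \<in> cycle_orbit C" if "C \<in> T" for C
  proof -
    obtain c u where c: "C = rot_class c" "length c = 3" "pre_digraph.awalk ?Q u c u"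
      using \<open>C \<in> T\<close> by (auto simp: T_def three_cycles_def closed_3_walks_def)
    have "c \<in> C" unfolding c rot_class_def by (rule range_eqI[of _ _ 0]) simp
    then have nX: "\<not> through_X s c" using that by (auto simp: T_def)
    have arcs: "set c \<subseteq> arcs ?Q" and u: "u \<in> simplex s" "tail ?Q (hd c) = u"
      using c(2,3) by (cases c; auto simp: pre_digraph.awalk_def pre_digraph.cas.simps quiverA_def)+
    have "hd c \<in> set c" using c(2) by (cases c) auto
    with nX u obtain j where j: "omega_pow j u \<in> V1_A s" 
      using V1_ex[of u s] by (auto simp: through_X_def)
    let ?d = "map (act_arr j) c"
    have w: "pre_digraph.awalk ?Q (omega_pow j u) ?d (omega_pow j u)" using act_walk[OF c(3)] .
    have fixX: "omega_pow j x = Xpt s \<longleftrightarrow> x = Xpt s" for x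
      by (cases x) (auto simp: omega_pow_cases Xpt_def)
    have "\<not> through_X s ?d"
      using nX arcs by (auto simp: through_X_def act_arr_arcs fixX subset_iff)
    moreover have "tail ?Q (hd ?d) = omega_pow j u"
      using w c(2) by (cases c) (auto simp: pre_digraph.awalk_def pre_digraph.cas.simps)
    moreover have "?d \<in> closed_3_walks ?Q" unfolding closed_3_walks_def
      by (intro CollectI conjI exI[of _ "omega_pow j u"] w) (simp add: c(2))
    ultimately have "?d \<in> good" using j by (simp add: good_def)
    then show ?thesis unfolding c orbit_UNIV by blast
  qed
  define ch where "ch orb = (SOME c. c \<in> good \<and> rot_class c \<in> orb)" for orb
  have ch: "ch (cycle_orbit C) \<in> good" "rot_class (ch (cycle_orbit C)) \<in> cycle_orbit C" if "C \<in> T" for C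
    using someI_ex[of "\<lambda>c. c \<in> good \<and> rot_class c \<in> cycle_orbit C"] ex[OF that] unfolding ch_def by blast+
  have "is_C1 s (ch ` cycle_orbit ` T)"
    unfolding is_C1_def good_def[symmetric]
  proof (intro conjI ballI impI)
    show "ch ` cycle_orbit ` T \<subseteq> good" using ch by auto
    fix C assume "C \<in> three_cycles ?Q" "\<forall>c\<in>C. \<not> through_X s c"
    then have C: "C \<in> T" by (simp add: T_def)
    show "\<exists>!c. c \<in> ch ` cycle_orbit ` T \<and> rot_class c \<in> cycle_orbit C"
    proof (rule ex1I[of _ "ch (cycle_orbit C)"])
      show "ch (cycle_orbit C) \<in> ch ` cycle_orbit ` T \<and> rot_class (ch (cycle_orbit C)) \<in> cycle_orbit C"
        using C ch by auto
      fix d assume d: "d \<in> ch ` cycle_orbit ` T \<and> rot_class d \<in> cycle_orbit C"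
      then obtain C' where C': "C' \<in> T" "d = ch (cycle_orbit C')" by auto
      have eq: "cycle_orbit D = cycle_orbit C''" if "C'' \<in> T" "D \<in> cycle_orbit C''" for D C''
        using that orbit_eq by (auto simp: T_def three_cycles_def)
      have "cycle_orbit (rot_class d) = cycle_orbit C" using eq[OF C] d by blast
      moreover have "cycle_orbit (rot_class d) = cycle_orbit C'"
        unfolding C'(2) by (rule eq[OF C'(1) ch(2)[OF C'(1)]])
      ultimately have "cycle_orbit C' = cycle_orbit C" by (rule trans[OF sym, rotated])
      then show "d = ch (cycle_orbit C)" unfolding C'(2) by (rule arg_cong)
    qed
  qed
  then show ?thesis by blast
qed

end

theory Submission
  imports Defs
begin

text \<open>
  Both halves of the theorem come from one description of the rotation action. Every vertex \<open>v\<close> of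
  type A other than the fixed point \<open>X\<close> is a rotation of a unique lexicographically dominant
  vertex \<open>rep v\<close>, by an exponent \<open>level v\<close>. Rotating an arrow until its head is dominant turns it
  into an arrow \<open>\<alpha>\<close> of type D, called \<open>twist\<close>. The twist is constant on orbits, and an arrow of
  type D with tail \<open>rep v\<close> is the twist of exactly one arrow with tail \<open>v\<close> (\<open>lift_arrow\<close>,
  \<open>twist_inj\<close>). So walks in the arrows \<open>\<alpha>\<close> lift uniquely once a vertex above the start is chosen.
  A lifted walk changes the level by minus the sum of the exponents \<open>j\<close>, hence the lift of a
  closed walk is closed exactly when this sum vanishes modulo 3, which is the condition in the
  potential of type D (\<open>twist_walk_bij\<close>). Rotation shifts all three labels of a cycle by the same
  amount and \<open>index_sign\<close> does not see such a shift, so the signs agree as well (\<open>weightD_twist\<close>).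

  For the equality of potentials, both sides are rewritten as sums over closed walks instead of
  rotation classes. The cube of a loop gives one walk where every other cycle gives three, which
  absorbs the coefficient \<open>1/3\<close> of loops. A cycle \<open>c\<close> of \<open>C\<^sub>1\<close> stands for
  \<open>3 * card (cycle_orbit (rot_class c))\<close> walks of type A (\<open>card_orbit_walks\<close>), and every walk of
  type D of degree 0 has three lifts (\<open>sum_walks_off\<close>). The cycles through \<open>X\<close> are listed
  (\<open>sum_walks_X\<close>).

  For the isomorphism, the elements \<open>p \<otimes> g\<close> with \<open>p\<close> a path of type A and \<open>g\<close> in \<open>{0, 1, 2}\<close> are a
  basis of the skew group algebra of the path algebra. Let \<open>\<eta>\<close> be the sum of \<open>e\<^sub>x \<otimes> 0\<close> over the
  dominant vertices and \<open>X\<close>. The corner cut out by \<open>\<eta>\<close> has as basis those \<open>p \<otimes> g\<close> for which \<open>p\<close>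
  leads from a vertex of level 0 to the \<open>g\<close>-th rotation of a vertex of level 0 (\<open>KP g\<close>). They are
  mapped to the path algebra of type D arrow by arrow: off \<open>X\<close> by the twist, while \<open>e\<^sub>X \<otimes> g\<close> goes
  to the sum of the trivial paths at the three copies of \<open>X\<close>, weighted by the values of the three
  characters at \<open>g\<close>. The resulting map \<open>Psi\<close> is multiplicative on the corner (\<open>Psi_star\<close>). It is
  onto because every arrow \<open>\<alpha>\<close> is a twist and Fourier inversion separates the copies (\<open>Psi_surj\<close>),
  and \<open>Theta\<close>, which sends each vertex and arrow of type D to an explicit element of the corner,
  is a left inverse (\<open>Theta_Psi\<close>). So the path algebra of type D is the corner of the skew group
  algebra of the path algebra of type A, before any relations are imposed.

  It remains to compare the relations. By the lifting of closed walks, the derivative by \<open>\<alpha>\<close> is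
  the image of a derivative of type A (\<open>relation_Alpha\<close>); the derivatives by \<open>\<beta>\<^sub>k\<close> and \<open>\<gamma>\<^sub>k\<close> are
  the components at \<open>X\<^sub>k\<close> of the images of the derivatives by the arrows into and out of \<open>X\<close>
  (\<open>relation_Beta\<close>, \<open>relation_Gamma\<close>). Therefore an element lies in the Jacobian ideal of type D
  if and only if all its components under \<open>Theta\<close> lie in that of type A (\<open>ID_iff\<close>), and passing to
  cosets gives the isomorphism (\<open>PiD_iso_corner\<close>).
\<close>

section \<open>Linear maps between spaces of finitely supported functions\<close>

definition scale :: "complex \<Rightarrow> ('b \<Rightarrow>\<^sub>0 complex) \<Rightarrow> 'b \<Rightarrow>\<^sub>0 complex" where
  "scale z = Poly_Mapping.map ((*) z)"

abbreviation basis :: "'b \<Rightarrow> 'b \<Rightarrow>\<^sub>0 complex" where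
  "basis p \<equiv> Poly_Mapping.single p 1"

lemma lookup_scale [simp]: "Poly_Mapping.lookup (scale z a) p = z * Poly_Mapping.lookup a p"
  by (simp add: scale_def Poly_Mapping.map.rep_eq when_def)

lemma scale_add: "scale z (a + b) = scale z a + scale z b"
  by (rule poly_mapping_eqI) (simp add: lookup_add algebra_simps)

lemma scale_add_left: "scale (y + z) a = scale y a + scale z a"
  by (rule poly_mapping_eqI) (simp add: lookup_add algebra_simps)

lemma scale_scale [simp]: "scale y (scale z a) = scale (y * z) a"
  by (rule poly_mapping_eqI) (simp add: algebra_simps)

lemma scale_one [simp]: "scale 1 a = a"
  by (rule poly_mapping_eqI) simp

lemma scale_zero [simp]: "scale z 0 = 0" "scale 0 a = 0"
  by (rule poly_mapping_eqI, simp)+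

lemma scale_single [simp]: "scale z (Poly_Mapping.single p y) = Poly_Mapping.single p (z * y)"
  by (rule poly_mapping_eqI) (simp add: lookup_single when_def)

lemma scale_sum: "scale z (\<Sum>x\<in>A. f x) = (\<Sum>x\<in>A. scale z (f x))"
  by (induction A rule: infinite_finite_induct) (simp_all add: scale_add)

lemma scale_sum_left: "scale (\<Sum>x\<in>A. f x) a = (\<Sum>x\<in>A. scale (f x) a)"
  by (induction A rule: infinite_finite_induct) (simp_all add: scale_add_left)

lemma scale_minus_one: "scale (- 1) a = - a"
  by (rule poly_mapping_eqI) simp

lemma keys_scale: "Poly_Mapping.keys (scale z a) \<subseteq> Poly_Mapping.keys a"
  by (auto simp: in_keys_iff)

lemma basis_expansion: "a = (\<Sum>p\<in>Poly_Mapping.keys a. scale (Poly_Mapping.lookup a p) (basis p))"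
  by (rule poly_mapping_eqI) (simp add: lookup_sum lookup_single when_def sum.delta' in_keys_iff)

definition lin :: "(('b \<Rightarrow>\<^sub>0 complex) \<Rightarrow> ('c \<Rightarrow>\<^sub>0 complex)) \<Rightarrow> bool" where
  "lin F \<longleftrightarrow> (\<forall>a b. F (a + b) = F a + F b) \<and> (\<forall>z a. F (scale z a) = scale z (F a))"

named_theorems lin_intros

lemma lin_add: "lin F \<Longrightarrow> F (a + b) = F a + F b"
  by (simp add: lin_def)

lemma lin_scale: "lin F \<Longrightarrow> F (scale z a) = scale z (F a)"
  by (simp add: lin_def)

lemma lin_zero: "lin F \<Longrightarrow> F 0 = 0"
  using lin_scale[of F 0 0] by simp

lemma lin_uminus: "lin F \<Longrightarrow> F (- a) = - F a"
  using lin_scale[of F "- 1" a] by (simp add: scale_minus_one)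

lemma lin_diff: "lin F \<Longrightarrow> F (a - b) = F a - F b"
  using lin_add[of F a "- b"] by (simp add: lin_uminus)

lemma lin_sum: "lin F \<Longrightarrow> F (\<Sum>x\<in>A. f x) = (\<Sum>x\<in>A. F (f x))"
  by (induction A rule: infinite_finite_induct) (simp_all add: lin_zero lin_add)

lemma lin_ident [lin_intros]: "lin (\<lambda>a. a)"
  by (simp add: lin_def)

lemma lin_const_zero [lin_intros]: "lin (\<lambda>a. 0)"
  by (simp add: lin_def)

lemma lin_comp: "lin F \<Longrightarrow> lin G \<Longrightarrow> lin (\<lambda>a. F (G a))"
  by (simp add: lin_def)

lemma lin_plus [lin_intros]: "lin F \<Longrightarrow> lin G \<Longrightarrow> lin (\<lambda>a. F a + G a)"
  by (simp add: lin_def scale_add add.assoc add.left_commute)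

lemma lin_scaled [lin_intros]: "lin F \<Longrightarrow> lin (\<lambda>a. scale z (F a))"
  by (simp add: lin_def scale_add mult.commute)

lemma lin_sums [lin_intros]: "(\<And>x. x \<in> A \<Longrightarrow> lin (F x)) \<Longrightarrow> lin (\<lambda>a. \<Sum>x\<in>A. F x a)"
  by (induction A rule: infinite_finite_induct) (auto intro: lin_intros)

definition lin_ext :: "('b \<Rightarrow> ('c \<Rightarrow>\<^sub>0 complex)) \<Rightarrow> ('b \<Rightarrow>\<^sub>0 complex) \<Rightarrow> 'c \<Rightarrow>\<^sub>0 complex" where
  "lin_ext f a = (\<Sum>p\<in>Poly_Mapping.keys a. scale (Poly_Mapping.lookup a p) (f p))"

lemma lin_ext_superset:
  "finite A \<Longrightarrow> Poly_Mapping.keys a \<subseteq> A \<Longrightarrow>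
    lin_ext f a = (\<Sum>p\<in>A. scale (Poly_Mapping.lookup a p) (f p))"
  unfolding lin_ext_def by (rule sum.mono_neutral_left) (auto simp: in_keys_iff)

lemma lin_lin_ext [lin_intros]: "lin (lin_ext f)"
proof -
  have "lin_ext f (a + b) = lin_ext f a + lin_ext f b" for a b
  proof -
    let ?A = "Poly_Mapping.keys a \<union> Poly_Mapping.keys b"
    have "Poly_Mapping.keys (a + b) \<subseteq> ?A" by (rule Poly_Mapping.keys_add)
    then show ?thesis
      by (simp add: lin_ext_superset[of ?A] lookup_add scale_add_left sum.distrib)
  qed
  moreover have "lin_ext f (scale z a) = scale z (lin_ext f a)" for z a
    using keys_scale[of z a]
    by (simp add: lin_ext_superset[of "Poly_Mapping.keys a"] scale_sum)
  ultimately show ?thesis by (simp add: lin_def)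
qed

lemma lin_ext_basis [simp]: "lin_ext f (basis p) = f p"
  by (simp add: lin_ext_def)

lemma lin_ext_single: "lin_ext f (Poly_Mapping.single p z) = scale z (f p)"
  using lin_scale[OF lin_lin_ext, of f z "basis p"] by simp

lemmas lin_ext_add [simp] = lin_add[OF lin_lin_ext]
lemmas lin_ext_scale [simp] = lin_scale[OF lin_lin_ext]
lemmas lin_ext_zero [simp] = lin_zero[OF lin_lin_ext]
lemmas lin_ext_diff [simp] = lin_diff[OF lin_lin_ext]
lemmas lin_ext_sum = lin_sum[OF lin_lin_ext]

lemma lin_expansion:
  assumes "lin F"
  shows "F a = (\<Sum>p\<in>Poly_Mapping.keys a. scale (Poly_Mapping.lookup a p) (F (basis p)))"
proof -
  have "F a = F (\<Sum>p\<in>Poly_Mapping.keys a. scale (Poly_Mapping.lookup a p) (basis p))"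
    by (rule arg_cong[OF basis_expansion])
  then show ?thesis
    by (simp only: lin_sum[OF assms] lin_scale[OF assms])
qed

text \<open>Identities between multilinear expressions are proved below by applying this rule once for
  each argument, which leaves a statement about paths.\<close>
lemma lin_eq_on:
  assumes "lin F" "lin G" "\<And>p. p \<in> Poly_Mapping.keys a \<Longrightarrow> F (basis p) = G (basis p)"
  shows "F a = G a"
  unfolding lin_expansion[OF assms(1), of a] lin_expansion[OF assms(2), of a]
  by (rule sum.cong) (simp_all only: assms(3))

definition subspace :: "('b \<Rightarrow>\<^sub>0 complex) set \<Rightarrow> bool" where
  "subspace U \<longleftrightarrow> 0 \<in> U \<and> (\<forall>a\<in>U. \<forall>b\<in>U. a + b \<in> U) \<and> (\<forall>z. \<forall>a\<in>U. scale z a \<in> U)"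

lemma subspace_sum: "subspace U \<Longrightarrow> (\<And>x. x \<in> A \<Longrightarrow> f x \<in> U) \<Longrightarrow> (\<Sum>x\<in>A. f x) \<in> U"
  by (induction A rule: infinite_finite_induct) (auto simp: subspace_def)

lemma lin_mem:
  assumes "lin F" "subspace U" "\<And>p. p \<in> Poly_Mapping.keys a \<Longrightarrow> F (basis p) \<in> U"
  shows "F a \<in> U"
  unfolding lin_expansion[OF assms(1), of a]
  using assms(2,3) by (intro subspace_sum) (simp_all add: subspace_def)

definition supported :: "'b set \<Rightarrow> ('b \<Rightarrow>\<^sub>0 complex) set" where
  "supported B = {a. Poly_Mapping.keys a \<subseteq> B}"

lemma subspace_supported: "subspace (supported B)"
  by (auto simp: subspace_def supported_def dest!: subsetD[OF Poly_Mapping.keys_add] subsetD[OF keys_scale])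

lemma basis_supported [simp]: "basis p \<in> supported B \<longleftrightarrow> p \<in> B"
  by (simp add: supported_def)

section \<open>Path algebras\<close>

text \<open>The product of two paths is a single path or 0, so it is kept apart from its bilinear
  extension.\<close>
definition pconcat :: "('v, 'a) quiver \<Rightarrow> ('v, 'a) path \<Rightarrow> ('v, 'a) path \<Rightarrow> ('v, 'a) path \<Rightarrow>\<^sub>0 complex" where
  "pconcat Q p q = (if path_end Q p = fst q then basis (fst p, snd p @ snd q) else 0)"

definition pmult ::
    "('v, 'a) quiver \<Rightarrow> (('v, 'a) path \<Rightarrow>\<^sub>0 complex) \<Rightarrow> (('v, 'a) path \<Rightarrow>\<^sub>0 complex) \<Rightarrow> ('v, 'a) path \<Rightarrow>\<^sub>0 complex" where
  "pmult Q a b = lin_ext (\<lambda>p. lin_ext (pconcat Q p) b) a"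

lemma pmult_basis: "pmult Q (basis p) (basis q) = pconcat Q p q"
  by (simp add: pmult_def)

lemma lin_pmult_left [lin_intros]: "lin F \<Longrightarrow> lin (\<lambda>a. pmult Q (F a) b)"
  unfolding pmult_def by (rule lin_comp[OF lin_lin_ext])

lemma lin_pmult_right [lin_intros]: "lin F \<Longrightarrow> lin (\<lambda>b. pmult Q a (F b))"
  unfolding pmult_def lin_ext_def[of _ a]
  by (intro lin_intros lin_comp[OF lin_lin_ext])

lemmas pmult_add_left = lin_add[OF lin_pmult_left[OF lin_ident]]
lemmas pmult_add_right = lin_add[OF lin_pmult_right[OF lin_ident]]
lemmas pmult_scale_left = lin_scale[OF lin_pmult_left[OF lin_ident]]
lemmas pmult_scale_right = lin_scale[OF lin_pmult_right[OF lin_ident]]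
lemmas pmult_zero_left [simp] = lin_zero[OF lin_pmult_left[OF lin_ident]]
lemmas pmult_zero_right [simp] = lin_zero[OF lin_pmult_right[OF lin_ident]]
lemmas pmult_sum_left = lin_sum[OF lin_pmult_left[OF lin_ident]]
lemmas pmult_sum_right = lin_sum[OF lin_pmult_right[OF lin_ident]]

lemma pmult_single: "pmult Q (Poly_Mapping.single p y) (Poly_Mapping.single q z) = scale (y * z) (pconcat Q p q)"
  using pmult_scale_left[of Q y "basis p" "Poly_Mapping.single q z"]
    pmult_scale_right[of Q "basis p" z "basis q"]
  by (simp add: pmult_basis)

lemma path_end_append: "path_end Q (u, p) = fst q \<Longrightarrow> path_end Q (u, p @ snd q) = path_end Q q"
  by (auto simp: path_end_def)

lemma pmult_assoc: "pmult Q (pmult Q a b) c = pmult Q a (pmult Q b c)"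
proof -
  have basis: "pmult Q (pmult Q (basis p) (basis q)) (basis r) = pmult Q (basis p) (pmult Q (basis q) (basis r))" for p q r
    using path_end_append[of Q "fst p" "snd p" q]
    by (simp add: pmult_basis pconcat_def)
  have 1: "pmult Q (pmult Q (basis p) (basis q)) c = pmult Q (basis p) (pmult Q (basis q) c)" for p q
    by (rule lin_eq_on[where a = c and F = "pmult Q (pmult Q (basis p) (basis q))"
          and G = "\<lambda>c. pmult Q (basis p) (pmult Q (basis q) c)"])
      (intro lin_intros basis)+
  have 2: "pmult Q (pmult Q (basis p) b) c = pmult Q (basis p) (pmult Q b c)" for p
    by (rule lin_eq_on[where a = b and F = "\<lambda>b. pmult Q (pmult Q (basis p) b) c"
          and G = "\<lambda>b. pmult Q (basis p) (pmult Q b c)"])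
      (intro lin_intros 1)+
  show ?thesis
    by (rule lin_eq_on[where a = a and F = "\<lambda>a. pmult Q (pmult Q a b) c"
          and G = "\<lambda>a. pmult Q a (pmult Q b c)"])
      (intro lin_intros 2)+
qed

lemma path_algebra_simps:
  "carrier (path_algebra Q) = supported (paths Q)"
  "monoid.mult (path_algebra Q) = pmult Q"
  "monoid.one (path_algebra Q) = (\<Sum>v\<in>verts Q. basis (v, []))"
  "ring.zero (path_algebra Q) = 0"
  "ring.add (path_algebra Q) = (+)"
  "smult (path_algebra Q) = scale"
proof -
  have eq: "(if path_end Q p = fst q then Poly_Mapping.single (fst p, snd p @ snd q) (x * y) else 0)
      = scale x (scale y (pconcat Q p q))" for p q x y
    by (simp add: pconcat_def)
  have "monoid.mult (path_algebra Q) = (\<lambda>a b. \<Sum>p\<in>Poly_Mapping.keys a. \<Sum>q\<in>Poly_Mapping.keys b.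
      scale (Poly_Mapping.lookup a p) (scale (Poly_Mapping.lookup b q) (pconcat Q p q)))"
    unfolding path_algebra_def eq by simp
  then show "monoid.mult (path_algebra Q) = pmult Q"
    by (simp only: pmult_def[abs_def] lin_ext_def scale_sum)
  show "smult (path_algebra Q) = scale"
    by (rule ext) (simp add: path_algebra_def scale_def)
qed (simp_all add: path_algebra_def supported_def)

locale finite_quiver =
  fixes Q :: "('v, 'a) quiver"
  assumes finite_verts: "finite (verts Q)"
    and finite_arcs: "finite (arcs Q)"
    and tail_in: "a \<in> arcs Q \<Longrightarrow> tail Q a \<in> verts Q"
    and head_in: "a \<in> arcs Q \<Longrightarrow> head Q a \<in> verts Q"
begin

sublocale wf_digraph Q
  by unfold_locales (auto intro: tail_in head_in)

lemma awalk_path_end: "awalk u p v \<Longrightarrow> path_end Q (u, p) = v"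
  by (induction p arbitrary: u) (auto simp: path_end_def awalk_Cons_iff awalk_Nil_iff split: if_splits)

lemma path_iff: "(u, p) \<in> paths Q \<longleftrightarrow> awalk u p (path_end Q (u, p))"
  using awalk_path_end by (auto simp: paths_def)

lemma path_Nil [simp]: "(u, []) \<in> paths Q \<longleftrightarrow> u \<in> verts Q"
  by (auto simp: paths_def awalk_Nil_iff)

lemma path_Cons: "(u, a # p) \<in> paths Q \<longleftrightarrow> a \<in> arcs Q \<and> u = tail Q a \<and> (head Q a, p) \<in> paths Q"
  by (auto simp: paths_def awalk_Cons_iff)

lemma path_fst: "p \<in> paths Q \<Longrightarrow> fst p \<in> verts Q"
  by (cases p) (auto simp: paths_def)

lemma path_end_in: "p \<in> paths Q \<Longrightarrow> path_end Q p \<in> verts Q"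
  by (cases p) (simp add: path_iff awalk_last_in_verts)

lemma path_append:
  assumes "p \<in> paths Q" "q \<in> paths Q" "path_end Q p = fst q"
  shows "(fst p, snd p @ snd q) \<in> paths Q"
proof -
  have "awalk (fst p) (snd p) (fst q)" "awalk (fst q) (snd q) (path_end Q q)"
    using assms path_iff[of "fst p" "snd p"] path_iff[of "fst q" "snd q"] by simp_all
  then show ?thesis using awalk_appendI by (auto simp: paths_def)
qed

lemma pmult_closed:
  assumes "a \<in> supported (paths Q)" "b \<in> supported (paths Q)"
  shows "pmult Q a b \<in> supported (paths Q)"
proof (rule lin_mem[where F = "\<lambda>a. pmult Q a b" and a = a])
  fix p assume p: "p \<in> Poly_Mapping.keys a"
  show "pmult Q (basis p) b \<in> supported (paths Q)"
  proof (rule lin_mem[where F = "\<lambda>b. pmult Q (basis p) b" and a = b])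
    fix q assume "q \<in> Poly_Mapping.keys b"
    then show "pmult Q (basis p) (basis q) \<in> supported (paths Q)"
      using assms p path_append[of p q]
      by (auto simp: pmult_basis pconcat_def supported_def)
  qed (intro lin_intros subspace_supported)+
qed (intro lin_intros subspace_supported)+

abbreviation unit :: "('v, 'a) path \<Rightarrow>\<^sub>0 complex" where
  "unit \<equiv> (\<Sum>v\<in>verts Q. basis (v, []))"

lemma unit_closed: "unit \<in> supported (paths Q)"
  by (intro subspace_sum subspace_supported) simp

lemma unit_left: "a \<in> supported (paths Q) \<Longrightarrow> pmult Q unit a = a"
proof (rule lin_eq_on[where a = a and F = "pmult Q unit" and G = "\<lambda>a. a"])
  fix p assume "a \<in> supported (paths Q)" "p \<in> Poly_Mapping.keys a"
  then have "fst p \<in> verts Q" by (auto simp: supported_def path_fst)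
  then show "pmult Q unit (basis p) = basis p"
    using finite_verts
    by (simp add: pmult_sum_left pmult_basis pconcat_def path_end_def sum.delta cong: if_cong)
qed (intro lin_intros)+

lemma unit_right: "a \<in> supported (paths Q) \<Longrightarrow> pmult Q a unit = a"
proof (rule lin_eq_on[where a = a and F = "\<lambda>a. pmult Q a unit" and G = "\<lambda>a. a"])
  fix p assume "a \<in> supported (paths Q)" "p \<in> Poly_Mapping.keys a"
  then have "path_end Q p \<in> verts Q" by (auto simp: supported_def path_end_in)
  then show "pmult Q (basis p) unit = basis p"
    using finite_verts
    by (simp add: pmult_sum_right pmult_basis pconcat_def sum.delta cong: if_cong)
qed (intro lin_intros)+

lemma ring_path_algebra: "ring (path_algebra Q)"
proof (rule ringI)
  have sub: "subspace (supported (paths Q))" by (rule subspace_supported)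
  show "abelian_group (path_algebra Q)"
  proof (rule abelian_groupI)
    fix a assume a: "a \<in> carrier (path_algebra Q)"
    then have "scale (- 1) a \<in> supported (paths Q)"
      using sub by (simp add: path_algebra_simps subspace_def)
    then show "\<exists>b\<in>carrier (path_algebra Q). b \<oplus>\<^bsub>path_algebra Q\<^esub> a = \<zero>\<^bsub>path_algebra Q\<^esub>"
      unfolding path_algebra_simps by (intro bexI[of _ "scale (- 1) a"]) (simp_all add: scale_minus_one)
  next
    fix a b assume "a \<in> carrier (path_algebra Q)" "b \<in> carrier (path_algebra Q)"
    then show "a \<oplus>\<^bsub>path_algebra Q\<^esub> b \<in> carrier (path_algebra Q)"
      using sub by (simp add: path_algebra_simps subspace_def)
  next
    show "\<zero>\<^bsub>path_algebra Q\<^esub> \<in> carrier (path_algebra Q)"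
      using sub by (simp add: path_algebra_simps subspace_def)
  qed (simp_all add: path_algebra_simps add.assoc add.commute)
  show "monoid (path_algebra Q)"
    by (rule monoidI) (simp_all add: path_algebra_simps pmult_closed unit_closed unit_left unit_right pmult_assoc)
qed (simp_all add: path_algebra_simps pmult_add_left pmult_add_right)

end

section \<open>Ideals and quotients\<close>

context finite_quiver
begin

lemma ideal_path_algebraI:
  assumes "I \<subseteq> supported (paths Q)" "subspace I"
    and "\<And>a x. a \<in> I \<Longrightarrow> x \<in> supported (paths Q) \<Longrightarrow> pmult Q x a \<in> I"
    and "\<And>a x. a \<in> I \<Longrightarrow> x \<in> supported (paths Q) \<Longrightarrow> pmult Q a x \<in> I"
  shows "ideal I (path_algebra Q)"
proof (rule idealI[OF ring_path_algebra])
  interpret R: ring "path_algebra Q" by (rule ring_path_algebra)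
  show "subgroup I (add_monoid (path_algebra Q))"
  proof (rule R.add.subgroupI)
    fix a assume a: "a \<in> I"
    then have m: "scale (- 1) a \<in> I" using assms(2) by (simp add: subspace_def)
    have "scale (- 1) a \<in> carrier (path_algebra Q)" "a \<in> carrier (path_algebra Q)"
      using a m assms(1) by (auto simp: path_algebra_simps)
    moreover have "scale (- 1) a \<oplus>\<^bsub>path_algebra Q\<^esub> a = \<zero>\<^bsub>path_algebra Q\<^esub>"
      by (simp add: path_algebra_simps scale_minus_one)
    ultimately have "\<ominus>\<^bsub>path_algebra Q\<^esub> a = scale (- 1) a"
      by (intro R.minus_equality)
    then show "\<ominus>\<^bsub>path_algebra Q\<^esub> a \<in> I" using m by simp
  qed (use assms(1,2) in \<open>auto simp: path_algebra_simps subspace_def\<close>)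
qed (use assms(3,4) in \<open>simp_all add: path_algebra_simps\<close>)

end

locale path_algebra_ideal = finite_quiver Q for Q :: "('v, 'a) quiver" +
  fixes I
  assumes is_ideal: "ideal I (path_algebra Q)"
begin

sublocale R: ring "path_algebra Q" by (rule ring_path_algebra)
sublocale I: ideal I "path_algebra Q" by (rule is_ideal)

lemma ideal_subset: "I \<subseteq> supported (paths Q)"
  using I.a_subset by (simp add: path_algebra_simps)

lemma ideal_left: "a \<in> I \<Longrightarrow> x \<in> supported (paths Q) \<Longrightarrow> pmult Q x a \<in> I"
  using I.I_l_closed by (simp add: path_algebra_simps)

lemma ideal_right: "a \<in> I \<Longrightarrow> x \<in> supported (paths Q) \<Longrightarrow> pmult Q a x \<in> I"
  using I.I_r_closed by (simp add: path_algebra_simps)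

lemma subspace_ideal: "subspace I"
  unfolding subspace_def
proof (intro conjI ballI allI)
  show "0 \<in> I" using I.zero_closed by (simp add: path_algebra_simps)
  show "a + b \<in> I" if "a \<in> I" "b \<in> I" for a b
    using I.a_closed[OF that] by (simp add: path_algebra_simps)
  show "scale z a \<in> I" if "a \<in> I" for z a
  proof -
    have "scale z a = pmult Q (scale z unit) a"
      using that ideal_subset by (simp add: pmult_scale_left unit_left subset_iff)
    moreover have "scale z unit \<in> supported (paths Q)"
      using unit_closed subspace_supported[of "paths Q"] unfolding subspace_def by blast
    ultimately show ?thesis using ideal_left[OF that] by simp
  qed
qed

lemma ideal_diff: "a \<in> I \<Longrightarrow> b \<in> I \<Longrightarrow> a - b \<in> I"
  using subspace_ideal unfolding subspace_def by (metis add.commute scale_minus_one uminus_add_conv_diff)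

abbreviation coset where "coset a \<equiv> I +>\<^bsub>path_algebra Q\<^esub> a"

lemma coset_eq: "coset a = (\<lambda>i. i + a) ` I"
  by (auto simp: a_r_coset_def' path_algebra_simps)

lemma coset_mem: "b \<in> coset a \<longleftrightarrow> b - a \<in> I"
proof
  assume "b - a \<in> I"
  then show "b \<in> coset a" unfolding coset_eq by (rule rev_image_eqI) simp
qed (auto simp: coset_eq)

text \<open>A coset may be formed for any representative, inside the carrier or not, since only the
  translate of the ideal matters.\<close>
lemma coset_eq_iff: "coset a = coset b \<longleftrightarrow> a - b \<in> I"
proof
  assume "coset a = coset b"
  moreover have "a \<in> coset a" using subspace_ideal by (auto simp: coset_eq subspace_def)
  ultimately show "a - b \<in> I" by (auto simp: coset_eq)
next
  assume ab: "a - b \<in> I"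
  show "coset a = coset b"
  proof (rule Set.set_eqI)
    fix x
    have "x - b = (x - a) + (a - b)" "x - a = (x - b) - (a - b)" by simp_all
    then have "x - a \<in> I \<longleftrightarrow> x - b \<in> I"
      using ab subspace_ideal ideal_diff unfolding subspace_def by metis
    then show "x \<in> coset a \<longleftrightarrow> x \<in> coset b" by (simp add: coset_mem)
  qed
qed

lemma coset_self: "a \<in> coset a"
  using subspace_ideal by (auto simp: coset_eq subspace_def)

abbreviation quotient where "quotient \<equiv> quotient_algebra (path_algebra Q) I"

lemma quotient_carrier: "carrier quotient = coset ` supported (paths Q)"
  by (auto simp: quotient_algebra_def FactRing_def A_RCOSETS_def' path_algebra_simps)

lemma quotient_add:
  "a \<in> supported (paths Q) \<Longrightarrow> b \<in> supported (paths Q) \<Longrightarrow> coset a \<oplus>\<^bsub>quotient\<^esub> coset b = coset (a + b)"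
  using I.a_rcos_sum[of a b] by (simp add: quotient_algebra_def FactRing_def path_algebra_simps)

lemma quotient_mult:
  "a \<in> supported (paths Q) \<Longrightarrow> b \<in> supported (paths Q) \<Longrightarrow> coset a \<otimes>\<^bsub>quotient\<^esub> coset b = coset (pmult Q a b)"
  using I.rcoset_mult_add[of a b] by (simp add: quotient_algebra_def FactRing_def path_algebra_simps)

lemma quotient_one: "\<one>\<^bsub>quotient\<^esub> = coset unit"
  by (simp add: quotient_algebra_def FactRing_def path_algebra_simps)

lemma coset_zero: "coset 0 = I"
  by (simp add: coset_eq)

lemma quotient_smult: "z \<odot>\<^bsub>quotient\<^esub> coset a = coset (scale z a)"
proof -
  have "coset (scale z b) = coset (scale z a)" if "b \<in> coset a" for b
  proof -
    have "scale z b - scale z a = scale z (b - a)"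
      by (rule poly_mapping_eqI) (simp add: lookup_minus algebra_simps)
    then show ?thesis
      using that subspace_ideal by (simp add: coset_mem coset_eq_iff subspace_def)
  qed
  then have "(\<Union>b\<in>coset a. coset (scale z b)) = coset (scale z a)"
    by (intro UN_constant_eq[OF coset_self]) blast
  then show ?thesis
    by (simp add: quotient_algebra_def path_algebra_simps)
qed

lemma finsum_coset:
  assumes "finite S" "\<And>x. x \<in> S \<Longrightarrow> f x \<in> supported (paths Q)" "\<And>x. x \<in> S \<Longrightarrow> h x = coset (f x)"
  shows "(\<Oplus>\<^bsub>quotient\<^esub>x\<in>S. h x) = coset (\<Sum>x\<in>S. f x)"
proof -
  let ?R = "path_algebra Q Quot I"
  interpret F: ring ?R by (rule I.quotient_is_ring)
  have fs: "finsum quotient g S = finsum ?R g S" for g :: "'b \<Rightarrow> _" and S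
    by (simp add: finsum_def finprod_def quotient_algebra_def)
  have carr: "coset a \<in> carrier ?R" if "a \<in> supported (paths Q)" for a
    using that quotient_carrier by (auto simp: quotient_algebra_def)
  have "finsum ?R h S = coset (\<Sum>x\<in>S. f x)"
    using assms
  proof (induction S rule: finite_induct)
    case empty
    then show ?case by (simp add: coset_zero) (simp add: FactRing_def)
  next
    case (insert x S)
    have "sum f S \<in> supported (paths Q)" using insert.prems by (intro subspace_sum subspace_supported) auto
    then have "coset (f x) \<oplus>\<^bsub>?R\<^esub> coset (sum f S) = coset (f x + sum f S)"
      using insert.prems quotient_add[of "f x" "sum f S"] by (simp add: quotient_algebra_def)
    then show ?case using insert carr by (simp add: F.finsum_insert)
  qed
  then show ?thesis by (simp add: fs)
qed

text \<open>First isomorphism theorem. The target is an arbitrary record, for which no ring laws are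
  assumed, so the kernel is expressed by congruence of two elements.\<close>
lemma quotient_iso:
  assumes surj: "\<Phi> ` supported (paths Q) = carrier B"
    and mult: "\<And>a b. a \<in> supported (paths Q) \<Longrightarrow> b \<in> supported (paths Q) \<Longrightarrow> \<Phi> (pmult Q a b) = \<Phi> a \<otimes>\<^bsub>B\<^esub> \<Phi> b"
    and add: "\<And>a b. a \<in> supported (paths Q) \<Longrightarrow> b \<in> supported (paths Q) \<Longrightarrow> \<Phi> (a + b) = \<Phi> a \<oplus>\<^bsub>B\<^esub> \<Phi> b"
    and one: "\<Phi> unit = \<one>\<^bsub>B\<^esub>"
    and smult: "\<And>z a. a \<in> supported (paths Q) \<Longrightarrow> \<Phi> (scale z a) = z \<odot>\<^bsub>B\<^esub> \<Phi> a"
    and ker: "\<And>a b. a \<in> supported (paths Q) \<Longrightarrow> b \<in> supported (paths Q) \<Longrightarrow> \<Phi> a = \<Phi> b \<longleftrightarrow> a - b \<in> I"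
  shows "algebra_iso quotient B"
proof -
  \<comment> \<open>Any representative of a coset gives the same value, by the kernel condition.\<close>
  define h where "h Y = \<Phi> (SOME a. a \<in> Y)" for Y
  have h: "h (coset a) = \<Phi> a" if a: "a \<in> supported (paths Q)" for a
  proof -
    define b where "b = (SOME b. b \<in> coset a)"
    have "b \<in> coset a" unfolding b_def using coset_self by (rule someI)
    then have b: "b - a \<in> I" by (simp add: coset_mem)
    then have "(b - a) + a \<in> supported (paths Q)"
      using a ideal_subset subspace_supported[of "paths Q"] unfolding subspace_def by blast
    then show ?thesis using b ker[of b a] a by (simp add: h_def b_def)
  qed
  note closed = pmult_closed unit_closed
    subspace_supported[of "paths Q", unfolded subspace_def]
  have "h \<in> ring_iso quotient B"
    unfolding ring_iso_def
  proof (intro CollectI conjI ring_hom_memI)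
    show "bij_betw h (carrier quotient) (carrier B)"
    proof (rule bij_betwI')
      show "(h x = h y) = (x = y)" if "x \<in> carrier quotient" "y \<in> carrier quotient" for x y
      proof -
        obtain a b where "a \<in> supported (paths Q)" "x = coset a" "b \<in> supported (paths Q)" "y = coset b"
          using \<open>x \<in> carrier quotient\<close> \<open>y \<in> carrier quotient\<close> by (auto simp: quotient_carrier)
        then show ?thesis by (simp add: h ker coset_eq_iff)
      qed
      show "h x \<in> carrier B" if "x \<in> carrier quotient" for x
        using that surj by (auto simp: quotient_carrier h)
      show "\<exists>x\<in>carrier quotient. y = h x" if y: "y \<in> carrier B" for y
      proof -
        obtain a where "a \<in> supported (paths Q)" "y = \<Phi> a" using y surj by auto
        then show ?thesis by (intro bexI[of _ "coset a"]) (auto simp: quotient_carrier h)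
      qed
    qed
    fix x assume x: "x \<in> carrier quotient"
    then show "h x \<in> carrier B" using surj by (auto simp: quotient_carrier h)
    fix y assume y: "y \<in> carrier quotient"
    obtain a b where ab: "a \<in> supported (paths Q)" "x = coset a" "b \<in> supported (paths Q)" "y = coset b"
      using x y by (auto simp: quotient_carrier)
    show "h (x \<otimes>\<^bsub>quotient\<^esub> y) = h x \<otimes>\<^bsub>B\<^esub> h y"
      using ab closed by (simp add: quotient_mult h mult)
    show "h (x \<oplus>\<^bsub>quotient\<^esub> y) = h x \<oplus>\<^bsub>B\<^esub> h y"
      using ab closed by (simp add: quotient_add h add)
  qed (simp add: quotient_one h one unit_closed)
  moreover have "h (z \<odot>\<^bsub>quotient\<^esub> x) = z \<odot>\<^bsub>B\<^esub> h x" if "x \<in> carrier quotient" for x z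
    using that closed by (auto simp: quotient_carrier quotient_smult h smult)
  ultimately show ?thesis by (auto simp: algebra_iso_def)
qed

end

section \<open>Potentials supported on cycles of length three\<close>

lemma rot_class_3: "rot_class [a, b, c] = {[a, b, c], [b, c, a], [c, a, b]}"
proof
  have "rotate n [a, b, c] = [a, b, c] \<or> rotate n [a, b, c] = [b, c, a] \<or> rotate n [a, b, c] = [c, a, b]" for n
    by (induction n) (simp, elim disjE, simp_all)
  then show "rot_class [a, b, c] \<subseteq> {[a, b, c], [b, c, a], [c, a, b]}"
    unfolding rot_class_def by (intro image_subsetI) simp
  have "rotate 0 [a, b, c] = [a, b, c]" "rotate 1 [a, b, c] = [b, c, a]" "rotate 2 [a, b, c] = [c, a, b]"
    by (simp_all add: numeral_2_eq_2)
  then show "{[a, b, c], [b, c, a], [c, a, b]} \<subseteq> rot_class [a, b, c]"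
    unfolding rot_class_def by (metis empty_subsetI insert_subset rangeI)
qed

lemma card_rot_class_3: "card (rot_class [a, b, c]) = (if a = b \<and> b = c then 1 else 3)"
proof (cases "a = b \<and> b = c")
  case False
  then have "distinct [[a, b, c], [b, c, a], [c, a, b]]" by auto
  then have "card (set [[a, b, c], [b, c, a], [c, a, b]]) = 3" by (subst distinct_card) simp_all
  then show ?thesis using False by (simp add: rot_class_3)
qed (simp add: rot_class_3)

lemma length_3E:
  assumes "length c = 3"
  obtains x y z where "c = [x, y, z]"
  using assms by (auto simp: numeral_3_eq_3 length_Suc_conv)

lemma rot_class_self: "c \<in> rot_class c"
  unfolding rot_class_def by (rule range_eqI[of _ _ 0]) simp

lemma rot_class_eq:
  assumes "length c = 3" "d \<in> rot_class c"
  shows "rot_class d = rot_class c"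
proof -
  obtain x y z where c: "c = [x, y, z]" using assms(1) by (rule length_3E)
  then have "d = [x, y, z] \<or> d = [y, z, x] \<or> d = [z, x, y]" using assms(2) by (simp add: rot_class_3)
  then show ?thesis by (elim disjE) (simp_all add: c rot_class_3 insert_commute)
qed

lemma rot_class_invariant:
  assumes "\<And>c. lam (rotate1 c) = lam c" "d \<in> rot_class c"
  shows "lam d = lam c"
proof -
  have "lam (rotate n c) = lam c" for n by (induction n) (simp_all add: assms(1))
  then show ?thesis using assms(2) by (auto simp: rot_class_def)
qed

lemma rot_rep_mem: "rot_rep (rot_class c) \<in> rot_class c"
  unfolding rot_rep_def using rot_class_self by (rule someI)

text \<open>A rotation class of size \<open>n\<close> consists of \<open>n\<close> closed walks, with \<open>n = 3\<close> except for the cube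
  of a loop, where \<open>n = 1\<close>. With the sum over walks, this size becomes a factor of the coefficient
  and loops need no separate treatment.\<close>
definition walk_potential :: "('v, 'a) quiver \<Rightarrow> ('a list \<Rightarrow> complex) \<Rightarrow> 'a potential" where
  "walk_potential Q L = (\<Sum>c\<in>closed_3_walks Q. Poly_Mapping.single (rot_class c) (L c / 3))"

context finite_quiver
begin

lemma closed_3_iff: "[a, b, c] \<in> closed_3_walks Q \<longleftrightarrow>
    a \<in> arcs Q \<and> b \<in> arcs Q \<and> c \<in> arcs Q \<and> head Q a = tail Q b \<and> head Q b = tail Q c \<and> head Q c = tail Q a"
  by (auto simp: closed_3_walks_def awalk_Cons_iff awalk_Nil_iff tail_in)

lemma closed_3_length: "c \<in> closed_3_walks Q \<Longrightarrow> length c = 3"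
  by (simp add: closed_3_walks_def)

lemma closed_3E:
  assumes "c \<in> closed_3_walks Q"
  obtains x y z where "c = [x, y, z]"
  using closed_3_length[OF assms] by (rule length_3E) (rule that)

lemma closed_3_rotate1: "rotate1 c \<in> closed_3_walks Q \<longleftrightarrow> c \<in> closed_3_walks Q"
proof (cases "length c = 3")
  case True
  then show ?thesis by (elim length_3E) (auto simp: closed_3_iff)
qed (simp add: closed_3_walks_def)

lemma finite_closed_3_walks: "finite (closed_3_walks Q)"
proof (rule finite_subset)
  show "closed_3_walks Q \<subseteq> {c. set c \<subseteq> arcs Q \<and> length c = 3}"
    by (auto simp: closed_3_walks_def awalk_def)
qed (rule finite_lists_length_eq[OF finite_arcs])

lemma closed_3_rot_class:
  assumes "c \<in> closed_3_walks Q" "d \<in> rot_class c"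
  shows "d \<in> closed_3_walks Q"
proof -
  have "rotate n c \<in> closed_3_walks Q" for n by (induction n) (simp_all add: assms(1) closed_3_rotate1)
  then show ?thesis using assms(2) by (auto simp: rot_class_def)
qed

lemma potential_eq_walk_potential:
  assumes "\<And>c. lam (rotate1 c) = lam c"
  shows "(\<Sum>C\<in>three_cycles Q. Poly_Mapping.single C (lam (rot_rep C)))
    = walk_potential Q (\<lambda>c. 3 * lam c / of_nat (card (rot_class c)))"
proof -
  let ?S = "closed_3_walks Q"
  let ?g = "\<lambda>c. Poly_Mapping.single (rot_class c) (lam c / of_nat (card (rot_class c)))"
  have inner: "(\<Sum>c | c \<in> ?S \<and> rot_class c = C. ?g c) = Poly_Mapping.single C (lam (rot_rep C))"
    if C: "C \<in> rot_class ` ?S" for C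
  proof -
    obtain c where c: "c \<in> ?S" "C = rot_class c" using C by blast
    have len: "length c = 3" using c(1) by (rule closed_3_length)
    have set: "{d. d \<in> ?S \<and> rot_class d = C} = C"
    proof (rule Set.set_eqI)
      fix d
      show "d \<in> {d. d \<in> ?S \<and> rot_class d = C} \<longleftrightarrow> d \<in> C"
        using closed_3_rot_class[OF c(1), of d] rot_class_eq[OF len, of d] rot_class_self[of d]
        by (auto simp: c(2))
    qed
    have card: "finite C" "card C \<noteq> 0"
      using len by (rule length_3E; simp add: c(2) card_rot_class_3; simp add: rot_class_3)+
    have "?g d = Poly_Mapping.single C (lam (rot_rep C) / of_nat (card C))" if "d \<in> C" for d
    proof -
      have "lam d = lam c" "lam (rot_rep C) = lam c"
        using that rot_rep_mem[of c] rot_class_invariant[of lam, OF assms] unfolding c(2) by blast+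
      moreover have "rot_class d = C" using that rot_class_eq[OF len] c(2) by blast
      ultimately show ?thesis by simp
    qed
    then have "(\<Sum>d\<in>C. ?g d) = (\<Sum>d\<in>C. Poly_Mapping.single C (lam (rot_rep C) / of_nat (card C)))"
      by (rule sum.cong[OF refl])
    also have "\<dots> = Poly_Mapping.single C (lam (rot_rep C))"
    proof (rule poly_mapping_eqI)
      fix k
      have "of_nat (card C) \<noteq> (0 :: complex)" using card(2) by (simp only: of_nat_eq_0_iff not_False_eq_True)
      then show "Poly_Mapping.lookup (\<Sum>d\<in>C. Poly_Mapping.single C (lam (rot_rep C) / of_nat (card C))) k
          = Poly_Mapping.lookup (Poly_Mapping.single C (lam (rot_rep C))) k"
        by (cases "C = k") (simp_all add: lookup_sum lookup_single del: of_nat_eq_0_iff)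
    qed
    finally show ?thesis unfolding set .
  qed
  have "(\<Sum>c\<in>?S. ?g c) = (\<Sum>C\<in>rot_class ` ?S. \<Sum>c | c \<in> ?S \<and> rot_class c = C. ?g c)"
    by (rule sum.image_gen[OF finite_closed_3_walks])
  also have "\<dots> = (\<Sum>C\<in>three_cycles Q. Poly_Mapping.single C (lam (rot_rep C)))"
    unfolding three_cycles_def by (rule sum.cong[OF refl inner])
  finally show ?thesis by (simp add: walk_potential_def)
qed

text \<open>Every occurrence of \<open>a\<close> in a cycle is the head of exactly one rotation of the cycle, so the
  cyclic derivative collects the tails of the closed walks that begin with \<open>a\<close>. The factor \<open>1/3\<close>
  cancels against the three rotations.\<close>
lemma deriv_walk_potential:
  assumes L: "\<And>c. c \<in> closed_3_walks Q \<Longrightarrow> L (rotate1 c) = L c"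
  shows "deriv_potential Q a (walk_potential Q L)
    = (\<Sum>w | w \<in> closed_3_walks Q \<and> hd w = a. Poly_Mapping.single (head Q a, tl w) (L w))"
proof -
  let ?S = "closed_3_walks Q"
  define g where "g w = (if hd w = a then Poly_Mapping.single (head Q a, tl w) (L w / 3) else 0)" for w
  have step: "scale (L c / 3) (cyc_deriv Q a c) = g c + g (rotate1 c) + g (rotate1 (rotate1 c))"
    if c: "c \<in> ?S" for c
  proof -
    obtain x y z where xyz: "c = [x, y, z]" using closed_3_length[OF c] by (rule length_3E)
    have L': "L [y, z, x] = L c" "L [z, x, y] = L c"
      using L[of c] L[of "[y, z, x]"] c closed_3_rotate1[of c] by (simp_all add: xyz)
    have "{i. i < length c \<and> c ! i = a} = {i \<in> {0, 1, 2}. c ! i = a}"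
      by (auto simp: xyz)
    then have "cyc_deriv Q a c = (\<Sum>i\<in>{0, 1, 2}. if c ! i = a then basis (head Q a, drop (Suc i) c @ take i c) else 0)"
      unfolding cyc_deriv_def by (simp only: sum.inter_filter[of "{0, 1, 2::nat}"] finite.intros)
    moreover have "g c = (if x = a then Poly_Mapping.single (head Q a, [y, z]) (L c / 3) else 0)"
      "g (rotate1 c) = (if y = a then Poly_Mapping.single (head Q a, [z, x]) (L c / 3) else 0)"
      "g (rotate1 (rotate1 c)) = (if z = a then Poly_Mapping.single (head Q a, [x, y]) (L c / 3) else 0)"
      using L' by (simp_all only: g_def xyz rotate1.simps append.simps list.sel)
    ultimately show ?thesis
      by (simp add: scale_add numeral_2_eq_2 add.assoc) (simp add: xyz)
  qed
  have bij: "bij_betw rotate1 ?S ?S"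
  proof (rule bij_betwI[where g = "\<lambda>c. rotate1 (rotate1 c)"])
    show "rotate1 (rotate1 (rotate1 c)) = c" "rotate1 (rotate1 (rotate1 c)) = c" if "c \<in> ?S" for c
      by (rule closed_3E[OF that], simp)+
  qed (simp_all add: closed_3_rotate1)
  have rot: "(\<Sum>c\<in>?S. h (rotate1 c)) = (\<Sum>c\<in>?S. h c)" for h :: "_ \<Rightarrow> ('v, 'a) path \<Rightarrow>\<^sub>0 complex"
    by (rule sum.reindex_bij_betw[OF bij])
  have "deriv_potential Q a W = lin_ext (\<lambda>C. cyc_deriv Q a (rot_rep C)) W" for W
    by (simp add: deriv_potential_def lin_ext_def scale_def)
  then have "deriv_potential Q a (walk_potential Q L)
      = (\<Sum>c\<in>?S. scale (L c / 3) (cyc_deriv Q a (rot_rep (rot_class c))))"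
    by (simp add: walk_potential_def lin_ext_sum lin_ext_single)
  also have "\<dots> = (\<Sum>c\<in>?S. scale (L c / 3) (cyc_deriv Q a c))"
    by (simp only: cyc_deriv_rot_class[OF rot_rep_mem])
  also have "\<dots> = (\<Sum>c\<in>?S. g c) + (\<Sum>c\<in>?S. g (rotate1 c)) + (\<Sum>c\<in>?S. g (rotate1 (rotate1 c)))"
    using step by (simp add: sum.distrib)
  also have "\<dots> = (\<Sum>c\<in>?S. scale 3 (g c))"
    unfolding rot[of "\<lambda>c. g (rotate1 c)"] rot[of g] scale_sum[symmetric]
    by (intro poly_mapping_eqI) (simp add: lookup_add)
  also have "\<dots> = (\<Sum>c\<in>?S. if hd c = a then Poly_Mapping.single (head Q a, tl c) (L c) else 0)"
    by (intro sum.cong) (auto simp: g_def)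
  also have "\<dots> = (\<Sum>w | w \<in> ?S \<and> hd w = a. Poly_Mapping.single (head Q a, tl w) (L w))"
    by (rule sum.inter_filter[OF finite_closed_3_walks, symmetric])
  finally show ?thesis .
qed

lemma deriv_walk_potential_closed:
  assumes "\<And>c. c \<in> closed_3_walks Q \<Longrightarrow> L (rotate1 c) = L c"
  shows "deriv_potential Q a (walk_potential Q L) \<in> supported (paths Q)"
proof (subst deriv_walk_potential)
  show "L (rotate1 c) = L c" if "c \<in> closed_3_walks Q" for c using that by (rule assms)
  show "(\<Sum>w | w \<in> closed_3_walks Q \<and> hd w = a. Poly_Mapping.single (head Q a, tl w) (L w)) \<in> supported (paths Q)"
  proof (rule subspace_sum[OF subspace_supported])
  fix w assume w: "w \<in> {w. w \<in> closed_3_walks Q \<and> hd w = a}"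
  then obtain x y z where "w = [x, y, z]" using closed_3E by blast
  then have "(head Q a, tl w) \<in> paths Q" using w by (auto simp: closed_3_iff path_Cons head_in)
  then show "Poly_Mapping.single (head Q a, tl w) (L w) \<in> supported (paths Q)"
    by (simp add: supported_def)
  qed
qed

end

section \<open>Orbits of triples under cyclic rotation\<close>

lemma omega_pow_0 [simp]: "omega_pow 0 x = x"
  by (simp add: omega_pow_cases)

lemma omega_pow_mod [simp]: "omega_pow (j mod 3) x = omega_pow j x"
  by (simp add: omega_pow_def)

lemma fvec_mod [simp]: "fvec (i mod 3) = fvec i"
  by (simp add: fvec_def)

lemma omega_pow_cancel [simp]: "omega_pow j (omega_pow (- j) x) = x" "omega_pow (- j) (omega_pow j x) = x"
  by (simp_all add: omega_pow_add)

lemma omega_pow_eq_iff [simp]: "omega_pow j x = omega_pow j y \<longleftrightarrow> x = y"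
  by (metis omega_pow_cancel(2))

lemma omega_pow_fixed: "omega v = v \<Longrightarrow> omega_pow j v = v"
  by (simp add: omega_pow_cases)

lemma fixed_omega_pow [simp]: "omega (omega_pow j v) = omega_pow j v \<longleftrightarrow> omega v = v"
proof -
  have "omega (omega_pow j v) = omega_pow j (omega v)"
    by (simp add: omega_pow_cases)
  then show ?thesis by simp
qed

lemma omega_pow_add_f: "omega_pow j (x + fvec i) = omega_pow j x + fvec (i - j)"
  by (simp add: omega_pow_f)

lemma mod3_Ix: "j mod 3 \<in> Ix" for j :: int
  using mod3_cases[of j] by (auto simp: Ix_def)

lemma Ix_mod: "j \<in> Ix \<Longrightarrow> j mod 3 = j"
  by (auto simp: Ix_def)

lemma finite_Ix [simp]: "finite Ix"
  by (simp add: Ix_def)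

text \<open>Dominant triples represent the orbits of rotation that have more than one element: of three
  rotations that are not all equal, exactly one exceeds both others.\<close>
definition dominant :: "triple \<Rightarrow> bool" where
  "dominant v \<longleftrightarrow> v \<succ> omega v \<and> v \<succ> omega (omega v)"

text \<open>The exponent of the rotation that carries the representative of the orbit to \<open>v\<close>, see
  \<open>omega_pow_rep\<close>. A triple fixed by rotation has level 0, hence is its own representative.\<close>
definition level :: "triple \<Rightarrow> int" where
  "level v = (if dominant (omega v) then 2 else if dominant (omega (omega v)) then 1 else 0)"

definition rep :: "triple \<Rightarrow> triple" where
  "rep v = omega_pow (- level v) v"

lemma fixed_triple:
  assumes "omega v = v"
  obtains t where "v = (t, t, t)"
  using assms by (cases v) (metis omega.simps prod.inject)

lemma not_dominant_fixed: "omega v = v \<Longrightarrow> \<not> dominant v"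
  by (erule fixed_triple) (simp add: dominant_def)

lemma dominant_unique:
  "dominant v \<Longrightarrow> \<not> dominant (omega v)"
  "dominant v \<Longrightarrow> \<not> dominant (omega (omega v))"
  by (cases v; auto simp: dominant_def)+

lemma dominant_exists: "omega v \<noteq> v \<Longrightarrow> dominant v \<or> dominant (omega v) \<or> dominant (omega (omega v))"
  by (cases v) (simp add: dominant_def, smt (verit))

lemma level_Ix: "level v \<in> Ix"
  by (simp add: level_def Ix_def)

lemma level_mod [simp]: "level v mod 3 = level v"
  by (simp add: level_def)

lemma level_fixed: "omega v = v \<Longrightarrow> level v = 0"
  by (simp add: level_def not_dominant_fixed)

lemma level_dominant: "dominant v \<Longrightarrow> level v = 0"
  by (simp add: level_def dominant_unique)

lemma level_omega: "omega v \<noteq> v \<Longrightarrow> level (omega v) = (level v + 1) mod 3"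
proof -
  note unique = dominant_unique[of v] dominant_unique[of "omega v", unfolded omega3]
    dominant_unique[of "omega (omega v)", unfolded omega3]
  assume "omega v \<noteq> v"
  then have "dominant v \<or> dominant (omega v) \<or> dominant (omega (omega v))" by (rule dominant_exists)
  then consider "dominant v" "\<not> dominant (omega v)" "\<not> dominant (omega (omega v))"
    | "\<not> dominant v" "dominant (omega v)" "\<not> dominant (omega (omega v))"
    | "\<not> dominant v" "\<not> dominant (omega v)" "dominant (omega (omega v))"
    using unique by blast
  then show ?thesis by cases (simp_all add: level_def)
qed

lemma level_omega_pow: "omega v \<noteq> v \<Longrightarrow> level (omega_pow j v) = (level v + j) mod 3"
proof -
  assume v: "omega v \<noteq> v"
  then have "omega (omega v) \<noteq> omega v" by (metis omega3)
  then have "level (omega (omega v)) = (level (omega v) + 1) mod 3" by (rule level_omega)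
  also have "level (omega v) = (level v + 1) mod 3" using v by (rule level_omega)
  also have "((level v + 1) mod 3 + 1) mod 3 = (level v + 2) mod 3" by presburger
  finally have two: "level (omega (omega v)) = (level v + 2) mod 3" .
  have "level (omega_pow j v) = (level v + j mod 3) mod 3"
    using mod3_cases[of j] v two by (elim disjE) (simp_all add: omega_pow_cases level_omega)
  then show ?thesis by (simp add: mod_add_right_eq)
qed

lemma rep_omega_pow [simp]: "rep (omega_pow j v) = rep v"
proof (cases "omega v = v")
  case True
  then show ?thesis by (simp add: omega_pow_fixed)
next
  case False
  then have "rep (omega_pow j v) = omega_pow (- ((level v + j) mod 3) + j) v"
    by (simp add: rep_def level_omega_pow omega_pow_add)
  also have "\<dots> = omega_pow ((- ((level v + j) mod 3) + j) mod 3) v" by simp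
  also have "(- ((level v + j) mod 3) + j) mod 3 = (- level v) mod 3" by presburger
  finally show ?thesis by (simp add: rep_def)
qed

lemma omega_pow_rep [simp]: "omega_pow (level v) (rep v) = v"
  by (simp add: rep_def)

lemma level_rep: "level (rep v) = 0"
  by (cases "omega v = v") (simp_all add: rep_def level_omega_pow level_fixed omega_pow_fixed)

lemma level_0_iff: "level v = 0 \<longleftrightarrow> dominant v \<or> omega v = v"
  using dominant_exists[of v] dominant_unique[of v] not_dominant_fixed[of v]
  by (auto simp: level_def)

lemma dominant_rep: "omega v \<noteq> v \<Longrightarrow> dominant (rep v)"
  using level_rep[of v] level_0_iff[of "rep v"] by (simp add: rep_def)

lemma rep_level_0: "level v = 0 \<Longrightarrow> rep v = v"
  by (simp add: rep_def)

lemma rep_simplex [simp]: "rep v \<in> simplex s \<longleftrightarrow> v \<in> simplex s"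
  by (simp add: rep_def omega_pow_simplex)

lemma fixed_rep: "omega (rep v) = rep v \<longleftrightarrow> omega v = v"
  by (simp add: rep_def)

subsection \<open>Roots of unity\<close>

definition zt :: "int \<Rightarrow> complex" where
  "zt n = zeta powi n"

lemma zeta_nz: "zeta \<noteq> 0"
  by (simp add: zeta_def)

lemma zeta_3: "zeta ^ 3 = 1"
proof -
  have "zeta ^ 3 = exp (of_nat 3 * (2 * of_real pi * \<i> / 3))"
    unfolding zeta_def by (rule exp_of_nat_mult[symmetric])
  also have "of_nat 3 * (2 * of_real pi * \<i> / 3) = 2 * of_real pi * \<i>" by simp
  also have "exp (2 * of_real pi * \<i>) = 1" by (rule exp_two_pi_i)
  finally show ?thesis .
qed

lemma zeta_neq_1: "zeta \<noteq> 1"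
proof
  assume "zeta = 1"
  then have "Im zeta = 0" by simp
  moreover have "zeta = cis (2 * pi / 3)" by (simp add: zeta_def cis_conv_exp mult.commute)
  ultimately have "sin (2 * pi / 3) = 0" by (metis cis.sel(2))
  moreover have "0 < sin (2 * pi / 3)" by (rule sin_gt_zero) auto
  ultimately show False by simp
qed

lemma zt_0 [simp]: "zt 0 = 1"
  by (simp add: zt_def)

lemma zt_add: "zt (m + n) = zt m * zt n"
  by (simp add: zt_def power_int_add zeta_nz)

lemma zt_mult_3: "zt (3 * n) = 1"
  using zeta_3 by (simp add: zt_def power_int_mult)

lemma zt_cong: "m mod 3 = n mod 3 \<Longrightarrow> zt m = zt n"
proof -
  have red: "zt n = zt (n mod 3)" for n
  proof -
    have "zt (3 * (n div 3) + n mod 3) = zt (n mod 3)" by (simp only: zt_add zt_mult_3 mult_1)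
    then show ?thesis by simp
  qed
  assume "m mod 3 = n mod 3"
  then show ?thesis using red[of m] red[of n] by simp
qed

text \<open>Orthogonality of the characters of the cyclic group of order three.\<close>
lemma zt_sum: "(\<Sum>k\<in>Ix. zt (k * g)) = (if g mod 3 = 0 then 3 else 0)"
proof (cases "g mod 3 = 0")
  case True
  then have "3 dvd k * g" for k by auto
  then have "(k * g) mod 3 = 0 mod 3" for k by (simp add: mod_eq_0_iff_dvd)
  then have "zt (k * g) = zt 0" for k by (rule zt_cong)
  then have "zt (k * g) = 1" for k by simp
  then show ?thesis using True by (simp add: Ix_def)
next
  case False
  have g: "zt g \<noteq> 1"
  proof
    assume 1: "zt g = 1"
    have "zeta = 1"
    proof (cases "g mod 3 = 1")
      case True
      then show ?thesis using 1 zt_cong[of g 1] by (simp add: zt_def)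
    next
      case g2: False
      then have "(g + g) mod 3 = 1 mod 3" using False by presburger
      then have "zt (g + g) = zt 1" by (rule zt_cong)
      then show ?thesis using 1 unfolding zt_add by (simp add: zt_def)
    qed
    then show False using zeta_neq_1 by simp
  qed
  have "(zt g - 1) * (1 + zt g + zt (g + g)) = zt g * zt (g + g) - 1"
    unfolding zt_add by (simp add: algebra_simps)
  also have "zt g * zt (g + g) = 1"
  proof -
    have "g + (g + g) = 3 * g" by simp
    then show ?thesis by (simp only: zt_add[symmetric] zt_mult_3)
  qed
  finally have "1 + zt g + zt (g + g) = 0" using g by simp
  then have "zt (0 * g) + (zt (1 * g) + zt (2 * g)) = 0" by (simp only: mult_2 mult_1 mult_zero_left zt_0 add.assoc)
  then show ?thesis using False by (simp add: Ix_def)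
qed

lemma zt_sum_delta: "k \<in> Ix \<Longrightarrow> l \<in> Ix \<Longrightarrow> (\<Sum>h\<in>Ix. zt ((k - l) * h)) = (if k = l then 3 else 0)"
  using zt_sum[of "k - l"] by (auto simp: mult.commute Ix_def)

section \<open>The covering functor from type A to type D\<close>

lemma path_end_Nil [simp]: "path_end Q (u, []) = u"
  by (simp add: path_end_def)

lemma path_end_Cons [simp]: "path_end Q (u, a # p) = path_end Q (head Q a, p)"
  by (simp add: path_end_def)

lemma pmult_single_single:
  "pmult Q (Poly_Mapping.single (u, p) y) (Poly_Mapping.single (v, q) z)
    = (if path_end Q (u, p) = v then Poly_Mapping.single (u, p @ q) (y * z) else 0)"
  by (simp add: pmult_single pconcat_def)

lemma zt_mult_mod [simp]: "zt (k * (n mod 3)) = zt (k * n)"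
  by (rule zt_cong) (rule mod_mult_right_eq)

lemma triple_eq_diff: "(v :: triple) + f = x \<longleftrightarrow> v = x - f"
  by (auto simp: eq_diff_eq)

text \<open>The image of \<open>e\<^sub>v \<otimes> g\<close>. All vertices of an orbit are identified with the representative, so
  off the fixed point this is a trivial path. The fixed point is split into three copies, one for
  each character \<open>g \<mapsto> zt (k * g)\<close>, and the group acts on a copy through its character.\<close>
definition tau :: "int \<Rightarrow> triple \<Rightarrow> (vertD, arrD) path \<Rightarrow>\<^sub>0 complex" where
  "tau g v = (if omega v = v then \<Sum>k\<in>Ix. Poly_Mapping.single (Copy k, []) (zt (k * g))
     else basis (Pt (rep v), []))"

text \<open>The arrow \<open>(v, l)\<close> with head \<open>w = v + fvec l\<close> is rotated by \<open>- level w\<close>, which makes its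
  head dominant. Rotation by \<open>- level w\<close> adds \<open>level w\<close> to the label and moves the tail to level
  \<open>level v - level w\<close>. This is the recipe that selects an arrow in each orbit in the construction
  of Giovannini and Pasquali.\<close>
definition twist :: "arrA \<Rightarrow> arrD" where
  "twist = (\<lambda>(v, l). Alpha (rep v) ((l + level (v + fvec l)) mod 3) ((level v - level (v + fvec l)) mod 3))"

text \<open>The image of \<open>a \<otimes> 0\<close> for an arrow \<open>a\<close>. The coefficients at the fixed point are forced, up to
  normalisation, by \<open>tau_psi_commute\<close>: rotating the arrow out of or into \<open>X\<close> has to multiply the
  component at the copy \<open>k\<close> by a value of the \<open>k\<close>-th character. The arrow out of \<open>X\<close> whose head
  has level 0 and the arrow into \<open>X\<close> whose tail has level 0 are normalised to the plain sums of
  the \<open>Gamma k\<close> and of the \<open>Beta k\<close>.\<close>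
definition psi :: "arrA \<Rightarrow> (vertD, arrD) path \<Rightarrow>\<^sub>0 complex" where
  "psi = (\<lambda>(v, l).
     if omega v = v then \<Sum>k\<in>Ix. Poly_Mapping.single (Copy k, [Gamma k]) (zt (k * level (v + fvec l)))
     else if omega (v + fvec l) = v + fvec l
       then \<Sum>k\<in>Ix. Poly_Mapping.single (Pt (rep v), [Beta k]) (zt (- k * level v))
     else basis (Pt (rep v), [twist (v, l)]))"

lemma tau_off: "omega v \<noteq> v \<Longrightarrow> tau g v = basis (Pt (rep v), [])"
  by (simp add: tau_def)

lemma tau_fixed: "omega v = v \<Longrightarrow> tau g v = (\<Sum>k\<in>Ix. Poly_Mapping.single (Copy k, []) (zt (k * g)))"
  by (simp add: tau_def)

lemma tau_mod [simp]: "tau (g mod 3) v = tau g v"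
  by (simp add: tau_def)

lemma tau_omega_pow [simp]: "tau g (omega_pow j v) = tau g v"
  by (simp add: tau_def)

lemma psi_off: "omega v \<noteq> v \<Longrightarrow> omega (v + fvec l) \<noteq> v + fvec l \<Longrightarrow> psi (v, l) = basis (Pt (rep v), [twist (v, l)])"
  by (simp add: psi_def)

lemma psi_from: "omega v = v \<Longrightarrow>
    psi (v, l) = (\<Sum>k\<in>Ix. Poly_Mapping.single (Copy k, [Gamma k]) (zt (k * level (v + fvec l))))"
  by (simp add: psi_def)

lemma psi_into: "omega v \<noteq> v \<Longrightarrow> omega (v + fvec l) = v + fvec l \<Longrightarrow>
    psi (v, l) = (\<Sum>k\<in>Ix. Poly_Mapping.single (Pt (rep v), [Beta k]) (zt (- k * level v)))"
  by (simp add: psi_def)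

lemma act_arr_pair: "act_arr g (v, l) = (omega_pow g v, (l - g) mod 3)"
  by (simp add: act_arr_def)

lemma act_head: "omega_pow g v + fvec (l - g) = omega_pow g (v + fvec l)"
  by (simp add: omega_pow_add_f)

lemma mod3_shift:
  fixes l p q g :: int
  shows "((l - g) mod 3 + (q + g) mod 3) mod 3 = (l + q) mod 3"
    "((p + g) mod 3 - (q + g) mod 3) mod 3 = (p - q) mod 3"
  by (simp_all only: mod_add_eq mod_diff_eq) simp_all

text \<open>Rotation changes the levels of both ends by the same amount, and the label by the opposite
  amount.\<close>
lemma twist_act:
  assumes "omega v \<noteq> v" "omega (v + fvec l) \<noteq> v + fvec l"
  shows "twist (act_arr g (v, l)) = twist (v, l)"
proof -
  have "omega_pow g v + fvec ((l - g) mod 3) = omega_pow g (v + fvec l)"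
    by (simp only: fvec_mod act_head)
  then show ?thesis
    by (simp only: twist_def act_arr_pair prod.case level_omega_pow[OF assms(1)]
        level_omega_pow[OF assms(2)] mod3_shift rep_omega_pow)
qed

lemma head_twist:
  assumes "omega v \<noteq> v" "omega (v + fvec l) \<noteq> v + fvec l"
  shows "headD s (twist (v, l)) = Pt (rep (v + fvec l))"
proof -
  have "omega_pow (level v - level (v + fvec l)) (rep v) = omega_pow (- level (v + fvec l)) (omega_pow (level v) (rep v))"
    by (simp only: omega_pow_add) simp
  then show ?thesis
    by (simp add: twist_def) (simp add: rep_def[of "v + fvec l"] omega_pow_add_f)
qed

locale covering =
  fixes s :: int
  assumes s_ge: "s \<ge> 2"
begin

abbreviation A where "A \<equiv> quiverA s"
abbreviation D where "D \<equiv> quiverD s"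
abbreviation X where "X \<equiv> Xpt s"
abbreviation Y where "Y \<equiv> Xpt s - fvec 0"
abbreviation Z where "Z \<equiv> Xpt s + fvec 2"

lemma quiverA_simps:
  "verts A = simplex s" "tail A = fst" "head A (v, l) = v + fvec l"
  "(v, l) \<in> arcs A \<longleftrightarrow> l \<in> Ix \<and> v \<in> simplex s \<and> v + fvec l \<in> simplex s"
  by (simp_all add: quiverA_def)

lemma quiverD_simps:
  "verts D = Pt ` {x \<in> simplex s. dominant x} \<union> (if s mod 3 = 1 then Copy ` Ix else {})"
  "tail D = tailD s" "head D = headD s"
  "arcs D = Q1_D s \<union> (if s mod 3 = 1 then Beta ` Ix \<union> Gamma ` Ix else {})"
  by (simp_all add: quiverD_def Q0_D_def dominant_def)

lemma Q0_D_iff: "x \<in> Q0_D s \<longleftrightarrow> x \<in> simplex s \<and> dominant x"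
  by (simp add: Q0_D_def dominant_def)

lemma Alpha_arc: "Alpha x i j \<in> arcs D \<longleftrightarrow>
    x \<in> simplex s \<and> dominant x \<and> i \<in> Ix \<and> j \<in> Ix \<and> omega_pow j x + fvec i \<in> simplex s \<and> dominant (omega_pow j x + fvec i)"
proof -
  have "Alpha x i j \<in> Q1_D s \<longleftrightarrow> x \<in> Q0_D s \<and> i \<in> Ix \<and> j \<in> Ix \<and> omega_pow j x + fvec i \<in> Q0_D s"
    unfolding Q1_D_def by blast
  moreover have "Alpha x i j \<in> arcs D \<longleftrightarrow> Alpha x i j \<in> Q1_D s"
    by (auto simp: quiverD_simps)
  ultimately show ?thesis unfolding Q0_D_iff by blast
qed

lemma nonAlpha_arc:
  "Beta k \<in> arcs D \<longleftrightarrow> s mod 3 = 1 \<and> k \<in> Ix"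
  "Gamma k \<in> arcs D \<longleftrightarrow> s mod 3 = 1 \<and> k \<in> Ix"
  by (auto simp: quiverD_simps Q1_D_def)

lemma fixed_simplex:
  assumes "v \<in> simplex s" "omega v = v"
  shows "s mod 3 = 1 \<and> v = X"
proof -
  obtain t where t: "v = (t, t, t)" using assms(2) by (rule fixed_triple)
  then have "s = 3 * t + 1" using assms(1) by (simp add: simplex_def)
  then have "s mod 3 = 1" "(s - 1) div 3 = t" by presburger+
  then show ?thesis by (simp add: t Xpt_def)
qed

lemma X_fixed [simp]: "omega X = X"
  by (simp add: Xpt_def)

lemma X_coords:
  assumes "s mod 3 = 1"
  obtains t where "t \<ge> 1" "X = (t, t, t)" "s = 3 * t + 1"
proof
  show "(s - 1) div 3 \<ge> 1" "s = 3 * ((s - 1) div 3) + 1" using assms s_ge by presburger+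
qed (simp add: Xpt_def)

lemma neighbours_X:
  assumes "s mod 3 = 1"
  shows "X \<in> simplex s" "Y \<in> simplex s" "Z \<in> simplex s" "dominant Y" "dominant Z"
proof -
  obtain t where t: "t \<ge> 1" "X = (t, t, t)" "s = 3 * t + 1" using assms by (rule X_coords)
  have YZ: "Y = (t + 1, t - 1, t)" "Z = (t + 1, t, t - 1)" by (simp_all add: t(2) fvec_def)
  show "X \<in> simplex s" "Y \<in> simplex s" "Z \<in> simplex s" "dominant Y" "dominant Z"
    unfolding YZ unfolding t(2) simplex_def dominant_def using t(1,3) by simp_all
qed

text \<open>The arrows into the fixed point form one orbit, that of the arrow from the dominant
  neighbour \<open>Y\<close> with label 0; likewise the arrows out of it are the rotations of the arrow to the
  dominant neighbour \<open>Z\<close> with label 2.\<close>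
lemma into_X:
  assumes "s mod 3 = 1" "v + fvec l = X"
  shows "v = omega_pow (- l) Y" "rep v = Y" "level v = (- l) mod 3" "omega v \<noteq> v"
proof -
  have "omega_pow (- l) Y + fvec l = omega_pow (- l) (Y + fvec 0)"
    by (simp only: omega_pow_add_f) simp
  also have "\<dots> = X" by (simp add: omega_pow_fixed)
  finally show v: "v = omega_pow (- l) Y" using assms(2) by (simp add: triple_eq_diff)
  have Y: "dominant Y" "omega Y \<noteq> Y" using neighbours_X[OF assms(1)] not_dominant_fixed by blast+
  show "rep v = Y" by (simp add: v rep_level_0 level_dominant[OF Y(1)])
  show "level v = (- l) mod 3" by (simp add: v level_omega_pow[OF Y(2)] level_dominant[OF Y(1)])
  show "omega v \<noteq> v" using Y(2) by (simp add: v)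
qed

lemma from_X:
  assumes "s mod 3 = 1"
  shows "X + fvec l = omega_pow (2 - l) Z" "rep (X + fvec l) = Z" "level (X + fvec l) = (2 - l) mod 3"
    "omega (X + fvec l) \<noteq> X + fvec l"
proof -
  have "omega_pow (2 - l) Z = omega_pow (2 - l) X + fvec l"
    by (simp only: omega_pow_add_f) simp
  then show w: "X + fvec l = omega_pow (2 - l) Z" by (simp add: omega_pow_fixed)
  have Z: "dominant Z" "omega Z \<noteq> Z" using neighbours_X[OF assms(1)] not_dominant_fixed by blast+
  show "rep (X + fvec l) = Z" unfolding w by (simp add: rep_level_0 level_dominant[OF Z(1)])
  show "level (X + fvec l) = (2 - l) mod 3"
    unfolding w by (simp add: level_omega_pow[OF Z(2)] level_dominant[OF Z(1)])
  show "omega (X + fvec l) \<noteq> X + fvec l" unfolding w using Z(2) by simp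
qed

lemma finite_quiverA: "finite_quiver A"
proof
  have "simplex s \<subseteq> {0..s} \<times> {0..s} \<times> {0..s}" by (auto simp: simplex_def)
  then show "finite (verts A)" unfolding quiverA_simps by (rule finite_subset) simp
  then have "finite (simplex s \<times> Ix)" by (simp add: quiverA_simps)
  then show "finite (arcs A)" by (rule rev_finite_subset) (auto simp: quiverA_def)
qed (auto simp: quiverA_def)

lemma finite_quiverD: "finite_quiver D"
proof
  have fin: "finite (simplex s)" using finite_quiver.finite_verts[OF finite_quiverA] by (simp add: quiverA_simps)
  then show "finite (verts D)" by (simp add: quiverD_simps)
  have "Q1_D s \<subseteq> (\<lambda>(x, i, j). Alpha x i j) ` (simplex s \<times> Ix \<times> Ix)"
  proof
    fix a assume "a \<in> Q1_D s"
    then obtain x i j where "a = Alpha x i j" "x \<in> simplex s" "i \<in> Ix" "j \<in> Ix"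
      unfolding Q1_D_def Q0_D_iff by blast
    then show "a \<in> (\<lambda>(x, i, j). Alpha x i j) ` (simplex s \<times> Ix \<times> Ix)"
      by (intro image_eqI[of _ _ "(x, i, j)"]) simp_all
  qed
  then have "finite (Q1_D s)" by (rule finite_subset) (simp add: fin)
  then show "finite (arcs D)" by (simp add: quiverD_simps)
  fix a assume a: "a \<in> arcs D"
  show "tail D a \<in> verts D"
    using a neighbours_X by (cases a) (auto simp: Alpha_arc quiverD_simps(1,2) image_iff nonAlpha_arc)
  show "head D a \<in> verts D"
    using a neighbours_X by (cases a) (auto simp: Alpha_arc quiverD_simps(1,3) image_iff nonAlpha_arc)
qed

sublocale A: finite_quiver A by (rule finite_quiverA)
sublocale D: finite_quiver D by (rule finite_quiverD)

text \<open>Distinct fixed points do not occur, so an arrow meets the fixed point in at most one end.\<close>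
lemma arc_cases [consumes 1, case_names off out into]:
  assumes "(v, l) \<in> arcs A"
  obtains "omega v \<noteq> v" "omega (v + fvec l) \<noteq> v + fvec l"
  | "s mod 3 = 1" "v = X" "omega v = v" "omega (v + fvec l) \<noteq> v + fvec l"
  | "s mod 3 = 1" "v + fvec l = X" "omega v \<noteq> v" "omega (v + fvec l) = v + fvec l"
proof -
  have simplex: "v \<in> simplex s" "v + fvec l \<in> simplex s" using assms by (simp_all add: quiverA_simps)
  consider "omega v \<noteq> v" "omega (v + fvec l) \<noteq> v + fvec l" | "omega v = v"
    | "omega v \<noteq> v" "omega (v + fvec l) = v + fvec l" by metis
  then show ?thesis
  proof cases
    case 1
    then show ?thesis by (rule that(1))
  next
    case 2
    then have X: "s mod 3 = 1" "v = X" using fixed_simplex[OF simplex(1)] by simp_all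
    have "omega (v + fvec l) \<noteq> v + fvec l" unfolding X(2) using X(1) by (rule from_X(4))
    with X 2 show ?thesis by (intro that(2))
  next
    case 3
    then have "s mod 3 = 1" "v + fvec l = X" using fixed_simplex[OF simplex(2)] by simp_all
    with 3 show ?thesis by (intro that(3))
  qed
qed

lemma tau_tau:
  assumes "v \<in> simplex s" "v' \<in> simplex s"
  shows "pmult D (tau g v) (tau h v') = (if rep v = rep v' then tau (g + h) v else 0)"
proof (cases "omega v = v"; cases "omega v' = v'")
  assume "omega v = v" "omega v' = v'"
  then have "v = v'" using assms fixed_simplex by metis
  then show ?thesis
    using \<open>omega v = v\<close>
    by (simp add: tau_fixed pmult_sum_left pmult_sum_right pmult_single_single sum.delta distrib_left zt_add cong: if_cong)
next
  assume f: "omega v = v" "omega v' \<noteq> v'"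
  then have "rep v \<noteq> rep v'" by (metis fixed_rep)
  then show ?thesis using f by (simp add: tau_fixed tau_off pmult_sum_left pmult_single_single)
next
  assume f: "omega v \<noteq> v" "omega v' = v'"
  then have "rep v \<noteq> rep v'" by (metis fixed_rep)
  then show ?thesis using f by (simp add: tau_fixed tau_off pmult_sum_right pmult_single_single)
qed (simp add: tau_off pmult_single_single)

text \<open>This is the relation \<open>(e \<otimes> g) (a \<otimes> 0) = (g a \<otimes> 0) (e \<otimes> g)\<close> of the skew group algebra. It is
  what makes the images of paths depend on their orbit only.\<close>
lemma tau_psi_commute:
  assumes "(v, l) \<in> arcs A"
  shows "pmult D (tau g v) (psi (v, l)) = pmult D (psi (act_arr g (v, l))) (tau g (v + fvec l))"
  using assms
proof (cases rule: arc_cases)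
  case off
  then have "psi (act_arr g (v, l)) = basis (Pt (rep v), [twist (v, l)])"
    using twist_act[OF off, of g] by (simp add: act_arr_pair psi_off act_head)
  then show ?thesis
    using off by (simp add: psi_off tau_off pmult_single_single quiverD_simps head_twist)
next
  case out
  have "psi (act_arr g (v, l)) = (\<Sum>k\<in>Ix. Poly_Mapping.single (Copy k, [Gamma k]) (zt (k * (level (v + fvec l) + g))))"
    using out(3,4) by (simp add: act_arr_pair psi_from act_head level_omega_pow)
  moreover have "rep (v + fvec l) = Z" using from_X(2)[OF out(1)] by (simp only: out(2))
  ultimately show ?thesis
    using out(3,4)
    by (simp add: psi_from tau_fixed tau_off pmult_sum_left pmult_sum_right pmult_single_single
        quiverD_simps sum.delta distrib_left zt_add mult.commute cong: if_cong)
next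
  case into
  have "psi (act_arr g (v, l)) = (\<Sum>k\<in>Ix. Poly_Mapping.single (Pt (rep v), [Beta k]) (zt (- k * (level v + g))))"
    using into zt_mult_mod[of "- k" for k] by (simp add: act_arr_pair psi_into act_head level_omega_pow)
  moreover have "zt (- k * (level v + g)) * zt (k * g) = zt (- k * level v)" for k
    by (simp add: zt_add[symmetric] algebra_simps)
  ultimately show ?thesis
    using into
    by (simp add: psi_into tau_fixed tau_off pmult_sum_left pmult_sum_right pmult_single_single
        quiverD_simps sum.delta cong: if_cong)
qed

lemma tau_psi: "(v, l) \<in> arcs A \<Longrightarrow> pmult D (tau 0 v) (psi (v, l)) = psi (v, l)"
  by (erule arc_cases)
    (simp_all add: psi_off psi_from psi_into tau_off tau_fixed pmult_sum_left pmult_sum_right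
      pmult_single_single sum.delta cong: if_cong)

lemma tau_closed:
  assumes "v \<in> simplex s"
  shows "tau g v \<in> supported (paths D)"
proof (cases "omega v = v")
  case True
  have "Poly_Mapping.single (Copy k, []) (zt (k * g)) \<in> supported (paths D)" if "k \<in> Ix" for k
    using that fixed_simplex[OF assms True] by (simp add: supported_def quiverD_simps)
  then show ?thesis unfolding tau_fixed[OF True] by (rule subspace_sum[OF subspace_supported])
next
  case False
  then show ?thesis using assms dominant_rep[OF False] by (simp add: tau_off quiverD_simps)
qed

lemma twist_arc:
  assumes "(v, l) \<in> arcs A" "omega v \<noteq> v" "omega (v + fvec l) \<noteq> v + fvec l"
  shows "twist (v, l) \<in> arcs D"
  using assms head_twist[OF assms(2,3), of s] dominant_rep mod3_Ix
  by (simp add: twist_def Alpha_arc quiverA_simps)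

lemma psi_closed:
  assumes "(v, l) \<in> arcs A"
  shows "psi (v, l) \<in> supported (paths D)"
  using assms
proof (cases rule: arc_cases)
  case off
  have "tailD s (twist (v, l)) = Pt (rep v)" by (simp add: twist_def)
  then show ?thesis
    using twist_arc[OF assms off] D.head_in[OF twist_arc[OF assms off]] off
    by (simp add: psi_off D.path_Cons quiverD_simps(2))
next
  case out
  then show ?thesis
    unfolding psi_from[OF out(3)]
    using neighbours_X[OF out(1)]
    by (intro subspace_sum[OF subspace_supported]) (auto simp: supported_def D.path_Cons quiverD_simps)
next
  case into
  then show ?thesis
    unfolding psi_into[OF into(3,4)] into_X(2)[OF into(1,2)]
    using neighbours_X[OF into(1)]
    by (intro subspace_sum[OF subspace_supported]) (auto simp: supported_def D.path_Cons quiverD_simps)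
qed

text \<open>The image of \<open>p \<otimes> g\<close> for a path \<open>p\<close> starting at \<open>v\<close>.\<close>
primrec NN :: "int \<Rightarrow> triple \<Rightarrow> arrA list \<Rightarrow> (vertD, arrD) path \<Rightarrow>\<^sub>0 complex" where
  "NN g v [] = tau g v"
| "NN g v (a # p) = pmult D (psi a) (NN g (fst a + fvec (snd a)) p)"

lemma pathA_Cons: "(v, a # p) \<in> paths A \<longleftrightarrow>
    (\<exists>l. a = (v, l) \<and> (v, l) \<in> arcs A \<and> (v + fvec l, p) \<in> paths A)"
  by (cases a) (auto simp: A.path_Cons quiverA_simps(2,3))

lemma pathA_fst: "(v, p) \<in> paths A \<Longrightarrow> v \<in> simplex s"
  using A.path_fst[of "(v, p)"] by (simp add: quiverA_simps)

lemma pathA_end: "(v, p) \<in> paths A \<Longrightarrow> path_end A (v, p) \<in> simplex s"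
  using A.path_end_in[of "(v, p)"] by (simp add: quiverA_simps)

lemma NN_closed: "(v, p) \<in> paths A \<Longrightarrow> NN g v p \<in> supported (paths D)"
proof (induction p arbitrary: v)
  case Nil
  then show ?case using tau_closed by (simp add: quiverA_simps)
next
  case (Cons a p)
  then obtain l where "a = (v, l)" "(v, l) \<in> arcs A" "(v + fvec l, p) \<in> paths A" by (auto simp: pathA_Cons)
  then show ?case using Cons.IH psi_closed by (simp add: D.pmult_closed)
qed

lemma NN_mod [simp]: "NN (g mod 3) v p = NN g v p"
  by (induction p arbitrary: v) simp_all

lemma NN_equivariant:
  "(v, p) \<in> paths A \<Longrightarrow> pmult D (tau g v) (NN h v p) = NN (g + h) (omega_pow g v) (map (act_arr g) p)"
proof (induction p arbitrary: v)
  case Nil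
  then have "v \<in> simplex s" by (rule pathA_fst)
  then show ?case by (simp add: tau_tau)
next
  case (Cons a p)
  then obtain l where a: "a = (v, l)" "(v, l) \<in> arcs A" "(v + fvec l, p) \<in> paths A" by (auto simp: pathA_Cons)
  have head: "fst (act_arr g (v, l)) + fvec (snd (act_arr g (v, l))) = omega_pow g (v + fvec l)"
    by (simp only: act_arr_pair fst_conv snd_conv fvec_mod act_head)
  have "pmult D (tau g v) (NN h v (a # p)) = pmult D (pmult D (tau g v) (psi (v, l))) (NN h (v + fvec l) p)"
    by (simp add: a(1) pmult_assoc)
  also have "\<dots> = pmult D (psi (act_arr g (v, l))) (pmult D (tau g (v + fvec l)) (NN h (v + fvec l) p))"
    by (simp add: tau_psi_commute[OF a(2)] pmult_assoc)
  also have "\<dots> = NN (g + h) (omega_pow g v) (map (act_arr g) (a # p))"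
    by (simp only: a(1) list.map NN.simps head Cons.IH[OF a(3)])
  finally show ?case .
qed

lemma NN_tau_left:
  assumes "(v, p) \<in> paths A"
  shows "pmult D (tau 0 v) (NN g v p) = NN g v p"
proof (cases p)
  case Nil
  then show ?thesis using pathA_fst[OF assms] by (simp add: tau_tau)
next
  case (Cons a q)
  then obtain l where a: "a = (v, l)" "(v, l) \<in> arcs A" using assms by (auto simp: pathA_Cons)
  then show ?thesis by (simp add: Cons pmult_assoc[symmetric] tau_psi)
qed

text \<open>The product \<open>(p \<otimes> g) (q \<otimes> h) = p (g q) \<otimes> (g + h)\<close> is respected. Multiplicativity is stated
  only for \<open>p\<close> and \<open>q\<close> whose product is not 0: images of vertices in one orbit coincide, so a
  product that vanishes in type A may have a nonzero counterpart in type D.\<close>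
lemma NN_append:
  "(v, p) \<in> paths A \<Longrightarrow> path_end A (v, p) = omega_pow g w \<Longrightarrow> (w, q) \<in> paths A
    \<Longrightarrow> pmult D (NN g v p) (NN h w q) = NN (g + h) v (p @ map (act_arr g) q)"
proof (induction p arbitrary: v)
  case Nil
  then show ?case using NN_equivariant[of w q g h] by simp
next
  case (Cons a p)
  then obtain l where a: "a = (v, l)" "(v, l) \<in> arcs A" "(v + fvec l, p) \<in> paths A" by (auto simp: pathA_Cons)
  then show ?case using Cons by (simp add: pmult_assoc quiverA_simps)
qed

lemma NN_tau_right:
  "(v, p) \<in> paths A \<Longrightarrow> pmult D (NN g v p) (tau h (path_end A (v, p))) = NN (g + h) v p"
proof -
  assume p: "(v, p) \<in> paths A"
  let ?e = "omega_pow (- g) (path_end A (v, p))"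
  have "(?e, []) \<in> paths A" using pathA_end[OF p] by (simp add: quiverA_simps omega_pow_simplex)
  then have "pmult D (NN g v p) (NN h ?e []) = NN (g + h) v (p @ map (act_arr g) [])"
    using p by (intro NN_append) simp_all
  then show ?thesis by simp
qed

end

section \<open>The skew product on paths of type A\<close>

lemma act_path_algebra_eq: "act_path_algebra g = lin_ext (\<lambda>p. basis (act_path g p))"
  by (rule ext) (simp add: act_path_algebra_def lin_ext_def)

lemma act_path_algebra_basis [simp]: "act_path_algebra g (basis p) = basis (act_path g p)"
  by (simp add: act_path_algebra_eq)

lemma lin_act: "lin (act_path_algebra g)"
  unfolding act_path_algebra_eq by (rule lin_lin_ext)

lemma lin_act_comp [lin_intros]: "lin F \<Longrightarrow> lin (\<lambda>a. act_path_algebra g (F a))"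
  by (rule lin_comp[OF lin_act])

lemma act_path_pair: "act_path g (v, p) = (omega_pow g v, map (act_arr g) p)"
  by (simp add: act_path_def)

lemma act_arr_comp: "act_arr g \<circ> act_arr h = act_arr (g + h)"
  by (rule ext) (simp add: act_arr_add)

lemma act_path_add: "act_path g (act_path h p) = act_path (g + h) p"
  by (cases p) (simp add: act_path_pair omega_pow_add act_arr_comp)

lemma act_path_mod [simp]: "act_path (g mod 3) p = act_path g p"
proof -
  have "act_arr (g mod 3) = act_arr g" by (rule ext) (rule act_mod)
  then show ?thesis by (cases p) (simp add: act_path_pair)
qed

lemma act_path_algebra_mod [simp]: "act_path_algebra (g mod 3) a = act_path_algebra g a"
  by (simp add: act_path_algebra_eq)

lemma act_act: "act_path_algebra g (act_path_algebra h a) = act_path_algebra (g + h) a"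
  by (rule lin_eq_on[where F = "\<lambda>a. act_path_algebra g (act_path_algebra h a)" and a = a])
    (intro lin_intros lin_act, intro lin_act, simp add: act_path_add)

lemma sum_Ix_shift:
  fixes f :: "int \<Rightarrow> 'b :: comm_monoid_add"
  assumes "g \<in> Ix"
  shows "(\<Sum>k\<in>Ix. f ((k - g) mod 3)) = (\<Sum>k\<in>Ix. f k)"
proof -
  consider "g = 0" | "g = 1" | "g = 2" using assms by (auto simp: Ix_def)
  then show ?thesis by cases (simp_all add: Ix_def ac_simps)
qed

context covering
begin

lemma act_path_in:
  assumes "p \<in> paths A"
  shows "act_path g p \<in> paths A" "path_end A (act_path g p) = omega_pow g (path_end A p)"
proof -
  obtain v q where p: "p = (v, q)" by (cases p)
  then have walk: "A.awalk (omega_pow g v) (map (act_arr g) q) (omega_pow g (path_end A (v, q)))"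
    using assms by (intro act_walk) (simp add: A.path_iff)
  show "path_end A (act_path g p) = omega_pow g (path_end A p)"
    using A.awalk_path_end[OF walk] by (simp add: p act_path_pair)
  then show "act_path g p \<in> paths A"
    using walk by (simp add: p act_path_pair A.path_iff)
qed

lemma act_closed:
  assumes "a \<in> supported (paths A)"
  shows "act_path_algebra g a \<in> supported (paths A)"
proof (rule lin_mem[OF lin_act subspace_supported])
  fix p assume "p \<in> Poly_Mapping.keys a"
  then have "p \<in> paths A" using assms by (auto simp: supported_def)
  then show "act_path_algebra g (basis p) \<in> supported (paths A)"
    by (simp add: act_path_in(1))
qed

lemma act_zero:
  assumes "a \<in> supported (paths A)"
  shows "act_path_algebra 0 a = a"
proof (rule lin_eq_on[OF lin_act lin_ident])
  fix p assume "p \<in> Poly_Mapping.keys a"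
  then have "p \<in> paths A" using assms by (auto simp: supported_def)
  then have "set (snd p) \<subseteq> arcs A" by (cases p) (auto simp: paths_def A.awalk_def)
  then have "map (act_arr 0) (snd p) = snd p" by (intro map_idI) (auto simp: act_arr_0)
  then show "act_path_algebra 0 (basis p) = basis p" by (cases p) (simp add: act_path_pair)
qed

lemma act_pconcat:
  assumes "p \<in> paths A" "q \<in> paths A"
  shows "act_path_algebra g (pconcat A p q) = pconcat A (act_path g p) (act_path g q)"
  using act_path_in(2)[OF assms(1), of g]
  by (cases p; cases q) (simp add: pconcat_def act_path_pair lin_zero[OF lin_act])

lemma act_pmult:
  assumes "a \<in> supported (paths A)" "b \<in> supported (paths A)"
  shows "act_path_algebra g (pmult A a b) = pmult A (act_path_algebra g a) (act_path_algebra g b)"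
proof (rule lin_eq_on[where F = "\<lambda>a. act_path_algebra g (pmult A a b)"
      and G = "\<lambda>a. pmult A (act_path_algebra g a) (act_path_algebra g b)" and a = a])
  fix p assume p: "p \<in> Poly_Mapping.keys a"
  show "act_path_algebra g (pmult A (basis p) b) = pmult A (act_path_algebra g (basis p)) (act_path_algebra g b)"
  proof (rule lin_eq_on[where F = "\<lambda>b. act_path_algebra g (pmult A (basis p) b)"
        and G = "\<lambda>b. pmult A (act_path_algebra g (basis p)) (act_path_algebra g b)" and a = b])
    fix q assume "q \<in> Poly_Mapping.keys b"
    then show "act_path_algebra g (pmult A (basis p) (basis q))
        = pmult A (act_path_algebra g (basis p)) (act_path_algebra g (basis q))"
      using p assms act_pconcat[of p q g] by (auto simp: supported_def pmult_basis)
  qed (intro lin_intros)+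
qed (intro lin_intros)+

text \<open>The paths \<open>p\<close> for which \<open>p \<otimes> g\<close> lies in the corner: from a vertex of level 0 to the \<open>g\<close>-th
  rotation of a vertex of level 0. Among vertices of level 0 distinct ones lie in distinct orbits,
  so on these paths the map to type D also preserves vanishing products.\<close>
definition KP :: "int \<Rightarrow> (triple, arrA) path set" where
  "KP g = {p \<in> paths A. level (fst p) = 0 \<and> level (omega_pow (- g) (path_end A p)) = 0}"

lemma KP_paths: "supported (KP g) \<subseteq> supported (paths A)"
  by (auto simp: KP_def supported_def)

lemma KP_mod [simp]: "KP (g mod 3) = KP g"
proof -
  have "omega_pow (- (g mod 3)) v = omega_pow (- g) v" for v
    by (metis mod_minus_eq omega_pow_mod)
  then show ?thesis by (simp add: KP_def)
qed

text \<open>The image of \<open>a \<otimes> g\<close> for a linear combination \<open>a\<close> of paths.\<close>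
definition Ng :: "int \<Rightarrow> ((triple, arrA) path \<Rightarrow>\<^sub>0 complex) \<Rightarrow> (vertD, arrD) path \<Rightarrow>\<^sub>0 complex" where
  "Ng g = lin_ext (\<lambda>p. NN g (fst p) (snd p))"

lemma lin_Ng: "lin (Ng g)"
  unfolding Ng_def by (rule lin_lin_ext)

lemma lin_Ng_comp [lin_intros]: "lin F \<Longrightarrow> lin (\<lambda>a. Ng g (F a))"
  by (rule lin_comp[OF lin_Ng])

lemma Ng_basis [simp]: "Ng g (basis (v, p)) = NN g v p"
  by (simp add: Ng_def)

lemma Ng_mod [simp]: "Ng (g mod 3) a = Ng g a"
  by (simp add: Ng_def)

lemma Ng_closed:
  assumes "a \<in> supported (paths A)"
  shows "Ng g a \<in> supported (paths D)"
proof (rule lin_mem[OF lin_Ng subspace_supported])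
  fix p assume "p \<in> Poly_Mapping.keys a"
  then have "(fst p, snd p) \<in> paths A" using assms by (auto simp: supported_def)
  then show "Ng g (basis p) \<in> supported (paths D)" by (simp add: Ng_def NN_closed)
qed

lemma KP_mult_basis:
  assumes "p \<in> KP g" "q \<in> KP h"
  shows "Ng (g + h) (pconcat A p (act_path g q)) = pmult D (Ng g (basis p)) (Ng h (basis q))"
    "pconcat A p (act_path g q) \<in> supported (KP (g + h))"
proof -
  obtain v P w R where p: "p = (v, P)" and q: "q = (w, R)" by (cases p, cases q)
  have P: "(v, P) \<in> paths A" and R: "(w, R) \<in> paths A" using assms by (auto simp: KP_def p q)
  have w: "rep w = w" using assms(2) by (simp add: KP_def q rep_level_0)
  let ?e = "path_end A (v, P)"
  have e: "rep ?e = omega_pow (- g) ?e"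
  proof -
    have "rep ?e = rep (omega_pow (- g) ?e)" by (simp only: rep_omega_pow)
    also have "\<dots> = omega_pow (- g) ?e" using assms(1) by (intro rep_level_0) (simp add: KP_def p)
    finally show ?thesis .
  qed
  show "Ng (g + h) (pconcat A p (act_path g q)) = pmult D (Ng g (basis p)) (Ng h (basis q))"
  proof (cases "?e = omega_pow g w")
    case True
    then have "pconcat A p (act_path g q) = basis (v, P @ map (act_arr g) R)"
      by (simp add: pconcat_def p q act_path_pair)
    then show ?thesis using NN_append[OF P True R] by (simp add: p q)
  next
    case False
    \<comment> \<open>The ends of the images are representatives of different orbits, so the images do not compose either.\<close>
    then have "rep ?e \<noteq> rep w" unfolding e w by (metis omega_pow_cancel(1))
    have "pmult D (NN g v P) (NN h w R)
        = pmult D (NN g v P) (pmult D (pmult D (tau 0 ?e) (tau 0 w)) (NN h w R))"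
      using NN_tau_right[OF P, of g 0] NN_tau_left[OF R, of h] by (metis add.right_neutral pmult_assoc)
    also have "\<dots> = 0"
      using \<open>rep ?e \<noteq> rep w\<close> by (simp add: tau_tau[OF pathA_end[OF P] pathA_fst[OF R]])
    finally show ?thesis using False by (simp add: p q pconcat_def act_path_pair lin_zero[OF lin_Ng])
  qed
  show "pconcat A p (act_path g q) \<in> supported (KP (g + h))"
  proof (cases "?e = omega_pow g w")
    case True
    have act: "act_path g q \<in> paths A" "path_end A (act_path g q) = omega_pow g (path_end A q)"
      using act_path_in[of q g] assms(2) by (simp_all add: KP_def)
    have "(v, P @ snd (act_path g q)) \<in> paths A"
      using A.path_append[OF P act(1)] True by (simp add: q act_path_pair)
    moreover have "path_end A (v, P @ snd (act_path g q)) = omega_pow g (path_end A q)"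
      using path_end_append[of A v P "act_path g q"] True act(2) by (simp add: q act_path_pair)
    moreover have "omega_pow (- (g + h)) (omega_pow g (path_end A q)) = omega_pow (- h) (path_end A q)"
      by (simp add: omega_pow_add)
    ultimately have "(v, P @ snd (act_path g q)) \<in> KP (g + h)"
      using assms unfolding KP_def by (simp add: p)
    then show ?thesis using True by (simp add: pconcat_def p q act_path_pair)
  next
    case False
    then show ?thesis by (simp add: pconcat_def p q act_path_pair supported_def)
  qed
qed

lemma KP_mult:
  assumes a: "a \<in> supported (KP g)" and b: "b \<in> supported (KP h)"
  shows "Ng (g + h) (pmult A a (act_path_algebra g b)) = pmult D (Ng g a) (Ng h b)"
    "pmult A a (act_path_algebra g b) \<in> supported (KP (g + h))"
proof -
  have keys: "p \<in> KP g" if "p \<in> Poly_Mapping.keys a" for p using a that by (auto simp: supported_def)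
  have keys': "q \<in> KP h" if "q \<in> Poly_Mapping.keys b" for q using b that by (auto simp: supported_def)
  show "Ng (g + h) (pmult A a (act_path_algebra g b)) = pmult D (Ng g a) (Ng h b)"
  proof (rule lin_eq_on[where F = "\<lambda>a. Ng (g + h) (pmult A a (act_path_algebra g b))"
        and G = "\<lambda>a. pmult D (Ng g a) (Ng h b)" and a = a])
    fix p assume p: "p \<in> Poly_Mapping.keys a"
    show "Ng (g + h) (pmult A (basis p) (act_path_algebra g b)) = pmult D (Ng g (basis p)) (Ng h b)"
    proof (rule lin_eq_on[where F = "\<lambda>b. Ng (g + h) (pmult A (basis p) (act_path_algebra g b))"
          and G = "\<lambda>b. pmult D (Ng g (basis p)) (Ng h b)" and a = b])
      fix q assume "q \<in> Poly_Mapping.keys b"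
      then show "Ng (g + h) (pmult A (basis p) (act_path_algebra g (basis q)))
          = pmult D (Ng g (basis p)) (Ng h (basis q))"
        using KP_mult_basis(1)[OF keys[OF p] keys'] by (simp add: pmult_basis)
    qed (intro lin_intros)+
  qed (intro lin_intros)+
  show "pmult A a (act_path_algebra g b) \<in> supported (KP (g + h))"
  proof (rule lin_mem[where F = "\<lambda>a. pmult A a (act_path_algebra g b)" and a = a])
    fix p assume p: "p \<in> Poly_Mapping.keys a"
    show "pmult A (basis p) (act_path_algebra g b) \<in> supported (KP (g + h))"
    proof (rule lin_mem[where F = "\<lambda>b. pmult A (basis p) (act_path_algebra g b)" and a = b])
      fix q assume "q \<in> Poly_Mapping.keys b"
      then show "pmult A (basis p) (act_path_algebra g (basis q)) \<in> supported (KP (g + h))"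
        using KP_mult_basis(2)[OF keys[OF p] keys'] by (simp add: pmult_basis)
    qed (intro lin_intros subspace_supported)+
  qed (intro lin_intros subspace_supported)+
qed

text \<open>The product of the skew group algebra, for families of elements of the path algebra: \<open>u\<close>
  stands for the sum of the \<open>u g \<otimes> g\<close>.\<close>
definition star ::
    "(int \<Rightarrow> (triple, arrA) path \<Rightarrow>\<^sub>0 complex) \<Rightarrow> (int \<Rightarrow> (triple, arrA) path \<Rightarrow>\<^sub>0 complex) \<Rightarrow> int \<Rightarrow> (triple, arrA) path \<Rightarrow>\<^sub>0 complex" where
  "star u v k = (\<Sum>g\<in>Ix. pmult A (u g) (act_path_algebra g (v ((k - g) mod 3))))"

definition Psi :: "(int \<Rightarrow> (triple, arrA) path \<Rightarrow>\<^sub>0 complex) \<Rightarrow> (vertD, arrD) path \<Rightarrow>\<^sub>0 complex" where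
  "Psi u = (\<Sum>g\<in>Ix. Ng g (u g))"

definition corner_element :: "(int \<Rightarrow> (triple, arrA) path \<Rightarrow>\<^sub>0 complex) \<Rightarrow> bool" where
  "corner_element u \<longleftrightarrow> (\<forall>g\<in>Ix. u g \<in> supported (KP g))"

lemma star_summand:
  assumes "corner_element u" "corner_element v" "g \<in> Ix"
  shows "Ng k (pmult A (u g) (act_path_algebra g (v ((k - g) mod 3))))
      = pmult D (Ng g (u g)) (Ng ((k - g) mod 3) (v ((k - g) mod 3)))"
    "pmult A (u g) (act_path_algebra g (v ((k - g) mod 3))) \<in> supported (KP k)"
proof -
  have uv: "u g \<in> supported (KP g)" "v ((k - g) mod 3) \<in> supported (KP ((k - g) mod 3))"
    using assms mod3_Ix unfolding corner_element_def by blast+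
  have k: "(g + (k - g) mod 3) mod 3 = k mod 3" by (simp add: mod_add_right_eq)
  have "Ng (g + (k - g) mod 3) a = Ng k a" "KP (g + (k - g) mod 3) = KP k" for a
    by (metis k Ng_mod, metis k KP_mod)
  then show "Ng k (pmult A (u g) (act_path_algebra g (v ((k - g) mod 3))))
      = pmult D (Ng g (u g)) (Ng ((k - g) mod 3) (v ((k - g) mod 3)))"
    "pmult A (u g) (act_path_algebra g (v ((k - g) mod 3))) \<in> supported (KP k)"
    using KP_mult[OF uv] by simp_all
qed

lemma corner_element_star: "corner_element u \<Longrightarrow> corner_element v \<Longrightarrow> corner_element (star u v)"
  unfolding corner_element_def[of "star u v"] star_def
  using star_summand(2) by (intro ballI subspace_sum subspace_supported)

lemma Psi_star:
  assumes "corner_element u" "corner_element v"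
  shows "Psi (star u v) = pmult D (Psi u) (Psi v)"
proof -
  have "Psi (star u v) = (\<Sum>k\<in>Ix. \<Sum>g\<in>Ix. pmult D (Ng g (u g)) (Ng ((k - g) mod 3) (v ((k - g) mod 3))))"
    unfolding Psi_def star_def
    by (intro sum.cong refl) (simp only: lin_sum[OF lin_Ng] star_summand(1)[OF assms] cong: sum.cong)
  also have "\<dots> = (\<Sum>g\<in>Ix. \<Sum>k\<in>Ix. pmult D (Ng g (u g)) (Ng ((k - g) mod 3) (v ((k - g) mod 3))))"
    by (rule sum.swap)
  also have "\<dots> = (\<Sum>g\<in>Ix. \<Sum>k\<in>Ix. pmult D (Ng g (u g)) (Ng k (v k)))"
    by (intro sum.cong refl sum_Ix_shift)
  also have "\<dots> = pmult D (Psi u) (Psi v)"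
    by (simp only: Psi_def pmult_sum_left pmult_sum_right) (rule sum.swap)
  finally show ?thesis .
qed

end

section \<open>The path algebra of type D is the corner\<close>

context covering
begin

lemma zero_supported: "0 \<in> supported B"
  by (simp add: supported_def)

lemma psi_tau0: "(v, l) \<in> arcs A \<Longrightarrow> pmult D (psi (v, l)) (tau 0 (v + fvec l)) = psi (v, l)"
  using tau_psi_commute[of v l 0] tau_psi[of v l] act_arr_0[of "(v, l)" s] by simp

lemma psi_tau_off:
  "omega (v + fvec l) \<noteq> v + fvec l \<Longrightarrow> (v, l) \<in> arcs A \<Longrightarrow> pmult D (psi (v, l)) (tau g (v + fvec l)) = psi (v, l)"
  using psi_tau0[of v l] by (simp add: tau_off)

lemma path_single: "(v, [(v, l)]) \<in> paths A \<longleftrightarrow> (v, l) \<in> arcs A"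
  using A.head_in[of "(v, l)"] by (auto simp: pathA_Cons quiverA_simps)

lemma psi_Y: "s mod 3 = 1 \<Longrightarrow> psi (Y, 0) = (\<Sum>k\<in>Ix. basis (Pt Y, [Beta k]))"
  using into_X[of Y 0] by (simp add: psi_into)

lemma psi_X: "s mod 3 = 1 \<Longrightarrow> psi (X, l) = (\<Sum>k\<in>Ix. Poly_Mapping.single (Copy k, [Gamma k]) (zt (k * (2 - l))))"
  using from_X(3)[of l] by (simp add: psi_from)

lemma arc_Y: "s mod 3 = 1 \<Longrightarrow> (Y, 0) \<in> arcs A"
  using neighbours_X by (simp add: quiverA_simps Ix_def)

lemma arc_X:
  assumes "s mod 3 = 1"
  shows "(X, l mod 3) \<in> arcs A"
proof -
  have "X + fvec l \<in> simplex s"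
    using neighbours_X(3)[OF assms] by (simp only: from_X(1)[OF assms, of l] omega_pow_simplex)
  then show ?thesis using neighbours_X(1)[OF assms] mod3_Ix by (simp add: quiverA_simps)
qed

subsection \<open>Surjectivity\<close>

text \<open>A subalgebra that contains all vertices and arrows is everything, so the image is shown to
  be closed under products and to contain these generators.\<close>
definition image_Psi :: "((vertD, arrD) path \<Rightarrow>\<^sub>0 complex) set" where
  "image_Psi = Psi ` Collect corner_element"

lemma subspace_image: "subspace image_Psi"
  unfolding subspace_def
proof (intro conjI ballI allI)
  have sub: "subspace (supported (KP g))" for g by (rule subspace_supported)
  have "Psi (\<lambda>g. 0) = 0" by (simp add: Psi_def lin_zero[OF lin_Ng])
  moreover have "corner_element (\<lambda>g. 0)" using sub by (simp add: corner_element_def subspace_def)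
  ultimately show "0 \<in> image_Psi" unfolding image_Psi_def by (intro image_eqI[of _ _ "\<lambda>g. 0"]) simp_all
  fix a assume "a \<in> image_Psi"
  then obtain u where u: "corner_element u" "a = Psi u" by (auto simp: image_Psi_def)
  show "scale z a \<in> image_Psi" for z
  proof -
    have "scale z a = Psi (\<lambda>g. scale z (u g))" by (simp add: u(2) Psi_def lin_scale[OF lin_Ng] scale_sum)
    moreover have "corner_element (\<lambda>g. scale z (u g))" using u(1) sub by (simp add: corner_element_def subspace_def)
    ultimately show ?thesis unfolding image_Psi_def by simp
  qed
  fix b assume "b \<in> image_Psi"
  then obtain v where v: "corner_element v" "b = Psi v" by (auto simp: image_Psi_def)
  have "a + b = Psi (\<lambda>g. u g + v g)" by (simp add: u(2) v(2) Psi_def lin_add[OF lin_Ng] sum.distrib)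
  moreover have "corner_element (\<lambda>g. u g + v g)" using u(1) v(1) sub by (simp add: corner_element_def subspace_def)
  ultimately show "a + b \<in> image_Psi" unfolding image_Psi_def by simp
qed

lemma image_pmult: "a \<in> image_Psi \<Longrightarrow> b \<in> image_Psi \<Longrightarrow> pmult D a b \<in> image_Psi"
  unfolding image_Psi_def by (auto simp: Psi_star[symmetric] corner_element_star)

lemma image_Ng:
  assumes "a \<in> supported (KP g)"
  shows "Ng g a \<in> image_Psi"
proof -
  let ?u = "\<lambda>k. if k = g mod 3 then a else 0"
  have "corner_element ?u"
    using assms by (simp add: corner_element_def zero_supported)
  moreover have "Psi ?u = (\<Sum>k\<in>Ix. if k = g mod 3 then Ng k a else 0)"
    unfolding Psi_def by (intro sum.cong) (simp_all add: lin_zero[OF lin_Ng])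
  then have "Psi ?u = Ng g a" using mod3_Ix[of g] by (simp add: sum.delta)
  ultimately show ?thesis unfolding image_Psi_def by (intro image_eqI[of _ _ ?u]) simp_all
qed

lemma image_NN: "(v, p) \<in> KP g \<Longrightarrow> NN g v p \<in> image_Psi"
  using image_Ng[of "basis (v, p)" g] by simp

text \<open>A copy of the fixed point is recovered from the elements \<open>tau g X\<close> by Fourier inversion.\<close>
lemma image_vertex:
  assumes "U \<in> verts D"
  shows "basis (U, []) \<in> image_Psi"
proof (cases U)
  case (Pt x)
  then have x: "x \<in> simplex s" "dominant x" using assms by (auto simp: quiverD_simps split: if_splits)
  then have "omega x \<noteq> x" "level x = 0" "rep x = x"
    using not_dominant_fixed level_dominant rep_level_0 by blast+
  then show ?thesis
    using image_NN[of x "[]" 0] x by (simp add: Pt tau_off KP_def quiverA_simps)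
next
  case (Copy k)
  then have k: "k \<in> Ix" "s mod 3 = 1" using assms by (auto simp: quiverD_simps split: if_splits)
  have "(X, []) \<in> KP g" for g
    using neighbours_X(1)[OF k(2)] by (simp add: KP_def quiverA_simps level_fixed omega_pow_fixed)
  then have "tau g X \<in> image_Psi" for g using image_NN[of X "[]" g] by simp
  then have mem: "(\<Sum>g\<in>Ix. scale (zt (- k * g) / 3) (tau g X)) \<in> image_Psi"
    using subspace_image by (intro subspace_sum subspace_image) (simp add: subspace_def)
  have "(\<Sum>g\<in>Ix. scale (zt (- k * g) / 3) (tau g X))
      = (\<Sum>g\<in>Ix. \<Sum>l\<in>Ix. Poly_Mapping.single (Copy l, []) (zt ((l - k) * g) / 3))"
    by (intro sum.cong refl) (simp add: tau_fixed scale_sum zt_add[symmetric] algebra_simps)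
  also have "\<dots> = (\<Sum>l\<in>Ix. \<Sum>g\<in>Ix. Poly_Mapping.single (Copy l, []) (zt ((l - k) * g) / 3))"
    by (rule sum.swap)
  also have "\<dots> = (\<Sum>l\<in>Ix. scale ((\<Sum>g\<in>Ix. zt ((l - k) * g)) / 3) (basis (Copy l, [])))"
    by (intro sum.cong refl) (simp only: scale_sum_left sum_divide_distrib, simp)
  also have "\<dots> = (\<Sum>l\<in>Ix. if l = k then basis (Copy l, []) else 0)"
    using k(1) by (intro sum.cong refl) (simp add: zt_sum_delta)
  also have "\<dots> = basis (U, [])" using k(1) by (simp add: sum.delta Copy)
  finally show ?thesis using mem by simp
qed

text \<open>The arrow \<open>Alpha x i j\<close> is the image of the arrow with tail \<open>x\<close> and label \<open>i + j\<close>, tensored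
  with \<open>- j\<close>. The arrows at the copies are cut out of the images of the arrows at \<open>X\<close> by the
  vertices \<open>Copy k\<close>.\<close>
lemma image_arrow:
  assumes "b \<in> arcs D"
  shows "basis (tail D b, [b]) \<in> image_Psi"
proof (cases b)
  case (Alpha x i j)
  let ?w = "x + fvec (i + j)"
  have b: "x \<in> simplex s" "dominant x" "i \<in> Ix" "j \<in> Ix" "omega_pow j x + fvec i \<in> simplex s"
    "dominant (omega_pow j x + fvec i)" using assms by (simp_all add: Alpha Alpha_arc)
  have x: "omega x \<noteq> x" "level x = 0" "rep x = x"
    using b(2) not_dominant_fixed level_dominant rep_level_0 by blast+
  have y: "omega (omega_pow j x + fvec i) \<noteq> omega_pow j x + fvec i" "level (omega_pow j x + fvec i) = 0"
    using b(6) not_dominant_fixed level_dominant by blast+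
  have w: "omega_pow j ?w = omega_pow j x + fvec i" by (simp add: omega_pow_add_f)
  then have w': "?w = omega_pow (- j) (omega_pow j x + fvec i)" by (metis omega_pow_cancel(2))
  have level: "level ?w = (- j) mod 3" unfolding w' by (simp add: level_omega_pow[OF y(1)] y(2))
  have off: "omega ?w \<noteq> ?w" unfolding w' using y(1) by simp
  have ws: "?w \<in> simplex s" unfolding w' using b(5) by (simp only: omega_pow_simplex)
  have arc: "(x, (i + j) mod 3) \<in> arcs A" using b(1) ws mod3_Ix by (simp add: quiverA_simps)
  have i: "(((i + j) mod 3) + (- j) mod 3) mod 3 = i" "(- ((- j) mod 3)) mod 3 = j"
    using b(3,4) by (simp_all add: mod_add_eq mod_minus_eq Ix_mod)
  have "twist (x, (i + j) mod 3) = Alpha x i j"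
    using i by (simp only: twist_def prod.case fvec_mod level x(2,3) diff_0)
  then have "psi (x, (i + j) mod 3) = basis (Pt x, [b])"
    using x off by (simp add: psi_off Alpha)
  then have "NN (- j) x [(x, (i + j) mod 3)] = basis (Pt x, [b])"
    using psi_tau_off[of x "(i + j) mod 3" "- j"] off arc by simp
  moreover have "(x, [(x, (i + j) mod 3)]) \<in> KP (- j)"
    using arc x(2) y(2) w unfolding KP_def by (simp add: path_single quiverA_simps)
  ultimately show ?thesis using image_NN[of x "[(x, (i + j) mod 3)]" "- j"] by (simp add: Alpha quiverD_simps)
next
  case (Beta k)
  then have k: "k \<in> Ix" "s mod 3 = 1" using assms by (simp_all add: nonAlpha_arc)
  have lev: "level Y = 0" "level X = 0" using neighbours_X(4)[OF k(2)] by (simp_all add: level_dominant level_fixed)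
  have "(Y, [(Y, 0)]) \<in> KP 0"
    using arc_Y[OF k(2)] lev unfolding KP_def by (simp add: path_single quiverA_simps)
  then have "NN 0 Y [(Y, 0)] \<in> image_Psi" by (rule image_NN)
  moreover have "NN 0 Y [(Y, 0)] = (\<Sum>k\<in>Ix. basis (Pt Y, [Beta k]))"
    using psi_tau0[OF arc_Y[OF k(2)]] psi_Y[OF k(2)] by simp
  moreover have "basis (Copy k, []) \<in> image_Psi"
    using k by (intro image_vertex) (simp add: quiverD_simps)
  ultimately have "pmult D (\<Sum>k\<in>Ix. basis (Pt Y, [Beta k])) (basis (Copy k, [])) \<in> image_Psi"
    by (metis image_pmult)
  then show ?thesis
    using k by (simp add: pmult_sum_left pmult_single_single quiverD_simps sum.delta Beta cong: if_cong)
next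
  case (Gamma k)
  then have k: "k \<in> Ix" "s mod 3 = 1" using assms by (simp_all add: nonAlpha_arc)
  have lev: "level Z = 0" "level X = 0" using neighbours_X(5)[OF k(2)] by (simp_all add: level_dominant level_fixed)
  have arc: "(X, 2) \<in> arcs A" using arc_X[OF k(2), of 2] by simp
  then have "(X, [(X, 2)]) \<in> KP 0"
    using lev unfolding KP_def by (simp add: path_single quiverA_simps)
  then have "NN 0 X [(X, 2)] \<in> image_Psi" by (rule image_NN)
  moreover have "NN 0 X [(X, 2)] = (\<Sum>k\<in>Ix. basis (Copy k, [Gamma k]))"
    using psi_tau0[OF arc] psi_X[OF k(2), of 2] by simp
  moreover have "basis (Copy k, []) \<in> image_Psi"
    using k by (intro image_vertex) (simp add: quiverD_simps)
  ultimately have "pmult D (basis (Copy k, [])) (\<Sum>k\<in>Ix. basis (Copy k, [Gamma k])) \<in> image_Psi"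
    by (metis image_pmult)
  then show ?thesis
    using k by (simp add: pmult_sum_right pmult_single_single quiverD_simps sum.delta' sum.delta Gamma cong: if_cong)
qed

lemma image_path: "(U, p) \<in> paths D \<Longrightarrow> basis (U, p) \<in> image_Psi"
proof (induction p arbitrary: U)
  case Nil
  then show ?case by (intro image_vertex) simp
next
  case (Cons b p)
  then have b: "b \<in> arcs D" "U = tail D b" "(head D b, p) \<in> paths D" by (simp_all add: D.path_Cons)
  have "basis (U, b # p) = pmult D (basis (tail D b, [b])) (basis (head D b, p))"
    by (simp add: pmult_single_single b(2))
  then show ?case using image_pmult[OF image_arrow[OF b(1)] Cons.IH[OF b(3)]] by simp
qed

lemma Psi_surj:
  assumes "b \<in> supported (paths D)"
  obtains u where "corner_element u" "b = Psi u"
proof -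
  have "b \<in> image_Psi"
  proof (rule lin_mem[OF lin_ident subspace_image])
    fix P assume "P \<in> Poly_Mapping.keys b"
    then show "basis P \<in> image_Psi" using assms image_path[of "fst P" "snd P"] by (auto simp: supported_def)
  qed
  then show ?thesis using that unfolding image_Psi_def by blast
qed

subsection \<open>A left inverse\<close>

definition arrow_path :: "triple \<Rightarrow> int \<Rightarrow> (triple, arrA) path \<Rightarrow>\<^sub>0 complex" where
  "arrow_path v l = basis (v, [(v, l mod 3)])"

text \<open>The component of degree \<open>g\<close> of the element of the corner that corresponds to a path of type
  D. A copy of the fixed point corresponds to the idempotent of the \<open>k\<close>-th character, with
  coefficients \<open>zt (- k * g) / 3\<close>; the arrow \<open>Alpha x i j\<close> to an arrow tensored with \<open>- j\<close>;
  \<open>Beta k\<close> and \<open>Gamma k\<close> to the arrows between \<open>X\<close> and its dominant neighbours, multiplied by that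
  idempotent. The first factor of degree \<open>h\<close> acts on the rest of the path, whose degree is then
  \<open>g - h\<close>.\<close>
primrec Th :: "vertD \<Rightarrow> arrD list \<Rightarrow> int \<Rightarrow> (triple, arrA) path \<Rightarrow>\<^sub>0 complex" where
  "Th U [] = (\<lambda>g. case U of Pt x \<Rightarrow> if g mod 3 = 0 then basis (x, []) else 0
     | Copy k \<Rightarrow> Poly_Mapping.single (X, []) (zt (- k * g) / 3))"
| "Th U (b # p) = (\<lambda>g. case b of
       Alpha x i j \<Rightarrow> pmult A (arrow_path x (i + j)) (act_path_algebra (- j) (Th (headD s b) p (g + j)))
     | Beta k \<Rightarrow> pmult A (arrow_path Y 0) (Th (headD s b) p g)
     | Gamma k \<Rightarrow> \<Sum>h\<in>Ix. scale (zt (- k * h) / 3)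
         (pmult A (arrow_path X (2 - h)) (act_path_algebra h (Th (headD s b) p (g - h)))))"

definition Theta :: "int \<Rightarrow> ((vertD, arrD) path \<Rightarrow>\<^sub>0 complex) \<Rightarrow> (triple, arrA) path \<Rightarrow>\<^sub>0 complex" where
  "Theta g = lin_ext (\<lambda>P. Th (fst P) (snd P) g)"

lemma lin_Theta: "lin (Theta g)"
  unfolding Theta_def by (rule lin_lin_ext)

lemma lin_Theta_comp [lin_intros]: "lin F \<Longrightarrow> lin (\<lambda>a. Theta g (F a))"
  by (rule lin_comp[OF lin_Theta])

lemma Theta_basis: "Theta g (basis (U, p)) = Th U p g"
  by (simp add: Theta_def)

text \<open>The recursion of \<open>Th\<close> for a first factor \<open>\<alpha>\<close> and arbitrary continuation \<open>y\<close>; multiplying \<open>y\<close>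
  by the trivial path at the head of the arrow discards the paths that do not continue it.\<close>
lemma Theta_Alpha:
  "Theta g (pmult D (basis (U, [Alpha x i j])) y)
    = pmult A (arrow_path x (i + j)) (act_path_algebra (- j) (Theta (g + j) (pmult D (basis (headD s (Alpha x i j), [])) y)))"
proof (rule lin_eq_on[where a = y and F = "\<lambda>y. Theta g (pmult D (basis (U, [Alpha x i j])) y)"])
  fix P :: "(vertD, arrD) path"
  obtain V p where P: "P = (V, p)" by (cases P)
  show "Theta g (pmult D (basis (U, [Alpha x i j])) (basis P)) = pmult A (arrow_path x (i + j))
      (act_path_algebra (- j) (Theta (g + j) (pmult D (basis (headD s (Alpha x i j), [])) (basis P))))"
    by (cases "V = headD s (Alpha x i j)")
      (simp_all add: P pmult_single_single quiverD_simps Theta_basis lin_zero[OF lin_Theta] lin_zero[OF lin_act])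
qed (intro lin_intros)+

lemma Theta_Beta:
  "Theta g (pmult D (basis (U, [Beta k])) y) = pmult A (arrow_path Y 0) (Theta g (pmult D (basis (Copy k, [])) y))"
proof (rule lin_eq_on[where a = y and F = "\<lambda>y. Theta g (pmult D (basis (U, [Beta k])) y)"])
  fix P :: "(vertD, arrD) path"
  obtain V p where P: "P = (V, p)" by (cases P)
  show "Theta g (pmult D (basis (U, [Beta k])) (basis P)) = pmult A (arrow_path Y 0)
      (Theta g (pmult D (basis (Copy k, [])) (basis P)))"
    by (cases "V = Copy k")
      (simp_all add: P pmult_single_single quiverD_simps Theta_basis lin_zero[OF lin_Theta])
qed (intro lin_intros)+

lemma Theta_Gamma:
  "Theta g (pmult D (basis (U, [Gamma k])) y) = (\<Sum>h\<in>Ix. scale (zt (- k * h) / 3)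
     (pmult A (arrow_path X (2 - h)) (act_path_algebra h (Theta (g - h) (pmult D (basis (Pt Z, [])) y)))))"
proof (rule lin_eq_on[where a = y and F = "\<lambda>y. Theta g (pmult D (basis (U, [Gamma k])) y)"])
  fix P :: "(vertD, arrD) path"
  obtain V p where P: "P = (V, p)" by (cases P)
  show "Theta g (pmult D (basis (U, [Gamma k])) (basis P)) = (\<Sum>h\<in>Ix. scale (zt (- k * h) / 3)
     (pmult A (arrow_path X (2 - h)) (act_path_algebra h (Theta (g - h) (pmult D (basis (Pt Z, [])) (basis P))))))"
    by (cases "V = Pt Z")
      (simp_all add: P pmult_single_single quiverD_simps Theta_basis lin_zero[OF lin_Theta] lin_zero[OF lin_act])
qed (intro lin_intros)+

lemma degree_shift:
  fixes g g' h :: int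
  shows "(g' + (- h) mod 3) mod 3 = (g - h) mod 3 \<longleftrightarrow> g' mod 3 = g mod 3"
    "(g' - h) mod 3 = (g - h) mod 3 \<longleftrightarrow> g' mod 3 = g mod 3"
proof -
  have "(g' + (- h) mod 3) mod 3 = (g' - h) mod 3" by (simp add: mod_add_right_eq)
  moreover show "(g' - h) mod 3 = (g - h) mod 3 \<longleftrightarrow> g' mod 3 = g mod 3"
    by (simp add: mod_eq_dvd_iff)
  ultimately show "(g' + (- h) mod 3) mod 3 = (g - h) mod 3 \<longleftrightarrow> g' mod 3 = g mod 3" by simp
qed

lemma act_path_back:
  assumes "(w, p) \<in> paths A"
  shows "map (act_arr h) (map (act_arr (- h)) p) = p"
proof -
  have "map (act_arr 0) p = p"
    using assms by (intro map_idI) (auto simp: paths_def A.awalk_def act_arr_0)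
  then show ?thesis by (simp add: act_arr_comp)
qed

text \<open>A path leaving an arrow with head \<open>w\<close> need not start at level 0, so the induction hypothesis
  of \<open>Theta_NN\<close> does not apply to it directly. Rotating it back by \<open>h = level w\<close> gives a path from
  the representative with the same image, and lowers the degree by \<open>h\<close>.\<close>
lemma normalised_tail:
  assumes p: "(w, p) \<in> paths A" and off: "omega w \<noteq> w" and e: "level (omega_pow (- g) (path_end A (w, p))) = 0"
    and h: "h = level w" and q: "q = map (act_arr (- h)) p"
  shows "(rep w, q) \<in> KP (g - h)" "NN g w p = NN (g - h) (rep w) q"
    "act_path h (rep w, q) = (w, p)" "pmult D (basis (Pt (rep w), [])) (NN (g - h) (rep w) q) = NN (g - h) (rep w) q"
proof -
  have rep: "(rep w, q) = act_path (- h) (w, p)" by (simp add: act_path_pair q h rep_def)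
  have path: "(rep w, q) \<in> paths A" unfolding rep using p by (rule act_path_in)
  have "path_end A (rep w, q) = omega_pow (- h) (path_end A (w, p))" unfolding rep using p by (rule act_path_in)
  then have "omega_pow (- (g - h)) (path_end A (rep w, q)) = omega_pow (- g) (path_end A (w, p))"
    by (simp add: omega_pow_add)
  then show "(rep w, q) \<in> KP (g - h)" using path e by (simp add: KP_def level_rep)
  have undo: "map (act_arr h) q = p" unfolding q using p by (rule act_path_back)
  then show "act_path h (rep w, q) = (w, p)" by (simp add: act_path_pair h)
  have "pmult D (tau h (rep w)) (NN (g - h) (rep w) q) = NN g w p"
    using NN_equivariant[OF path, of h "g - h"] undo by (simp add: h)
  moreover show unit: "pmult D (basis (Pt (rep w), [])) (NN (g - h) (rep w) q) = NN (g - h) (rep w) q"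
    using NN_tau_left[OF path] off by (simp add: tau_off fixed_rep rep_level_0 level_rep)
  ultimately show "NN g w p = NN (g - h) (rep w) q"
    using off by (simp add: tau_off fixed_rep rep_level_0 level_rep)
qed

lemma arrow_path_mult: "headA = v + fvec l \<Longrightarrow> l \<in> Ix \<Longrightarrow> pmult A (arrow_path v l) (basis (headA, p)) = basis (v, (v, l) # p)"
  by (simp add: arrow_path_def pmult_single_single quiverA_simps Ix_mod)

lemma arrow_path_cong: "l mod 3 = l' mod 3 \<Longrightarrow> arrow_path v l = arrow_path v l'"
  by (simp add: arrow_path_def)

text \<open>Induction on the length. Only the first arrow matters in each step: off the fixed point
  \<open>Theta\<close> undoes the twist, and at the fixed point the three copies are recombined by
  orthogonality of characters.\<close>
lemma Theta_NN:
  "(v, p) \<in> KP g \<Longrightarrow> Theta g' (NN g v p) = (if g' mod 3 = g mod 3 then basis (v, p) else 0)"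
proof (induction "length p" arbitrary: v p g g')
  case 0
  then have p: "p = []" and v: "v \<in> simplex s" "level v = 0" "level (omega_pow (- g) v) = 0"
    by (auto simp: KP_def quiverA_simps)
  show ?case
  proof (cases "omega v = v")
    case True
    then have X: "s mod 3 = 1" "v = X" using fixed_simplex[OF v(1)] by simp_all
    have "Theta g' (tau g v) = (\<Sum>k\<in>Ix. Poly_Mapping.single (X, []) (zt (k * (g - g')) / 3))"
      unfolding tau_fixed[OF True] lin_sum[OF lin_Theta]
      by (intro sum.cong refl) (simp add: Theta_def lin_ext_single zt_add[symmetric] algebra_simps)
    also have "\<dots> = scale ((\<Sum>k\<in>Ix. zt (k * (g - g'))) / 3) (basis (X, []))"
      by (simp only: scale_sum_left sum_divide_distrib, simp)
    also have "\<dots> = (if g' mod 3 = g mod 3 then basis (v, p) else 0)"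
      by (auto simp: zt_sum X p mod_eq_dvd_iff mod_eq_0_iff_dvd dvd_diff_commute)
    finally show ?thesis by (simp add: p)
  next
    case False
    then have "(- g) mod 3 = 0" using v by (simp add: level_omega_pow)
    then have "g mod 3 = 0" by presburger
    then show ?thesis using False v by (simp add: p tau_off Theta_basis rep_level_0)
  qed
next
  case (Suc n)
  then obtain a p' where p: "p = a # p'" by (cases p) auto
  then obtain l where a: "a = (v, l)" "(v, l) \<in> arcs A" "(v + fvec l, p') \<in> paths A"
    using Suc.prems by (auto simp: KP_def pathA_Cons)
  have l: "l \<in> Ix" using a(2) by (simp add: quiverA_simps)
  define w where "w = v + fvec l"
  define h where "h = level w"
  define q where "q = map (act_arr (- h)) p'"
  have lev: "level v = 0" "rep v = v" using Suc.prems by (simp_all add: KP_def rep_level_0)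
  have e: "level (omega_pow (- g) (path_end A (w, p'))) = 0"
    using Suc.prems by (simp add: KP_def p a(1) quiverA_simps w_def)
  have IH: "Theta g'' (NN (g - h) (rep w) q) = (if g'' mod 3 = (g - h) mod 3 then basis (rep w, q) else 0)"
    if "omega w \<noteq> w" for g''
    using Suc.hyps(2) normalised_tail(1)[OF a(3)[folded w_def] that e h_def q_def]
    by (intro Suc.hyps(1)) (simp_all add: p q_def)
  have y: "NN g v p = pmult D (psi (v, l)) (NN g w p')" by (simp add: p a(1) w_def)
  from a(2) show ?case
  proof (cases rule: arc_cases)
    case off
    note off = off[folded w_def]
    note tail = normalised_tail[OF a(3)[folded w_def] off(2) e h_def q_def]
    let ?b = "Alpha v ((l + h) mod 3) ((- h) mod 3)"
    have psi: "psi (v, l) = basis (Pt v, [?b])"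
      using off lev by (simp add: psi_off twist_def w_def[symmetric] h_def)
    have head: "headD s ?b = Pt (rep w)"
      using head_twist[of v l s] off lev by (simp add: twist_def w_def[symmetric] h_def)
    have arrow: "arrow_path v ((l + h) mod 3 + (- h) mod 3) = arrow_path v l"
      by (rule arrow_path_cong) (simp add: mod_add_eq)
    have act: "act_path_algebra (- ((- h) mod 3)) y = act_path_algebra h y" for y
      by (metis act_path_algebra_mod add.inverse_inverse mod_minus_eq)
    have "Theta g' (NN g v p) = pmult A (arrow_path v l)
        (act_path_algebra h (Theta (g' + (- h) mod 3) (NN (g - h) (rep w) q)))"
      unfolding y psi tail(2) Theta_Alpha head tail(4) arrow act ..
    also have "Theta (g' + (- h) mod 3) (NN (g - h) (rep w) q) = (if g' mod 3 = g mod 3 then basis (rep w, q) else 0)"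
      unfolding IH[OF off(2)] degree_shift ..
    finally have result: "Theta g' (NN g v p) = pmult A (arrow_path v l)
        (act_path_algebra h (if g' mod 3 = g mod 3 then basis (rep w, q) else 0))" .
    show ?thesis
      unfolding result
      by (cases "g' mod 3 = g mod 3")
        (simp_all add: tail(3) arrow_path_mult[OF w_def l] lin_zero[OF lin_act] p a(1))
  next
    case into
    note into = into[folded w_def]
    have "(- l) mod 3 = 0" using into_X(3)[of v l] into lev by (simp add: w_def)
    \<comment> \<open>The path starts at level 0 and so enters the fixed point from \<open>Y\<close>.\<close>
    then have l0: "l = 0" using l by (auto simp: Ix_def)
    then have v: "v = Y" using into_X(1)[of v l] into by (simp add: w_def)
    have "(w, p') \<in> KP g" using a(3) into e by (simp add: KP_def w_def[symmetric] level_fixed)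
    then have IH0: "Theta g' (NN g w p') = (if g' mod 3 = g mod 3 then basis (w, p') else 0)"
      using Suc.hyps(2) by (intro Suc.hyps(1)) (simp_all add: p)
    have "Theta g' (NN g v p) = (\<Sum>k\<in>Ix. pmult A (arrow_path Y 0) (Theta g' (pmult D (basis (Copy k, [])) (NN g w p'))))"
    proof -
      have psi: "psi (v, l) = (\<Sum>k\<in>Ix. basis (Pt Y, [Beta k]))"
        unfolding v l0 by (rule psi_Y[OF into(1)])
      show ?thesis unfolding y psi pmult_sum_left lin_sum[OF lin_Theta] Theta_Beta ..
    qed
    also have "\<dots> = pmult A (arrow_path Y 0) (Theta g' (pmult D (\<Sum>k\<in>Ix. basis (Copy k, [])) (NN g w p')))"
      by (simp only: pmult_sum_left pmult_sum_right lin_sum[OF lin_Theta])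
    also have "(\<Sum>k\<in>Ix. basis (Copy k, [])) = tau 0 w"
      using into by (simp add: tau_fixed)
    also have "pmult D (tau 0 w) (NN g w p') = NN g w p'"
      by (rule NN_tau_left[OF a(3)[folded w_def]])
    finally have result: "Theta g' (NN g v p) = pmult A (arrow_path Y 0) (if g' mod 3 = g mod 3 then basis (w, p') else 0)"
      unfolding IH0 .
    have "arrow_path Y 0 = arrow_path v l" by (simp only: v l0)
    then show ?thesis
      unfolding result
      by (cases "g' mod 3 = g mod 3") (simp_all only: arrow_path_mult[OF w_def l] pmult_zero_right p a(1) if_True if_False simp_thms)
  next
    case out
    note out = out[folded w_def]
    note tail = normalised_tail[OF a(3)[folded w_def] out(4) e h_def q_def]
    have w: "rep w = Z" "h = (2 - l) mod 3" using from_X[OF out(1), of l] by (simp_all add: w_def h_def out(2))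
    \<comment> \<open>The sum over the copies selects the term \<open>h' = h\<close> in the expansion of the idempotents.\<close>
    define f where "f h' = pmult A (arrow_path X (2 - h')) (act_path_algebra h' (Theta (g' - h') (NN (g - h) (rep w) q)))" for h'
    have "Theta g' (NN g v p) = (\<Sum>k\<in>Ix. scale (zt (k * h)) (\<Sum>h'\<in>Ix. scale (zt (- k * h') / 3) (f h')))"
    proof -
      have "psi (v, l) = (\<Sum>k\<in>Ix. scale (zt (k * h)) (basis (Copy k, [Gamma k])))"
        unfolding out(2) psi_X[OF out(1)] by (simp add: w(2))
      then show ?thesis
        unfolding y tail(2) using tail(4)
        by (simp only: pmult_sum_left pmult_scale_left lin_sum[OF lin_Theta] lin_scale[OF lin_Theta] Theta_Gamma w(1) f_def)
    qed
    also have "\<dots> = (\<Sum>k\<in>Ix. \<Sum>h'\<in>Ix. scale (zt (k * (h - h')) / 3) (f h'))"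
      by (intro sum.cong refl) (simp add: scale_sum zt_add[symmetric] algebra_simps)
    also have "\<dots> = (\<Sum>h'\<in>Ix. \<Sum>k\<in>Ix. scale (zt (k * (h - h')) / 3) (f h'))"
      by (rule sum.swap)
    also have "\<dots> = (\<Sum>h'\<in>Ix. scale ((\<Sum>k\<in>Ix. zt (k * (h - h'))) / 3) (f h'))"
      by (simp only: scale_sum_left sum_divide_distrib)
    also have "\<dots> = (\<Sum>h'\<in>Ix. if h' = h then f h' else 0)"
    proof (intro sum.cong refl)
      fix h' assume "h' \<in> Ix"
      then have "(h - h') mod 3 = 0 \<longleftrightarrow> h' = h" using level_Ix[of w] unfolding h_def[symmetric] by (auto simp: Ix_def)
      then show "scale ((\<Sum>k\<in>Ix. zt (k * (h - h'))) / 3) (f h') = (if h' = h then f h' else 0)"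
        by (simp add: zt_sum)
    qed
    also have "\<dots> = f h" using level_Ix[of w] by (simp add: sum.delta h_def)
    also have "f h = pmult A (arrow_path v l) (act_path_algebra h (Theta (g' - h) (NN (g - h) (rep w) q)))"
    proof -
      have "arrow_path X (2 - h) = arrow_path v l"
        unfolding out(2) w(2) by (rule arrow_path_cong) (simp add: mod_diff_right_eq)
      then show ?thesis by (simp only: f_def)
    qed
    also have "Theta (g' - h) (NN (g - h) (rep w) q) = (if g' mod 3 = g mod 3 then basis (rep w, q) else 0)"
      unfolding IH[OF out(4)] degree_shift ..
    finally have result: "Theta g' (NN g v p) = pmult A (arrow_path v l)
        (act_path_algebra h (if g' mod 3 = g mod 3 then basis (rep w, q) else 0))" .
    show ?thesis
      unfolding result
      by (cases "g' mod 3 = g mod 3")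
        (simp_all add: tail(3) arrow_path_mult[OF w_def l] lin_zero[OF lin_act] p a(1))
  qed
qed

lemma Theta_Ng:
  assumes "a \<in> supported (KP g)"
  shows "Theta g' (Ng g a) = (if g' mod 3 = g mod 3 then a else 0)"
proof (rule lin_eq_on[where F = "\<lambda>a. Theta g' (Ng g a)" and G = "\<lambda>a. if g' mod 3 = g mod 3 then a else 0"])
  show "lin (\<lambda>a. if g' mod 3 = g mod 3 then a else 0)" by (simp add: lin_def)
  fix p assume "p \<in> Poly_Mapping.keys a"
  then have "(fst p, snd p) \<in> KP g" using assms by (auto simp: supported_def)
  then show "Theta g' (Ng g (basis p)) = (if g' mod 3 = g mod 3 then basis p else 0)"
    using Theta_NN by (simp add: Ng_def)
qed (intro lin_intros)

lemma Theta_Psi: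
  assumes "corner_element u" "g \<in> Ix"
  shows "Theta g (Psi u) = u g"
proof -
  have "Theta g (Psi u) = (\<Sum>k\<in>Ix. if k = g then u k else 0)"
    unfolding Psi_def lin_sum[OF lin_Theta]
    using assms by (intro sum.cong refl) (auto simp: Theta_Ng corner_element_def Ix_mod)
  then show ?thesis using assms(2) by (simp add: sum.delta)
qed

end

section \<open>Lifting closed walks\<close>

context covering
begin

text \<open>An arrow of type D from \<open>rep v\<close> is rotated so that its tail becomes \<open>v\<close>; the label is then
  determined.\<close>
lemma lift_arrow:
  assumes v: "v \<in> simplex s" "omega v \<noteq> v" and b: "Alpha (rep v) i j \<in> arcs D"
  defines "l \<equiv> (i + j - level v) mod 3"
  shows "(v, l) \<in> arcs A" "omega (v + fvec l) \<noteq> v + fvec l"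
    "rep (v + fvec l) = omega_pow j (rep v) + fvec i" "level (v + fvec l) = (level v - j) mod 3"
    "twist (v, l) = Alpha (rep v) i j"
proof -
  define y where "y = omega_pow j (rep v) + fvec i"
  have y: "y \<in> simplex s" "dominant y" "i \<in> Ix" "j \<in> Ix" using b by (simp_all add: Alpha_arc y_def)
  have y': "omega y \<noteq> y" "level y = 0" "rep y = y"
    using y(2) not_dominant_fixed level_dominant rep_level_0 by blast+
  have "omega_pow (level v - j) y = omega_pow (level v) (rep v) + fvec (i + j - level v)"
    unfolding y_def omega_pow_add_f omega_pow_add by (simp add: algebra_simps)
  then have w: "v + fvec l = omega_pow (level v - j) y" by (simp add: l_def)
  show off: "omega (v + fvec l) \<noteq> v + fvec l" unfolding w using y'(1) by simp
  show rep: "rep (v + fvec l) = omega_pow j (rep v) + fvec i" unfolding w by (simp add: y'(3)) (simp add: y_def)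
  show level: "level (v + fvec l) = (level v - j) mod 3" unfolding w by (simp add: level_omega_pow[OF y'(1)] y'(2))
  have "v + fvec l \<in> simplex s" unfolding w using y(1) by (simp only: omega_pow_simplex)
  then show "(v, l) \<in> arcs A" using v(1) mod3_Ix by (simp add: quiverA_simps l_def)
  have "(l + level (v + fvec l)) mod 3 = (l + (level v - j)) mod 3"
    unfolding level by (rule mod_add_right_eq)
  also have "\<dots> = (i + j - level v + (level v - j)) mod 3"
    unfolding l_def by (rule mod_add_left_eq)
  finally have "(l + level (v + fvec l)) mod 3 = (i + j - level v + (level v - j)) mod 3" .
  moreover have "(level v - level (v + fvec l)) mod 3 = (level v - (level v - j)) mod 3"
    unfolding level by (rule mod_diff_right_eq)
  ultimately show "twist (v, l) = Alpha (rep v) i j"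
    using y(3,4) by (simp add: twist_def Ix_mod)
qed

lemma twist_inj:
  assumes "twist (v, l) = twist (v, l')" "l \<in> Ix" "l' \<in> Ix"
  shows "l = l'"
proof -
  have key: "((l + h) mod 3 + (g - h) mod 3) mod 3 = (l + g) mod 3" for l h g :: int
    by (simp add: mod_add_eq)
  have eq: "(l + level (v + fvec l)) mod 3 = (l' + level (v + fvec l')) mod 3"
    "(level v - level (v + fvec l)) mod 3 = (level v - level (v + fvec l')) mod 3"
    using assms(1) by (simp_all add: twist_def)
  have "(l + level v) mod 3 = (l' + level v) mod 3"
    unfolding key[of l "level (v + fvec l)" "level v", symmetric] eq by (rule key)
  then have "l mod 3 = l' mod 3" by (simp add: mod_eq_dvd_iff)
  then show ?thesis using assms(2,3) by (simp add: Ix_mod)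
qed

text \<open>The walks of length three whose lifts are closed, since the exponents \<open>j\<close> measure the change
  of level.\<close>
fun degree0 :: "arrD list \<Rightarrow> bool" where
  "degree0 [Alpha x0 i0 j0, Alpha x1 i1 j1, Alpha x2 i2 j2] \<longleftrightarrow> (j0 + j1 + j2) mod 3 = 0"
| "degree0 _ \<longleftrightarrow> False"

definition walksA :: "triple \<Rightarrow> arrA list set" where
  "walksA v = {c \<in> closed_3_walks A. fst (hd c) = v \<and> (\<forall>a\<in>set c. omega (fst a) \<noteq> fst a)}"

definition walksD :: "triple \<Rightarrow> arrD list set" where
  "walksD x = {c \<in> closed_3_walks D. degree0 c \<and> tailD s (hd c) = Pt x}"

lemma degree0E:
  assumes "degree0 c"
  obtains x0 i0 j0 x1 i1 j1 x2 i2 j2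
  where "c = [Alpha x0 i0 j0, Alpha x1 i1 j1, Alpha x2 i2 j2]" "(j0 + j1 + j2) mod 3 = 0"
  using assms by (cases c rule: degree0.cases) auto

lemma walksAE:
  assumes "c \<in> walksA v"
  obtains l w m z n where "c = [(v, l), (w, m), (z, n)]" "(v, l) \<in> arcs A" "(w, m) \<in> arcs A" "(z, n) \<in> arcs A"
    "w = v + fvec l" "z = w + fvec m" "v = z + fvec n" "omega v \<noteq> v" "omega w \<noteq> w" "omega z \<noteq> z"
proof -
  have c: "c \<in> closed_3_walks A" using assms by (simp add: walksA_def)
  then obtain a b d where abd: "c = [a, b, d]" by (rule A.closed_3E)
  obtain v' l w m z n where vs: "a = (v', l)" "b = (w, m)" "d = (z, n)" by (cases a, cases b, cases d)
  have "v' = v" using assms by (simp add: walksA_def abd vs)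
  then show ?thesis
    using c assms by (intro that[of l w m z n]) (auto simp: abd vs A.closed_3_iff quiverA_simps(2,3) walksA_def)
qed

text \<open>The labels that enter the sign of type D are the labels of type A, all shifted by \<open>level v\<close>,
  up to cyclic order. The second part is phrased for arbitrary coordinates of the twisted walk so
  that it can be combined with \<open>weightD_alpha\<close>.\<close>
lemma twist_walk:
  assumes "c \<in> walksA v"
  shows "map twist c \<in> walksD (rep v)"
    "map twist c = [Alpha x0 k0 g0, Alpha x1 k1 g1, Alpha x2 k2 g2] \<Longrightarrow>
      index_sign ((k0 + g0) mod 3, (k1 - g2) mod 3, k2 mod 3) = lamA c"
proof -
  obtain l w m z n where c: "c = [(v, l), (w, m), (z, n)]" "(v, l) \<in> arcs A" "(w, m) \<in> arcs A" "(z, n) \<in> arcs A"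
    "w = v + fvec l" "z = w + fvec m" "v = z + fvec n" and off: "omega v \<noteq> v" "omega w \<noteq> w" "omega z \<noteq> z"
    using assms by (rule walksAE)
  have heads: "headD s (twist (v, l)) = Pt (rep w)" "headD s (twist (w, m)) = Pt (rep z)" "headD s (twist (z, n)) = Pt (rep v)"
    using head_twist[of v l s] head_twist[of w m s] head_twist[of z n s] off by (simp_all flip: c(5,6,7))
  have arcs: "twist (v, l) \<in> arcs D" "twist (w, m) \<in> arcs D" "twist (z, n) \<in> arcs D"
    using twist_arc[OF c(2)] twist_arc[OF c(3)] twist_arc[OF c(4)] off by (simp_all flip: c(5,6,7))
  define i0 j0 i1 j1 i2 j2 where ij:
    "i0 = (l + level w) mod 3" "j0 = (level v - level w) mod 3"
    "i1 = (m + level z) mod 3" "j1 = (level w - level z) mod 3"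
    "i2 = (n + level v) mod 3" "j2 = (level z - level v) mod 3"
  have twists: "twist (v, l) = Alpha (rep v) i0 j0" "twist (w, m) = Alpha (rep w) i1 j1" "twist (z, n) = Alpha (rep z) i2 j2"
    by (simp_all add: twist_def ij flip: c(5,6,7))
  have j: "(j0 + j1 + j2) mod 3 = 0"
  proof -
    have "j0 + j1 + j2 = 3 * (- ((level v - level w) div 3) - (level w - level z) div 3 - (level z - level v) div 3)"
      unfolding ij minus_mult_div_eq_mod[symmetric] by (simp add: algebra_simps)
    then show ?thesis by simp
  qed
  have "(i0 + j0) mod 3 = (l + level v) mod 3" "(i1 - j2) mod 3 = (m + level v) mod 3" "i2 mod 3 = (n + level v) mod 3"
    unfolding ij by (simp_all add: mod_add_eq mod_diff_eq)
  then have "index_sign ((i0 + j0) mod 3, (i1 - j2) mod 3, i2 mod 3)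
      = index_sign ((l + level v) mod 3, (m + level v) mod 3, (n + level v) mod 3)" by simp
  also have "\<dots> = index_sign (n mod 3, l mod 3, m mod 3)" by (rule index_sign_shift)
  also have "\<dots> = index_sign (l mod 3, m mod 3, n mod 3)" using index_sign_shift[of l 0 m n] by simp
  also have "\<dots> = lamA c" using c(2,3,4) by (simp add: c(1) quiverA_simps Ix_mod)
  finally have sign: "index_sign ((i0 + j0) mod 3, (i1 - j2) mod 3, i2 mod 3) = lamA c" .
  show "index_sign ((k0 + g0) mod 3, (k1 - g2) mod 3, k2 mod 3) = lamA c"
    if "map twist c = [Alpha x0 k0 g0, Alpha x1 k1 g1, Alpha x2 k2 g2]"
    using that sign by (simp add: c(1) twists)
  have "map twist c \<in> closed_3_walks D"
    using heads arcs by (simp add: c(1) D.closed_3_iff quiverD_simps(2,3) twists)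
  then show "map twist c \<in> walksD (rep v)"
    using j by (simp add: walksD_def c(1) twists)
qed

text \<open>Lifting arrow by arrow ends at a vertex of the same orbit as \<open>v\<close>, and of the same level
  because the exponents add up to 0.\<close>
lemma lift_walk:
  assumes v: "v \<in> simplex s" "omega v \<noteq> v" and c: "c' \<in> walksD (rep v)"
  shows "c' \<in> map twist ` walksA v"
proof -
  have deg: "degree0 c'" and closed: "c' \<in> closed_3_walks D" using c by (simp_all add: walksD_def)
  obtain x0 i0 j0 x1 i1 j1 x2 i2 j2
    where c': "c' = [Alpha x0 i0 j0, Alpha x1 i1 j1, Alpha x2 i2 j2]" and j: "(j0 + j1 + j2) mod 3 = 0"
    using deg by (rule degree0E)
  have x0: "x0 = rep v" using c by (simp add: walksD_def c')
  have arcs: "Alpha x0 i0 j0 \<in> arcs D" "Alpha x1 i1 j1 \<in> arcs D" "Alpha x2 i2 j2 \<in> arcs D"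
    and heads: "omega_pow j0 x0 + fvec i0 = x1" "omega_pow j1 x1 + fvec i1 = x2" "omega_pow j2 x2 + fvec i2 = x0"
    using closed by (simp_all add: c' D.closed_3_iff quiverD_simps(2,3))
  define l where "l = (i0 + j0 - level v) mod 3"
  define w where "w = v + fvec l"
  note L = lift_arrow[OF v arcs(1)[unfolded x0], folded l_def w_def, folded x0, unfolded heads]
  have ws: "w \<in> simplex s" using L(1) by (simp add: quiverA_simps w_def)
  define m where "m = (i1 + j1 - level w) mod 3"
  define z where "z = w + fvec m"
  note M = lift_arrow[OF ws L(2) arcs(2)[folded L(3)], folded m_def z_def, unfolded L(3) heads]
  have zs: "z \<in> simplex s" using M(1) by (simp add: quiverA_simps z_def)
  define n where "n = (i2 + j2 - level z) mod 3"
  define u where "u = z + fvec n"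
  note N = lift_arrow[OF zs M(2) arcs(3)[folded M(3)], folded n_def u_def, unfolded M(3) heads]
  have "level u = (level v - (j0 + j1 + j2)) mod 3"
    unfolding N(4) M(4) L(4) by (simp add: mod_diff_left_eq algebra_simps)
  also have "\<dots> = (level v - (j0 + j1 + j2) mod 3) mod 3" by (simp only: mod_diff_right_eq)
  also have "\<dots> = level v" by (simp add: j)
  finally have level: "level u = level v" .
  have "u = omega_pow (level u) (rep u)" by (rule omega_pow_rep[symmetric])
  also have "\<dots> = omega_pow (level v) (rep v)" by (simp only: level N(3) x0)
  also have "\<dots> = v" by (rule omega_pow_rep)
  finally have u: "u = v" .
  let ?c = "[(v, l), (w, m), (z, n)]"
  have "?c \<in> closed_3_walks A"
    using L(1) M(1) N(1) u by (simp add: A.closed_3_iff quiverA_simps(2,3) w_def z_def u_def)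
  then have "?c \<in> walksA v" using v(2) L(2) M(2) by (simp add: walksA_def)
  moreover have "map twist ?c = c'" using L(5) M(5) N(5) by (simp add: c')
  ultimately show ?thesis by blast
qed

lemma twist_walk_bij:
  assumes v: "v \<in> simplex s" "omega v \<noteq> v"
  shows "bij_betw (map twist) (walksA v) (walksD (rep v))"
  unfolding bij_betw_def
proof
  show "inj_on (map twist) (walksA v)"
  proof (rule inj_onI)
    fix c d assume "c \<in> walksA v" "d \<in> walksA v" and eq: "map twist c = map twist d"
    obtain l w m z n where c: "c = [(v, l), (w, m), (z, n)]" "(v, l) \<in> arcs A" "(w, m) \<in> arcs A" "(z, n) \<in> arcs A"
      "w = v + fvec l" "z = w + fvec m" using \<open>c \<in> walksA v\<close> by (rule walksAE)
    obtain l' w' m' z' n' where d: "d = [(v, l'), (w', m'), (z', n')]" "(v, l') \<in> arcs A" "(w', m') \<in> arcs A" "(z', n') \<in> arcs A"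
      "w' = v + fvec l'" "z' = w' + fvec m'" using \<open>d \<in> walksA v\<close> by (rule walksAE)
    have Ix: "l \<in> Ix" "m \<in> Ix" "n \<in> Ix" "l' \<in> Ix" "m' \<in> Ix" "n' \<in> Ix"
      using c(2-4) d(2-4) by (simp_all add: quiverA_simps)
    have tw: "twist (v, l) = twist (v, l')" "twist (w, m) = twist (w', m')" "twist (z, n) = twist (z', n')"
      using eq by (simp_all add: c(1) d(1))
    have l: "l = l'" using tw(1) Ix(1,4) by (rule twist_inj)
    then have w: "w = w'" by (simp add: c(5) d(5))
    have m: "m = m'" using tw(2)[unfolded w] Ix(2,5) by (rule twist_inj)
    then have z: "z = z'" using w by (simp add: c(6) d(6))
    have "n = n'" using tw(3)[unfolded z] Ix(3,6) by (rule twist_inj)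
    then show "c = d" by (simp add: c(1) d(1) l m w z)
  qed
  show "map twist ` walksA v = walksD (rep v)"
    using twist_walk(1) lift_walk[OF v] by blast
qed

end

section \<open>Weights of closed walks\<close>

text \<open>The coefficient of a closed walk when a potential is written as a sum over walks.\<close>
definition weight :: "('a list \<Rightarrow> complex) \<Rightarrow> 'a list \<Rightarrow> complex" where
  "weight lam c = 3 * lam c / of_nat (card (rot_class c))"

lemma weight_rotate1:
  assumes "length c = 3" "\<And>c. lam (rotate1 c) = lam c"
  shows "weight lam (rotate1 c) = weight lam c"
proof -
  have "rotate1 c \<in> rot_class c" unfolding rot_class_def by (rule range_eqI[of _ _ 1]) simp
  then show ?thesis using rot_class_eq[OF assms(1)] assms(2) by (simp add: weight_def)
qed

lemma weight_3: "weight lam [a, b, c] = (if a = b \<and> b = c then 3 * lam [a, b, c] else lam [a, b, c])"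
  by (simp add: weight_def card_rot_class_3)

text \<open>Rotation moves the largest coordinate away from the front, and only \<open>fvec 2\<close> raises the
  first coordinate again. Then two coordinates are equal and the third differs from them by 1;
  which two are equal determines the rotation.\<close>
lemma loop_unique:
  assumes "dominant (a, b, c)" "i \<in> Ix" "j \<in> Ix" "omega_pow j (a, b, c) + fvec i = (a, b, c)"
  shows "i = 2 \<and> j = (if b = c then 1 else 2)"
proof -
  have "i = 0 \<or> i = 1 \<or> i = 2" "j = 0 \<or> j = 1 \<or> j = 2" using assms(2,3) by (simp_all add: Ix_def)
  then show ?thesis using assms(1,4)
    by (elim disjE) (simp_all add: omega_pow_cases fvec_def dominant_def)
qed

context covering
begin

lemma potentialA_walks: "potentialA s = walk_potential A (weight lamA)"
  unfolding potentialA_def weight_def[abs_def] by (rule A.potential_eq_walk_potential[of lamA, OF lamA_rotate1])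

lemma potentialD_walks: "potentialD s = walk_potential D (weight lamD)"
  unfolding potentialD_def weight_def[abs_def] by (rule D.potential_eq_walk_potential[of lamD, OF lamD_rotate1])

text \<open>Type A has no loops, so a closed walk is never the cube of an arrow.\<close>
lemma card_rot_class_A:
  assumes "c \<in> closed_3_walks A"
  shows "card (rot_class c) = 3"
proof -
  obtain a b d where c: "c = [a, b, d]" using assms by (rule A.closed_3E)
  obtain v l where a: "a = (v, l)" by (cases a)
  have "\<not> (a = b \<and> b = d)"
  proof
    assume "a = b \<and> b = d"
    then have "head A a = tail A a" using assms by (simp add: c A.closed_3_iff)
    then have "fvec l = 0" by (simp add: a quiverA_simps(2,3))
    then show False by (simp add: fvec_def zero_prod_def split: if_splits)
  qed
  then show ?thesis by (simp only: c card_rot_class_3 if_False)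
qed

lemma weightA:
  assumes "c \<in> closed_3_walks A"
  shows "weight lamA c = lamA c"
  by (simp add: weight_def card_rot_class_A[OF assms])

text \<open>The first two cases of the definition of the potential become one formula: for the cube of a
  loop, three times the coefficient \<open>1/3\<close> is 1, and the condition on the exponents holds since
  \<open>3 * j\<close> is 0 modulo 3.\<close>
lemma weightD_alpha:
  assumes "[Alpha x0 i0 j0, Alpha x1 i1 j1, Alpha x2 i2 j2] \<in> closed_3_walks D"
  shows "weight lamD [Alpha x0 i0 j0, Alpha x1 i1 j1, Alpha x2 i2 j2]
    = (if (j0 + j1 + j2) mod 3 = 0 then index_sign ((i0 + j0) mod 3, (i1 - j2) mod 3, i2 mod 3) else 0)"
proof -
  let ?a = "Alpha x0 i0 j0" and ?b = "Alpha x1 i1 j1" and ?c = "Alpha x2 i2 j2"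
  have arcs: "?a \<in> arcs D" "?b \<in> arcs D" "?c \<in> arcs D"
    and heads: "omega_pow j0 x0 + fvec i0 = x1" "omega_pow j1 x1 + fvec i1 = x2" "omega_pow j2 x2 + fvec i2 = x0"
    using assms by (simp_all add: D.closed_3_iff quiverD_simps(2,3))
  \<comment> \<open>There is at most one loop at each vertex.\<close>
  have loops: "i = i' \<and> j = j'" if "Alpha x i j \<in> arcs D" "Alpha x i' j' \<in> arcs D"
    "omega_pow j x + fvec i = x" "omega_pow j' x + fvec i' = x" for x i j i' j'
  proof -
    obtain a b c where x: "x = (a, b, c)" by (cases x)
    show ?thesis
      using that loop_unique[of a b c i j] loop_unique[of a b c i' j'] unfolding x Alpha_arc by simp
  qed
  show ?thesis
  proof (cases "distinct [?a, ?b, ?c]")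
    case True
    then have "weight lamD [?a, ?b, ?c] = lamD [?a, ?b, ?c]" by (auto simp: weight_3)
    then show ?thesis using True by (auto simp: lamD_alpha_def)
  next
    case False
    have "?a = ?b \<and> ?b = ?c"
    proof -
      \<comment> \<open>Two equal arrows of a closed walk of length three are adjacent up to rotation, hence a loop,
        and the third arrow is then a loop at the same vertex.\<close>
      consider "?a = ?b" | "?b = ?c" | "?a = ?c" using False by fastforce
      then show ?thesis
      proof cases
        case 1
        then show ?thesis using loops[of x0 i0 j0 i2 j2] arcs heads by simp
      next
        case 2
        then show ?thesis using loops[of x1 i1 j1 i0 j0] arcs heads by simp
      next
        case 3
        then show ?thesis using loops[of x0 i0 j0 i1 j1] arcs heads by simp
      qed
    qed
    then show ?thesis by (simp add: weight_3 lamD_alpha_def)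
  qed
qed

lemma weightD_twist:
  assumes "c \<in> walksA v"
  shows "weight lamD (map twist c) = lamA c"
proof -
  have closed: "map twist c \<in> closed_3_walks D" "degree0 (map twist c)"
    using twist_walk(1)[OF assms] by (simp_all add: walksD_def)
  obtain x0 i0 j0 x1 i1 j1 x2 i2 j2
    where c': "map twist c = [Alpha x0 i0 j0, Alpha x1 i1 j1, Alpha x2 i2 j2]" and j: "(j0 + j1 + j2) mod 3 = 0"
    using closed(2) by (rule degree0E)
  show ?thesis
    using weightD_alpha[OF closed(1)[unfolded c']] twist_walk(2)[OF assms c'] j by (simp add: c')
qed

lemma deriv_A:
  "deriv_potential A a (potentialA s) = (\<Sum>c | c \<in> closed_3_walks A \<and> hd c = a. Poly_Mapping.single (head A a, tl c) (lamA c))"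
proof -
  have "deriv_potential A a (potentialA s)
      = (\<Sum>c | c \<in> closed_3_walks A \<and> hd c = a. Poly_Mapping.single (head A a, tl c) (weight lamA c))"
    unfolding potentialA_walks
    by (rule A.deriv_walk_potential) (rule weight_rotate1[where lam = lamA, OF A.closed_3_length lamA_rotate1])
  also have "\<dots> = (\<Sum>c | c \<in> closed_3_walks A \<and> hd c = a. Poly_Mapping.single (head A a, tl c) (lamA c))"
    by (intro sum.cong refl) (simp add: weightA)
  finally show ?thesis .
qed

lemma deriv_D:
  "deriv_potential D b (potentialD s) = (\<Sum>c | c \<in> closed_3_walks D \<and> hd c = b. Poly_Mapping.single (head D b, tl c) (weight lamD c))"
  unfolding potentialD_walks
  by (rule D.deriv_walk_potential) (rule weight_rotate1[where lam = lamD, OF D.closed_3_length lamD_rotate1])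

lemma deriv_A_closed: "deriv_potential A a (potentialA s) \<in> supported (paths A)"
  unfolding potentialA_walks
  by (rule A.deriv_walk_potential_closed) (rule weight_rotate1[where lam = lamA, OF A.closed_3_length lamA_rotate1])

lemma deriv_D_closed: "deriv_potential D b (potentialD s) \<in> supported (paths D)"
  unfolding potentialD_walks
  by (rule D.deriv_walk_potential_closed) (rule weight_rotate1[where lam = lamD, OF D.closed_3_length lamD_rotate1])

text \<open>The two arrows through which a path \<open>Beta k\<close>, \<open>Gamma k\<close> from \<open>Y\<close> to \<open>Z\<close> closes up to a
  cycle. They come from the two 3-cycles through \<open>X\<close> that leave \<open>X\<close> by the label 2.\<close>
lemma arrows_Z_Y:
  assumes "s mod 3 = 1" "i \<in> Ix" "j \<in> Ix"
  shows "omega_pow j Z + fvec i = Y \<longleftrightarrow> (i, j) = (1, 0) \<or> (i, j) = (2, 1)"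
proof -
  obtain t where t: "X = (t, t, t)" using X_coords[OF assms(1)] by metis
  have "i = 0 \<or> i = 1 \<or> i = 2" "j = 0 \<or> j = 1 \<or> j = 2" using assms(2,3) by (simp_all add: Ix_def)
  then show ?thesis unfolding t
    by (elim disjE) (simp_all add: omega_pow_cases fvec_def)
qed

lemma arcs_Z_Y:
  assumes "s mod 3 = 1"
  shows "Alpha Z 1 0 \<in> arcs D" "Alpha Z 2 1 \<in> arcs D"
    "headD s (Alpha Z 1 0) = Pt Y" "headD s (Alpha Z 2 1) = Pt Y"
proof -
  have h: "omega_pow 0 Z + fvec 1 = Y" "omega_pow 1 Z + fvec 2 = Y"
    by (rule iffD2[OF arrows_Z_Y[OF assms]]; simp add: Ix_def)+
  then show "headD s (Alpha Z 1 0) = Pt Y" "headD s (Alpha Z 2 1) = Pt Y" by (simp_all only: headD.simps)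
  show "Alpha Z 1 0 \<in> arcs D" "Alpha Z 2 1 \<in> arcs D"
    unfolding Alpha_arc h using neighbours_X[OF assms] by (simp_all add: Ix_def)
qed

end

section \<open>Relations of type D are images of relations of type A\<close>

context covering
begin

abbreviation rho where "rho a \<equiv> deriv_potential A a (potentialA s)"
abbreviation delta where "delta b \<equiv> deriv_potential D b (potentialD s)"

lemma NN_two:
  assumes "(w, m) \<in> arcs A" "(z, n) \<in> arcs A" "z = w + fvec m"
  shows "NN 0 w [(w, m), (z, n)] = pmult D (psi (w, m)) (psi (z, n))"
  using psi_tau0[OF assms(2)] by (simp add: assms(3))

lemma Ng_rho:
  "Ng 0 (rho (v, l)) = (\<Sum>c | c \<in> closed_3_walks A \<and> hd c = (v, l). scale (lamA c) (NN 0 (v + fvec l) (tl c)))"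
  unfolding deriv_A lin_sum[OF lin_Ng] by (simp add: Ng_def lin_ext_single quiverA_simps)

text \<open>A closed walk beginning with \<open>\<alpha>\<close> either consists of three arrows \<open>\<alpha>\<close>, and has degree 0 or
  coefficient 0, or it passes through a copy of the fixed point.\<close>
lemma walkD_cases:
  assumes c: "c \<in> closed_3_walks D" "hd c = Alpha x i j"
  obtains "c \<in> walksD x" | "weight lamD c = 0"
  | k where "s mod 3 = 1" "k \<in> Ix" "x = Z" "headD s (Alpha x i j) = Pt Y" "c = [Alpha x i j, Beta k, Gamma k]"
proof -
  obtain d e where c': "c = [Alpha x i j, d, e]" using c by (metis D.closed_3E list.sel(1))
  have arcs: "Alpha x i j \<in> arcs D" "d \<in> arcs D" "e \<in> arcs D"
    and heads: "headD s (Alpha x i j) = tailD s d" "headD s d = tailD s e" "headD s e = Pt x"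
    using c(1) by (simp_all add: c' D.closed_3_iff quiverD_simps(2,3))
  show ?thesis
  proof (cases d)
    case (Alpha x1 i1 j1)
    show ?thesis
    proof (cases e)
      case e: (Alpha x2 i2 j2)
      show ?thesis
      proof (cases "(j + j1 + j2) mod 3 = 0")
        case True
        then have "c \<in> walksD x" using c(1) by (simp add: walksD_def c' Alpha e)
        then show ?thesis by (rule that(1))
      next
        case False
        then have "weight lamD c = 0" using weightD_alpha c(1) by (simp add: c' Alpha e)
        then show ?thesis by (rule that(2))
      qed
    qed (use heads in \<open>simp_all add: Alpha\<close>)
  next
    case (Beta k)
    have "e = Gamma k" using heads by (cases e) (simp_all add: Beta)
    then show ?thesis
      using that(3)[of k] heads arcs by (simp add: Beta nonAlpha_arc c')
  next
    case (Gamma k)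
    then show ?thesis using heads by simp
  qed
qed

lemma X_walksD:
  assumes "s mod 3 = 1" "Alpha Z i j \<in> arcs D" "headD s (Alpha Z i j) = Pt Y" "k \<in> Ix"
  shows "[Alpha Z i j, Beta k, Gamma k] \<in> closed_3_walks D"
    "weight lamD [Alpha Z i j, Beta k, Gamma k] = lamD_X i j k"
  using assms by (simp_all add: D.closed_3_iff quiverD_simps(2,3) nonAlpha_arc weight_3)

text \<open>If the head of the arrow is dominant, then the only way from it to \<open>X\<close> is the arrow from \<open>Y\<close>
  with label 0.\<close>
lemma X_walksA:
  assumes arc: "(v, l) \<in> arcs A" and off: "omega v \<noteq> v" "omega (v + fvec l) \<noteq> v + fvec l" and level: "level (v + fvec l) = 0"
    and c: "c \<in> closed_3_walks A" "hd c = (v, l)" "c \<notin> walksA v"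
  shows "s mod 3 = 1" "v + fvec l = Y" "rep v = Z" "c = [(v, l), (Y, 0), (X, (2 - level v) mod 3)]"
proof -
  obtain b d where bd: "c = [(v, l), b, d]" using c(1,2) by (metis A.closed_3E list.sel(1))
  obtain w m z n where vs: "b = (w, m)" "d = (z, n)" by (cases b, cases d)
  have arcs: "(w, m) \<in> arcs A" "(z, n) \<in> arcs A" and heads: "w = v + fvec l" "z = w + fvec m" "v = z + fvec n"
    using c(1) by (simp_all add: bd vs A.closed_3_iff quiverA_simps(2,3))
  have Ix: "m \<in> Ix" "n \<in> Ix" using arcs by (simp_all add: quiverA_simps)
  have "omega z = z"
    using c(1,3) off by (auto simp: walksA_def bd vs heads(1))
  then have sX: "s mod 3 = 1 \<and> z = X"
    using arcs(2) by (intro fixed_simplex) (simp_all add: quiverA_simps)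
  then show s: "s mod 3 = 1" by (rule conjunct1)
  have z: "z = X" using sX by (rule conjunct2)
  have wX: "w + fvec m = X" using heads(2) z by simp
  have "(- m) mod 3 = 0" using into_X(3)[OF s wX] level heads(1) by simp
  then have m: "m = 0" using Ix(1) by (auto simp: Ix_def)
  then have w: "w = Y" using into_X(1)[OF s wX] by simp
  then show "v + fvec l = Y" using heads(1) by simp
  have v: "v = X + fvec n" using heads(3) z by simp
  show "rep v = Z" unfolding v by (rule from_X(2)[OF s])
  have "level v = (2 - n) mod 3" unfolding v by (rule from_X(3)[OF s])
  then have "(2 - level v) mod 3 = n" using Ix(2) by (auto simp: Ix_def)
  then show "c = [(v, l), (Y, 0), (X, (2 - level v) mod 3)]" by (simp add: bd vs m w z)
qed

text \<open>The closed walks on both sides that begin with the given arrow and avoid the fixed point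
  correspond to each other by the twist. If the arrow leads from the orbit of \<open>Z\<close> to \<open>Y\<close>, then
  there is one more walk of type A, through \<open>X\<close>, and its image is the sum of the three walks of
  type D through the copies of \<open>X\<close>. The exponents of \<open>zt\<close> in \<open>psi\<close> produce exactly the
  coefficients of the potential of type D.\<close>
lemma relation_Alpha:
  assumes arc: "(v, l) \<in> arcs A" and off: "omega v \<noteq> v" "omega (v + fvec l) \<noteq> v + fvec l" and level: "level (v + fvec l) = 0"
  shows "Ng 0 (rho (v, l)) = delta (twist (v, l))"
proof -
  define w where "w = v + fvec l"
  define b where "b = twist (v, l)"
  define F where "F c = scale (lamA c) (NN 0 w (tl c))" for c
  define G where "G c = Poly_Mapping.single (Pt w, tl c) (weight lamD c)" for c
  define WA where "WA = {c. c \<in> closed_3_walks A \<and> hd c = (v, l)}"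
  define WD where "WD = {c. c \<in> closed_3_walks D \<and> hd c = b}"
  have fin: "finite WA" "finite WD" using A.finite_closed_3_walks D.finite_closed_3_walks by (simp_all add: WA_def WD_def)
  have l: "l \<in> Ix" using arc by (simp add: quiverA_simps)
  have vs: "v \<in> simplex s" using arc by (simp add: quiverA_simps)
  have w: "rep w = w" using level by (simp add: w_def rep_level_0)
  have b: "b = Alpha (rep v) l (level v)" using l level by (simp add: b_def twist_def Ix_mod)
  have head: "headD s b = Pt w" using head_twist[OF off] w by (simp add: b_def w_def)
  have barc: "b \<in> arcs D" unfolding b_def by (rule twist_arc[OF arc off])
  have "bij_betw (map twist) {c \<in> walksA v. hd c = (v, l)} {c \<in> walksD (rep v). hd c = b}"
  proof (rule bij_betw_subset[OF twist_walk_bij[OF vs off(1)]])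
    show "map twist ` {c \<in> walksA v. hd c = (v, l)} = {c \<in> walksD (rep v). hd c = b}"
    proof (intro equalityI subsetI)
      fix c' assume "c' \<in> map twist ` {c \<in> walksA v. hd c = (v, l)}"
      then obtain c where c: "c \<in> walksA v" "hd c = (v, l)" "c' = map twist c" by blast
      have "c \<noteq> []" using c(1) by (auto elim: walksAE)
      then show "c' \<in> {c \<in> walksD (rep v). hd c = b}" using twist_walk(1)[OF c(1)] c(2,3) by (simp add: hd_map b_def)
    next
      fix c' assume c': "c' \<in> {c \<in> walksD (rep v). hd c = b}"
      then obtain c where c: "c \<in> walksA v" "c' = map twist c" using lift_walk[OF vs off(1)] by blast
      obtain l' w' m z n where c2: "c = [(v, l'), (w', m), (z, n)]" "(v, l') \<in> arcs A" using c(1) by (rule walksAE)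
      have "twist (v, l') = twist (v, l)" using c' by (simp add: c(2) c2(1) b_def)
      then have "l' = l" using c2(2) l by (intro twist_inj) (simp_all add: quiverA_simps)
      then show "c' \<in> map twist ` {c \<in> walksA v. hd c = (v, l)}" using c c2(1) by (intro image_eqI[of _ _ c]) simp_all
    qed
  qed blast
  then have "(\<Sum>c\<in>{c \<in> walksD (rep v). hd c = b}. G c) = (\<Sum>c\<in>{c \<in> walksA v. hd c = (v, l)}. G (map twist c))"
    by (rule sum.reindex_bij_betw[symmetric])
  also have "\<dots> = (\<Sum>c\<in>{c \<in> walksA v. hd c = (v, l)}. F c)"
  proof (rule sum.cong[OF refl])
    fix c assume c: "c \<in> {c \<in> walksA v. hd c = (v, l)}"
    then have cw: "c \<in> walksA v" by simp
    obtain l' w' m z n where c2: "c = [(v, l'), (w', m), (z, n)]" "(w', m) \<in> arcs A" "(z, n) \<in> arcs A"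
      "w' = v + fvec l'" "z = w' + fvec m" "v = z + fvec n" "omega w' \<noteq> w'" "omega z \<noteq> z"
      using cw by (rule walksAE)
    have l': "l' = l" "w' = w" using c by (simp_all add: c2(1) c2(4) w_def)
    have psis: "psi (w, m) = basis (Pt w, [twist (w, m)])" "psi (z, n) = basis (Pt (rep z), [twist (z, n)])"
      using psi_off[of w m] psi_off[of z n] c2(5-8) off(1) w by (simp_all add: l'(2))
    have "headD s (twist (w, m)) = Pt (rep z)" using head_twist[of w m s] c2(5,7,8) by (simp add: l'(2))
    moreover have "NN 0 w (tl c) = pmult D (psi (w, m)) (psi (z, n))"
      unfolding c2(1) l' list.sel using c2(2,3,5) unfolding l' by (rule NN_two)
    ultimately have "NN 0 w (tl c) = basis (Pt w, tl (map twist c))"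
      by (simp only: psis) (simp add: c2(1) l' pmult_single_single quiverD_simps)
    then show "G (map twist c) = F c" by (simp add: G_def F_def weightD_twist[OF cw])
  qed
  \<comment> \<open>The walks that avoid the fixed point contribute equally.\<close>
  finally have alpha: "(\<Sum>c\<in>{c \<in> walksD (rep v). hd c = b}. G c) = (\<Sum>c\<in>{c \<in> walksA v. hd c = (v, l)}. F c)" .
  \<comment> \<open>The remaining walks pass through the fixed point or have coefficient 0.\<close>
  have X: "(\<Sum>c\<in>{c \<in> WD. c \<notin> walksD (rep v)}. G c) = (\<Sum>c\<in>{c \<in> WA. c \<notin> walksA v}. F c)"
  proof (cases "s mod 3 = 1 \<and> w = Y \<and> rep v = Z")
    case False
    have none: "{c \<in> WA. c \<notin> walksA v} = {}"
    proof (rule equals0I)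
      fix c assume "c \<in> {c \<in> WA. c \<notin> walksA v}"
      then have c: "c \<in> closed_3_walks A" "hd c = (v, l)" "c \<notin> walksA v" by (simp_all add: WA_def)
      show False
        using False X_walksA(1-3)[OF arc off level c] unfolding w_def by blast
    qed
    have "G c = 0" if "c \<in> {c \<in> WD. c \<notin> walksD (rep v)}" for c
    proof -
      have "c \<in> closed_3_walks D" "hd c = Alpha (rep v) l (level v)" using that by (simp_all add: WD_def b)
      then show ?thesis
        by (cases rule: walkD_cases) (use that False head b in \<open>simp_all add: G_def\<close>)
    qed
    then have "(\<Sum>c\<in>{c \<in> WD. c \<notin> walksD (rep v)}. G c) = 0" by (rule sum.neutral[OF ballI])
    then show ?thesis unfolding none by (simp only: sum.empty)
  next
    case True
    then have s: "s mod 3 = 1" and wY: "w = Y" and Z: "rep v = Z" by simp_all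
    let ?n = "(2 - level v) mod 3"
    let ?c = "[(v, l), (Y, 0), (X, ?n)]"
    have v: "X + fvec (2 - level v) = v"
    proof -
      have "X + fvec (2 - level v) = omega_pow (2 - (2 - level v)) Z" by (rule from_X(1)[OF s])
      also have "\<dots> = omega_pow (level v) (rep v)" by (simp add: Z)
      finally show ?thesis by (simp only: omega_pow_rep)
    qed
    have "?c \<in> closed_3_walks A"
      using arc arc_Y[OF s] arc_X[OF s, of "2 - level v"] v wY by (simp add: A.closed_3_iff quiverA_simps(2,3) w_def)
    moreover have "?c \<notin> walksA v" by (simp add: walksA_def)
    moreover have "c = ?c" if "c \<in> WA" "c \<notin> walksA v" for c
      using that unfolding WA_def by (intro X_walksA(4)[OF arc off level]) simp_all
    ultimately have WA: "{c \<in> WA. c \<notin> walksA v} = {?c}"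
      unfolding WA_def by (intro equalityI subsetI) auto
    have "omega_pow (level v) Z + fvec l = Y" using omega_pow_rep[of v] wY by (simp only: Z w_def)
    then have cases: "(l, level v) = (1, 0) \<or> (l, level v) = (2, 1)"
      using arrows_Z_Y[OF s l level_Ix] by simp
    let ?B = "(\<lambda>k. [b, Beta k, Gamma k]) ` Ix"
    have bZ: "b = Alpha Z l (level v)" by (simp add: b Z)
    have B: "?B \<subseteq> {c \<in> WD. c \<notin> walksD (rep v)}"
      using X_walksD(1)[OF s barc[unfolded bZ] head[unfolded bZ wY]] by (auto simp: WD_def walksD_def bZ)
    have "(\<Sum>c\<in>{c \<in> WD. c \<notin> walksD (rep v)}. G c) = (\<Sum>c\<in>?B. G c)"
    proof (rule sum.mono_neutral_right[OF _ B])
      show "finite {c \<in> WD. c \<notin> walksD (rep v)}" using fin(2) by simp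
      show "\<forall>c\<in>{c \<in> WD. c \<notin> walksD (rep v)} - ?B. G c = 0"
      proof
        fix c assume c: "c \<in> {c \<in> WD. c \<notin> walksD (rep v)} - ?B"
        then have "c \<in> closed_3_walks D" "hd c = Alpha (rep v) l (level v)" by (simp_all add: WD_def b)
        then show "G c = 0" by (cases rule: walkD_cases) (use c in \<open>auto simp: G_def b\<close>)
      qed
    qed
    also have "\<dots> = (\<Sum>k\<in>Ix. G [b, Beta k, Gamma k])"
      by (rule sum.reindex_cong[of "\<lambda>k. [b, Beta k, Gamma k]"]) (simp_all add: inj_on_def)
    also have "\<dots> = (\<Sum>k\<in>Ix. Poly_Mapping.single (Pt Y, [Beta k, Gamma k]) (lamD_X l (level v) k))"
      by (intro sum.cong refl)
        (simp add: G_def wY bZ X_walksD(2)[OF s barc[unfolded bZ] head[unfolded bZ wY]])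
    also have "\<dots> = scale (lamA ?c) (\<Sum>k\<in>Ix. Poly_Mapping.single (Pt Y, [Beta k, Gamma k]) (zt (k * level v)))"
    proof -
      \<comment> \<open>The level of \<open>v\<close> is 0 for the label 1 and 1 for the label 2, which matches the coefficients
        \<open>- 1\<close> and \<open>zeta powi k\<close>.\<close>
      have "lamD_X l (level v) k = lamA ?c * zt (k * level v)" for k
        using cases by (elim disjE) (simp_all add: lamD_X_def index_sign_def rot_sim_def zt_def)
      then show ?thesis by (simp add: scale_sum)
    qed
    also have "(\<Sum>k\<in>Ix. Poly_Mapping.single (Pt Y, [Beta k, Gamma k]) (zt (k * level v))) = pmult D (psi (Y, 0)) (psi (X, ?n))"
    proof -
      have "psi (X, ?n) = (\<Sum>k\<in>Ix. Poly_Mapping.single (Copy k, [Gamma k]) (zt (k * level v)))"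
        using v by (simp add: psi_from)
      then show ?thesis
        unfolding psi_Y[OF s]
        by (simp add: pmult_sum_left pmult_sum_right pmult_single_single quiverD_simps sum.delta cong: if_cong)
    qed
    also have "pmult D (psi (Y, 0)) (psi (X, ?n)) = NN 0 w (tl ?c)"
      using NN_two[OF arc_Y[OF s] arc_X[OF s, of "2 - level v"]] by (simp add: wY)
    finally have "(\<Sum>c\<in>{c \<in> WD. c \<notin> walksD (rep v)}. G c) = F ?c" unfolding F_def .
    then show ?thesis unfolding WA by (simp only: sum.insert finite.emptyI empty_iff not_False_eq_True sum.empty add_0_right)
  qed
  have sets: "WA \<inter> walksA v = {c \<in> walksA v. hd c = (v, l)}" "WD \<inter> walksD (rep v) = {c \<in> walksD (rep v). hd c = b}"
    "WA - walksA v = {c \<in> WA. c \<notin> walksA v}" "WD - walksD (rep v) = {c \<in> WD. c \<notin> walksD (rep v)}"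
    by (auto simp: WA_def WD_def walksA_def walksD_def)
  have "Ng 0 (rho (v, l)) = (\<Sum>c\<in>WA. F c)" by (simp add: Ng_rho WA_def F_def w_def)
  also have "\<dots> = (\<Sum>c\<in>WD. G c)"
    unfolding sum.Int_Diff[OF fin(1), where B = "walksA v"] sum.Int_Diff[OF fin(2), where B = "walksD (rep v)"]
      sets alpha X ..
  also have "\<dots> = delta b" by (simp add: deriv_D WD_def G_def head quiverD_simps(3))
  finally show ?thesis by (simp add: b_def)
qed

lemma psi_offI:
  assumes "omega v \<noteq> v" "v + fvec l = w" "omega w \<noteq> w"
  shows "psi (v, l) = basis (Pt (rep v), [Alpha (rep v) ((l + level w) mod 3) ((level v - level w) mod 3)])"
  using psi_off[of v l] assms(1,3) unfolding assms(2) by (simp add: twist_def assms(2))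

lemma psi_intoI:
  assumes "omega v \<noteq> v" "v + fvec l = w" "omega w = w"
  shows "psi (v, l) = (\<Sum>k\<in>Ix. Poly_Mapping.single (Pt (rep v), [Beta k]) (zt (- k * level v)))"
  using assms by (intro psi_into) simp_all

lemma sum_pair: "p \<noteq> q \<Longrightarrow> (\<Sum>c\<in>{p, q}. f c) = f p + f q"
  by simp

lemma arrows_Z_Y_arc:
  assumes "s mod 3 = 1" "Alpha Z i j \<in> arcs D" "omega_pow j Z + fvec i = Y"
  shows "(i, j) = (1, 0) \<or> (i, j) = (2, 1)"
proof -
  have "i \<in> Ix" "j \<in> Ix" using assms(2) by (simp_all add: Alpha_arc)
  then show ?thesis using arrows_Z_Y[OF assms(1)] assms(3) by blast
qed

lemma psi_Z_Y:
  assumes "s mod 3 = 1"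
  shows "psi (Z, 1) = basis (Pt Z, [Alpha Z 1 0])" "Z + fvec 1 = Y" "(Z, 1) \<in> arcs A"
proof -
  obtain a b c where "X = (a, b, c)" by (cases X)
  then show u: "Z + fvec 1 = Y" by (simp add: fvec_def)
  show "(Z, 1) \<in> arcs A"
    unfolding quiverA_simps(4) u using neighbours_X[OF assms] by (simp add: Ix_def)
  have Y: "omega Y \<noteq> Y" "level Y = 0" using neighbours_X(4)[OF assms] not_dominant_fixed level_dominant by blast+
  have lZ: "level Z = 0" using neighbours_X(5)[OF assms] by (rule level_dominant)
  show "psi (Z, 1) = basis (Pt Z, [Alpha Z 1 0])"
    unfolding psi_offI[OF from_X(4)[OF assms, of 2] u Y(1)] from_X(2)[OF assms] lZ Y(2) by simp
qed

text \<open>Two triangles contain the arrow from \<open>Y\<close> to \<open>X\<close>. The image of the derivative of type A is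
  the sum over all copies, so the relation of one copy is cut out by its vertex.\<close>
lemma relation_Beta:
  assumes s: "s mod 3 = 1" and k: "k \<in> Ix"
  shows "pmult D (basis (Copy k, [])) (Ng 0 (rho (Y, 0))) = delta (Beta k)"
proof -
  define u where "u = X + fvec 1"
  let ?p = "[(Y, 0 :: int), (X, 1), (u, 2)]" and ?q = "[(Y, 0 :: int), (X, 2), (Z, 1)]"
  obtain a b c where XC: "X = (a, b, c)" by (cases X)
  have YX: "Y + fvec 0 = X" by simp
  have uY: "u + fvec 2 = Y" by (simp add: u_def XC fvec_def)
  have u: "omega u \<noteq> u" "rep u = Z" "level u = 1" using from_X[OF s, of 1] by (simp_all add: u_def)
  have X1: "(X, 1) \<in> arcs A" "(X, 2) \<in> arcs A" using arc_X[OF s, of 1] arc_X[OF s, of 2] by simp_all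
  have u2: "(u, 2) \<in> arcs A"
    using X1(1) neighbours_X(2)[OF s] unfolding quiverA_simps(4) uY by (simp add: u_def Ix_def)
  have set: "{c. c \<in> closed_3_walks A \<and> hd c = (Y, 0)} = {?p, ?q}"
  proof (intro equalityI subsetI)
    fix c assume c: "c \<in> {c. c \<in> closed_3_walks A \<and> hd c = (Y, 0)}"
    then obtain b' d where bd: "c = [(Y, 0), b', d]" by (metis (mono_tags, lifting) A.closed_3E list.sel(1) mem_Collect_eq)
    obtain w m z n where vs: "b' = (w, m)" "d = (z, n)" by (cases b', cases d)
    have arcs': "(w, m) \<in> arcs A" "(z, n) \<in> arcs A" and heads: "Y + fvec 0 = w" "w + fvec m = z" "z + fvec n = Y"
      using c unfolding bd vs mem_Collect_eq A.closed_3_iff quiverA_simps(2,3) fst_conv by blast+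
    have w: "w = X" using heads(1) YX by (rule trans[OF sym])
    have e: "X + fvec m + fvec n = Y" using heads(2,3) unfolding w by (simp only:)
    have "m = 0 \<or> m = 1 \<or> m = 2" "n = 0 \<or> n = 1 \<or> n = 2" using arcs' by (simp_all add: quiverA_simps Ix_def)
    then have "(m, n) = (1, 2) \<or> (m, n) = (2, 1)"
      using e unfolding XC by (elim disjE) (simp_all add: fvec_def)
    then show "c \<in> {?p, ?q}"
      using heads(2) by (auto simp: bd vs w u_def)
  next
    fix c assume "c \<in> {?p, ?q}"
    then have "c = ?p \<or> c = ?q" by blast
    moreover have "?p \<in> closed_3_walks A" "?q \<in> closed_3_walks A"
      unfolding A.closed_3_iff quiverA_simps(2,3) fst_conv YX uY psi_Z_Y(2)[OF s]
      using X1 u2 psi_Z_Y(3)[OF s] arc_Y[OF s] by (simp_all only: u_def simp_thms)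
    ultimately show "c \<in> {c. c \<in> closed_3_walks A \<and> hd c = (Y, 0)}" by (elim disjE) (simp_all only: mem_Collect_eq list.sel simp_thms)
  qed
  have ne: "?p \<noteq> ?q" by simp
  have lam: "lamA ?p = 1" "lamA ?q = - 1" by (simp_all add: index_sign_def rot_sim_def)
  have "Ng 0 (rho (Y, 0)) = NN 0 X [(X, 1), (u, 2)] + scale (- 1) (NN 0 X [(X, 2), (Z, 1)])"
    unfolding Ng_rho set sum_pair[OF ne] YX lam list.sel scale_one ..
  also have "NN 0 X [(X, 1), (u, 2)] = pmult D (psi (X, 1)) (psi (u, 2))"
    by (rule NN_two[OF X1(1) u2 u_def])
  also have "NN 0 X [(X, 2), (Z, 1)] = pmult D (psi (X, 2)) (psi (Z, 1))"
    by (rule NN_two[OF X1(2) psi_Z_Y(3)[OF s] refl])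
  also have "psi (u, 2) = basis (Pt Z, [Alpha Z 2 1])"
  proof -
    have Y: "omega Y \<noteq> Y" "level Y = 0" using neighbours_X(4)[OF s] not_dominant_fixed level_dominant by blast+
    show ?thesis unfolding psi_offI[OF u(1) uY Y(1)] u Y(2) by simp
  qed
  also note psi_Z_Y(1)[OF s]
  finally have Ng: "Ng 0 (rho (Y, 0)) = (\<Sum>k\<in>Ix. Poly_Mapping.single (Copy k, [Gamma k, Alpha Z 2 1]) (zt k))
      + scale (- 1) (\<Sum>k\<in>Ix. basis (Copy k, [Gamma k, Alpha Z 1 0]))"
    unfolding psi_X[OF s] by (simp add: pmult_sum_left pmult_single_single quiverD_simps)
  have "{c. c \<in> closed_3_walks D \<and> hd c = Beta k} = {[Beta k, Gamma k, Alpha Z 1 0], [Beta k, Gamma k, Alpha Z 2 1]}"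
  proof (intro equalityI subsetI)
    fix c assume c: "c \<in> {c. c \<in> closed_3_walks D \<and> hd c = Beta k}"
    then obtain b d where bd: "c = [Beta k, b, d]" by (metis (mono_tags, lifting) D.closed_3E list.sel(1) mem_Collect_eq)
    have arcs': "b \<in> arcs D" "d \<in> arcs D" and heads: "Copy k = tailD s b" "headD s b = tailD s d" "headD s d = Pt Y"
      using c by (simp_all add: bd D.closed_3_iff quiverD_simps(2,3))
    have b: "b = Gamma k" using heads(1) by (cases b) simp_all
    obtain i j where d: "d = Alpha Z i j" "omega_pow j Z + fvec i = Y"
      using heads(2,3) by (cases d) (simp_all add: b)
    then have "(i, j) = (1, 0) \<or> (i, j) = (2, 1)"
      using arrows_Z_Y_arc[OF s] arcs'(2) by blast
    then show "c \<in> {[Beta k, Gamma k, Alpha Z 1 0], [Beta k, Gamma k, Alpha Z 2 1]}" by (auto simp: bd b d(1))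
  next
    fix c assume "c \<in> {[Beta k, Gamma k, Alpha Z 1 0], [Beta k, Gamma k, Alpha Z 2 1]}"
    then have "c = [Beta k, Gamma k, Alpha Z 1 0] \<or> c = [Beta k, Gamma k, Alpha Z 2 1]" by blast
    moreover have "[Beta k, Gamma k, Alpha Z 1 0] \<in> closed_3_walks D" "[Beta k, Gamma k, Alpha Z 2 1] \<in> closed_3_walks D"
      unfolding D.closed_3_iff quiverD_simps(2,3) nonAlpha_arc tailD.simps arcs_Z_Y(3,4)[OF s] headD.simps(2,3)
      using arcs_Z_Y(1,2)[OF s] s k by (simp_all only: simp_thms)
    ultimately show "c \<in> {c. c \<in> closed_3_walks D \<and> hd c = Beta k}" by (elim disjE) (simp_all only: mem_Collect_eq list.sel simp_thms)
  qed
  then have "delta (Beta k) = Poly_Mapping.single (Copy k, [Gamma k, Alpha Z 1 0]) (- 1)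
      + Poly_Mapping.single (Copy k, [Gamma k, Alpha Z 2 1]) (zt k)"
    unfolding deriv_D by (simp add: weight_3 lamD_X_def zt_def quiverD_simps)
  then show ?thesis
    using k unfolding Ng
    by (simp add: pmult_add_right pmult_scale_right pmult_sum_right pmult_single_single quiverD_simps sum.delta' sum.delta add.commute cong: if_cong)
qed

lemma relation_Gamma:
  assumes s: "s mod 3 = 1" and k: "k \<in> Ix"
  shows "pmult D (Ng 0 (rho (X, 2))) (basis (Copy k, [])) = delta (Gamma k)"
proof -
  define u where "u = Z + fvec 0"
  let ?p = "[(X, 2 :: int), (Z, 0), (u, 1)]" and ?q = "[(X, 2 :: int), (Z, 1), (Y, 0)]"
  obtain a b c where XC: "X = (a, b, c)" by (cases X)
  have YX: "Y + fvec 0 = X" by simp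
  have uX: "u + fvec 1 = X" by (simp add: u_def XC fvec_def)
  have u: "omega u \<noteq> u" "rep u = Y" "level u = 2" using into_X[OF s uX] by simp_all
  have us: "u \<in> simplex s"
    unfolding into_X(1)[OF s uX] omega_pow_simplex by (rule neighbours_X(2)[OF s])
  have X2: "(X, 2) \<in> arcs A" using arc_X[OF s, of 2] by simp
  have Z0: "(Z, 0) \<in> arcs A" using us neighbours_X(3)[OF s] unfolding quiverA_simps(4) u_def by (simp add: Ix_def)
  have u1: "(u, 1) \<in> arcs A" using us neighbours_X(1)[OF s] unfolding quiverA_simps(4) uX by (simp add: Ix_def)
  have Zoff: "omega Z \<noteq> Z" "rep Z = Z" "level Z = 0" using from_X[OF s, of 2] by simp_all
  have set: "{c. c \<in> closed_3_walks A \<and> hd c = (X, 2)} = {?p, ?q}"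
  proof (intro equalityI subsetI)
    fix c assume c: "c \<in> {c. c \<in> closed_3_walks A \<and> hd c = (X, 2)}"
    then obtain b' d where bd: "c = [(X, 2), b', d]" by (metis (mono_tags, lifting) A.closed_3E list.sel(1) mem_Collect_eq)
    obtain w m z n where vs: "b' = (w, m)" "d = (z, n)" by (cases b', cases d)
    have arcs': "(w, m) \<in> arcs A" "(z, n) \<in> arcs A" and heads: "Z = w" "w + fvec m = z" "z + fvec n = X"
      using c unfolding bd vs mem_Collect_eq A.closed_3_iff quiverA_simps(2,3) fst_conv by blast+
    have e: "Z + fvec m + fvec n = X" using heads(2,3) unfolding heads(1)[symmetric] by (simp only:)
    have "m = 0 \<or> m = 1 \<or> m = 2" "n = 0 \<or> n = 1 \<or> n = 2" using arcs' by (simp_all add: quiverA_simps Ix_def)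
    then have "(m, n) = (0, 1) \<or> (m, n) = (1, 0)"
      using e unfolding XC by (elim disjE) (simp_all add: fvec_def)
    moreover have "z = u" if "m = 0" using heads(1,2) that by (simp only: u_def)
    moreover have "z = Y" if "m = 1" using heads(1,2) psi_Z_Y(2)[OF s] that by (simp only:)
    ultimately show "c \<in> {?p, ?q}"
      unfolding bd vs heads(1)[symmetric] by (elim disjE) simp_all
  next
    fix c assume "c \<in> {?p, ?q}"
    then have "c = ?p \<or> c = ?q" by blast
    moreover have "?p \<in> closed_3_walks A" "?q \<in> closed_3_walks A"
      unfolding A.closed_3_iff quiverA_simps(2,3) fst_conv YX uX psi_Z_Y(2)[OF s]
      using X2 Z0 u1 psi_Z_Y(3)[OF s] arc_Y[OF s] by (simp_all only: u_def simp_thms)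
    ultimately show "c \<in> {c. c \<in> closed_3_walks A \<and> hd c = (X, 2)}" by (elim disjE) (simp_all only: mem_Collect_eq list.sel simp_thms)
  qed
  have ne: "?p \<noteq> ?q" by simp
  have lam: "lamA ?p = 1" "lamA ?q = - 1" by (simp_all add: index_sign_def rot_sim_def)
  have "Ng 0 (rho (X, 2)) = NN 0 Z [(Z, 0), (u, 1)] + scale (- 1) (NN 0 Z [(Z, 1), (Y, 0)])"
    unfolding Ng_rho set sum_pair[OF ne] lam list.sel scale_one ..
  also have "NN 0 Z [(Z, 0), (u, 1)] = pmult D (psi (Z, 0)) (psi (u, 1))"
    by (rule NN_two[OF Z0 u1 u_def])
  also have "NN 0 Z [(Z, 1), (Y, 0)] = pmult D (psi (Z, 1)) (psi (Y, 0))"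
    by (rule NN_two[OF psi_Z_Y(3)[OF s] arc_Y[OF s] psi_Z_Y(2)[OF s, symmetric]])
  also have "psi (Z, 0) = basis (Pt Z, [Alpha Z 2 1])"
    unfolding psi_offI[OF Zoff(1) u_def[symmetric] u(1)] Zoff u by simp
  also note psi_Z_Y(1)[OF s]
  also have "psi (u, 1) = (\<Sum>k\<in>Ix. Poly_Mapping.single (Pt Y, [Beta k]) (zt k))"
  proof -
    \<comment> \<open>The tail of this arrow has level 2, and \<open>- 2\<close> is 1 modulo 3.\<close>
    have "zt (- k * 2) = zt k" for k by (rule zt_cong) (simp add: mod_eq_dvd_iff)
    then show ?thesis unfolding psi_intoI[OF u(1) uX X_fixed] u by (simp only:)
  qed
  finally have Ng: "Ng 0 (rho (X, 2)) = (\<Sum>k\<in>Ix. Poly_Mapping.single (Pt Z, [Alpha Z 2 1, Beta k]) (zt k))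
      + scale (- 1) (\<Sum>k\<in>Ix. basis (Pt Z, [Alpha Z 1 0, Beta k]))"
    unfolding psi_Y[OF s] using arcs_Z_Y(3,4)[OF s]
    by (simp add: pmult_sum_right pmult_single_single quiverD_simps(3) del: headD.simps(1))
  have "{c. c \<in> closed_3_walks D \<and> hd c = Gamma k} = {[Gamma k, Alpha Z 1 0, Beta k], [Gamma k, Alpha Z 2 1, Beta k]}"
  proof (intro equalityI subsetI)
    fix c assume c: "c \<in> {c. c \<in> closed_3_walks D \<and> hd c = Gamma k}"
    then obtain b d where bd: "c = [Gamma k, b, d]" by (metis (mono_tags, lifting) D.closed_3E list.sel(1) mem_Collect_eq)
    have arcs': "b \<in> arcs D" "d \<in> arcs D" and heads: "Pt Z = tailD s b" "headD s b = tailD s d" "headD s d = Copy k"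
      using c by (simp_all add: bd D.closed_3_iff quiverD_simps(2,3))
    have d: "d = Beta k" using heads(3) by (cases d) simp_all
    have "Y \<noteq> Z" by (simp add: XC fvec_def)
    then obtain i j where b: "b = Alpha Z i j" "omega_pow j Z + fvec i = Y"
      using heads(1,2) by (cases b) (simp_all add: d)
    then have "(i, j) = (1, 0) \<or> (i, j) = (2, 1)"
      using arrows_Z_Y_arc[OF s] arcs'(1) by blast
    then show "c \<in> {[Gamma k, Alpha Z 1 0, Beta k], [Gamma k, Alpha Z 2 1, Beta k]}" by (auto simp: bd d b(1))
  next
    fix c assume "c \<in> {[Gamma k, Alpha Z 1 0, Beta k], [Gamma k, Alpha Z 2 1, Beta k]}"
    then have "c = [Gamma k, Alpha Z 1 0, Beta k] \<or> c = [Gamma k, Alpha Z 2 1, Beta k]" by blast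
    moreover have "[Gamma k, Alpha Z 1 0, Beta k] \<in> closed_3_walks D" "[Gamma k, Alpha Z 2 1, Beta k] \<in> closed_3_walks D"
      unfolding D.closed_3_iff quiverD_simps(2,3) nonAlpha_arc tailD.simps arcs_Z_Y(3,4)[OF s] headD.simps(2,3)
      using arcs_Z_Y(1,2)[OF s] s k by (simp_all only: simp_thms)
    ultimately show "c \<in> {c. c \<in> closed_3_walks D \<and> hd c = Gamma k}" by (elim disjE) (simp_all only: mem_Collect_eq list.sel simp_thms)
  qed
  then have "delta (Gamma k) = Poly_Mapping.single (Pt Z, [Alpha Z 1 0, Beta k]) (- 1)
      + Poly_Mapping.single (Pt Z, [Alpha Z 2 1, Beta k]) (zt k)"
    unfolding deriv_D by (simp add: weight_3 lamD_X_def zt_def quiverD_simps)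
  then show ?thesis
    using k unfolding Ng
    by (simp add: pmult_add_left pmult_scale_left pmult_sum_left pmult_single_single quiverD_simps sum.delta' sum.delta add.commute cong: if_cong)
qed

end

section \<open>The Jacobian ideals correspond\<close>

lemma act_single: "act_path_algebra g (Poly_Mapping.single p z) = Poly_Mapping.single (act_path g p) z"
  by (simp add: act_path_algebra_eq lin_ext_single)

context covering
begin

definition IA where "IA = Idl\<^bsub>path_algebra A\<^esub> (rho ` arcs A)"
definition ID where "ID = Idl\<^bsub>path_algebra D\<^esub> (delta ` arcs D)"

lemma generatorsA: "rho ` arcs A \<subseteq> carrier (path_algebra A)"
  using deriv_A_closed by (auto simp: path_algebra_simps)

lemma generatorsD: "delta ` arcs D \<subseteq> carrier (path_algebra D)"
  using deriv_D_closed by (auto simp: path_algebra_simps)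

lemma ideal_IA: "ideal IA (path_algebra A)"
  unfolding IA_def by (rule ring.genideal_ideal[OF A.ring_path_algebra generatorsA])

lemma ideal_ID: "ideal ID (path_algebra D)"
  unfolding ID_def by (rule ring.genideal_ideal[OF D.ring_path_algebra generatorsD])

sublocale IA: path_algebra_ideal A IA
  by (rule path_algebra_ideal.intro[OF finite_quiverA path_algebra_ideal_axioms.intro[OF ideal_IA]])
sublocale ID: path_algebra_ideal D ID
  by (rule path_algebra_ideal.intro[OF finite_quiverD path_algebra_ideal_axioms.intro[OF ideal_ID]])

lemma rho_IA: "a \<in> arcs A \<Longrightarrow> rho a \<in> IA"
  unfolding IA_def using ring.genideal_self[OF A.ring_path_algebra generatorsA] by blast

lemma delta_ID: "b \<in> arcs D \<Longrightarrow> delta b \<in> ID"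
  unfolding ID_def using ring.genideal_self[OF D.ring_path_algebra generatorsD] by blast

lemma IA_minimal: "ideal J (path_algebra A) \<Longrightarrow> (\<And>a. a \<in> arcs A \<Longrightarrow> rho a \<in> J) \<Longrightarrow> IA \<subseteq> J"
  unfolding IA_def by (rule ring.genideal_minimal[OF A.ring_path_algebra]) auto

lemma ID_minimal: "ideal J (path_algebra D) \<Longrightarrow> (\<And>b. b \<in> arcs D \<Longrightarrow> delta b \<in> J) \<Longrightarrow> ID \<subseteq> J"
  unfolding ID_def by (rule ring.genideal_minimal[OF D.ring_path_algebra]) auto

subsection \<open>Invariance of the ideal of type A\<close>

lemma closed_act: "c \<in> closed_3_walks A \<Longrightarrow> map (act_arr g) c \<in> closed_3_walks A"
  unfolding closed_3_walks_def using act_walk by (simp del: split_paired_Ex) blast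

lemma map_act_inverse:
  assumes "set c \<subseteq> arcs A" "g + h = 0"
  shows "map (act_arr g) (map (act_arr h) c) = c"
proof -
  have "map (act_arr 0) c = c" using assms(1) by (intro map_idI) (auto simp: act_arr_0)
  then show ?thesis by (simp add: act_arr_comp assms(2))
qed

lemma closed_arcs: "c \<in> closed_3_walks A \<Longrightarrow> set c \<subseteq> arcs A"
  by (auto simp: closed_3_walks_def A.awalk_def)

lemma lamA_act:
  assumes "c \<in> closed_3_walks A"
  shows "lamA (map (act_arr g) c) = lamA c"
proof -
  obtain a b d where abd: "c = [a, b, d]" using assms by (rule A.closed_3E)
  obtain v l w m z n where vs: "a = (v, l)" "b = (w, m)" "d = (z, n)" by (cases a, cases b, cases d)
  have Ix: "l mod 3 = l" "m mod 3 = m" "n mod 3 = n"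
    using closed_arcs[OF assms] by (simp_all add: abd vs quiverA_simps Ix_mod)
  have "lamA (map (act_arr g) c) = index_sign ((l + - g) mod 3, (m + - g) mod 3, (n + - g) mod 3)"
    by (simp add: abd vs act_arr_pair)
  also have "\<dots> = index_sign (n mod 3, l mod 3, m mod 3)" by (rule index_sign_shift)
  also have "\<dots> = index_sign (l mod 3, m mod 3, n mod 3)" using index_sign_shift[of l 0 m n] by simp
  finally show ?thesis by (simp add: abd vs Ix)
qed

lemma act_rho:
  assumes a: "a \<in> arcs A"
  shows "act_path_algebra g (rho a) = rho (act_arr g a)"
proof -
  let ?S = "\<lambda>a. {c. c \<in> closed_3_walks A \<and> hd c = a}"
  have hd: "hd (map (act_arr h) c) = act_arr h (hd c)" if "c \<in> closed_3_walks A" for c h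
    using A.closed_3_length[OF that] by (cases c) simp_all
  have bij: "bij_betw (map (act_arr g)) (?S a) (?S (act_arr g a))"
  proof (rule bij_betwI[where g = "map (act_arr (- g))"])
    have "act_arr (- g) (act_arr g a) = a" using act_arr_0[OF a] by (simp add: act_arr_add)
    then show "map (act_arr (- g)) \<in> ?S (act_arr g a) \<rightarrow> ?S a" using closed_act hd by auto
    show "map (act_arr g) \<in> ?S a \<rightarrow> ?S (act_arr g a)" using closed_act hd by auto
    show "map (act_arr (- g)) (map (act_arr g) c) = c" if "c \<in> ?S a" for c
      using that closed_arcs by (intro map_act_inverse) auto
    show "map (act_arr g) (map (act_arr (- g)) c) = c" if "c \<in> ?S (act_arr g a)" for c
      using that closed_arcs by (intro map_act_inverse) auto
  qed
  have head: "head A (act_arr g a) = omega_pow g (head A a)" using act_arr_arcs[OF a] by blast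
  have "rho (act_arr g a) = (\<Sum>c\<in>?S a. Poly_Mapping.single (head A (act_arr g a), tl (map (act_arr g) c)) (lamA (map (act_arr g) c)))"
    unfolding deriv_A by (rule sum.reindex_bij_betw[OF bij, symmetric])
  also have "\<dots> = (\<Sum>c\<in>?S a. act_path_algebra g (Poly_Mapping.single (head A a, tl c) (lamA c)))"
    by (intro sum.cong refl) (simp add: act_single act_path_pair head lamA_act map_tl)
  also have "\<dots> = act_path_algebra g (rho a)"
    unfolding deriv_A by (rule lin_sum[OF lin_act, symmetric])
  finally show ?thesis by simp
qed

text \<open>The elements that a rotation carries into the ideal form an ideal, and it contains the
  generators because they are permuted.\<close>
lemma IA_act:
  assumes "x \<in> IA"
  shows "act_path_algebra g x \<in> IA"
proof -
  let ?J = "{x \<in> supported (paths A). act_path_algebra g x \<in> IA}"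
  have "ideal ?J (path_algebra A)"
  proof (rule A.ideal_path_algebraI)
    show "?J \<subseteq> supported (paths A)" by blast
    show "subspace ?J"
      using subspace_supported[of "paths A"] IA.subspace_ideal
      by (simp add: subspace_def lin_zero[OF lin_act] lin_add[OF lin_act] lin_scale[OF lin_act])
    show "pmult A x a \<in> ?J" if "a \<in> ?J" "x \<in> supported (paths A)" for a x
      using that A.pmult_closed act_closed IA.ideal_left by (simp add: act_pmult)
    show "pmult A a x \<in> ?J" if "a \<in> ?J" "x \<in> supported (paths A)" for a x
      using that A.pmult_closed act_closed IA.ideal_right by (simp add: act_pmult)
  qed
  moreover have "rho a \<in> ?J" if "a \<in> arcs A" for a
    using that act_arr_arcs[OF that] by (simp add: deriv_A_closed act_rho rho_IA)
  ultimately show ?thesis using IA_minimal assms by blast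
qed

subsection \<open>The functor maps the ideal of type A into the ideal of type D\<close>

text \<open>Products in type D see only the orbits of the ends of a path. Recording the ends of the
  relations makes it possible to decide which products with paths vanish.\<close>
definition between :: "triple \<Rightarrow> triple \<Rightarrow> (triple, arrA) path set" where
  "between w v = {r \<in> paths A. fst r = w \<and> path_end A r = v}"

lemma rho_between:
  assumes "a \<in> arcs A"
  shows "rho a \<in> supported (between (head A a) (tail A a))"
  unfolding deriv_A
proof (rule subspace_sum[OF subspace_supported])
  fix c assume c: "c \<in> {c. c \<in> closed_3_walks A \<and> hd c = a}"
  then obtain b d where bd: "c = [a, b, d]" by (metis (mono_tags, lifting) A.closed_3E list.sel(1) mem_Collect_eq)
  have "a \<in> arcs A" "b \<in> arcs A" "d \<in> arcs A" "head A a = tail A b" "head A b = tail A d" "head A d = tail A a"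
    using c unfolding bd mem_Collect_eq A.closed_3_iff by blast+
  then have "(head A a, tl c) \<in> between (head A a) (tail A a)"
    by (simp add: bd between_def A.path_Cons A.tail_in)
  then show "Poly_Mapping.single (head A a, tl c) (lamA c) \<in> supported (between (head A a) (tail A a))"
    by (simp add: supported_def)
qed

lemma NN_concat:
  assumes "(v, p) \<in> paths A" "path_end A (v, p) = w" "(w, q) \<in> paths A"
  shows "pmult D (NN 0 v p) (NN g w q) = NN g v (p @ q)"
proof -
  have "map (act_arr 0) q = q"
    using assms(3) by (intro map_idI) (auto simp: paths_def A.awalk_def act_arr_0)
  then show ?thesis using NN_append[OF assms(1) _ assms(3), of 0 g] assms(2) by simp
qed

lemma Ng_tau_left:
  assumes "y \<in> supported (between w v)"
  shows "pmult D (tau h w) (Ng g y) = Ng (h + g) (act_path_algebra h y)"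
proof (rule lin_eq_on[where F = "\<lambda>y. pmult D (tau h w) (Ng g y)" and G = "\<lambda>y. Ng (h + g) (act_path_algebra h y)" and a = y])
  fix r assume "r \<in> Poly_Mapping.keys y"
  then have "r \<in> between w v" using assms by (auto simp: supported_def)
  then obtain p where "r = (w, p)" "(w, p) \<in> paths A" by (cases r) (auto simp: between_def)
  then show "pmult D (tau h w) (Ng g (basis r)) = Ng (h + g) (act_path_algebra h (basis r))"
    using NN_equivariant[of w p h g] by (simp add: act_path_pair)
qed (intro lin_intros)+

lemma Ng_tau_right:
  assumes "y \<in> supported (between w v)"
  shows "pmult D (Ng g y) (tau h v) = Ng (g + h) y"
proof (rule lin_eq_on[where F = "\<lambda>y. pmult D (Ng g y) (tau h v)" and G = "Ng (g + h)" and a = y])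
  fix r assume "r \<in> Poly_Mapping.keys y"
  then have "r \<in> between w v" using assms by (auto simp: supported_def)
  then obtain p where "r = (w, p)" "(w, p) \<in> paths A" "path_end A (w, p) = v" by (cases r) (auto simp: between_def)
  then show "pmult D (Ng g (basis r)) (tau h v) = Ng (g + h) (basis r)"
    using NN_tau_right[of w p g h] by simp
qed (intro lin_intros lin_Ng)+

text \<open>Products that vanish in type A have to be treated separately, see \<open>NN_append\<close>; for the
  others the map is multiplicative.\<close>
lemma Ng_sandwich:
  assumes y: "y \<in> supported (between w v)" and p: "p \<in> paths A" and q: "q \<in> paths A"
  shows "Ng g (pmult A (pmult A (basis p) y) (basis q))
    = (if path_end A p = w \<and> v = fst q then pmult D (Ng 0 (basis p)) (pmult D (Ng 0 y) (Ng g (basis q))) else 0)"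
proof (rule lin_eq_on[where F = "\<lambda>y. Ng g (pmult A (pmult A (basis p) y) (basis q))" and a = y
      and G = "\<lambda>y. if path_end A p = w \<and> v = fst q then pmult D (Ng 0 (basis p)) (pmult D (Ng 0 y) (Ng g (basis q))) else 0"])
  show "lin (\<lambda>y. if path_end A p = w \<and> v = fst q then pmult D (Ng 0 (basis p)) (pmult D (Ng 0 y) (Ng g (basis q))) else 0)"
  proof (cases "path_end A p = w \<and> v = fst q")
    case True
    show ?thesis unfolding if_P[OF True] by (intro lin_intros)
  next
    case False
    show ?thesis unfolding if_not_P[OF False] by (rule lin_const_zero)
  qed
  fix r assume "r \<in> Poly_Mapping.keys y"
  then have "r \<in> between w v" using y by (auto simp: supported_def)
  then obtain R where r: "r = (w, R)" "(w, R) \<in> paths A" "path_end A (w, R) = v" by (cases r) (auto simp: between_def)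
  obtain u P where P: "p = (u, P)" "(u, P) \<in> paths A" using p by (cases p) simp
  obtain z T where T: "q = (z, T)" "(z, T) \<in> paths A" using q by (cases q) simp
  show "Ng g (pmult A (pmult A (basis p) (basis r)) (basis q))
    = (if path_end A p = w \<and> v = fst q then pmult D (Ng 0 (basis p)) (pmult D (Ng 0 (basis r)) (Ng g (basis q))) else 0)"
  proof (cases "path_end A p = w")
    case True
    have PR: "path_end A (u, P @ R) = v" using path_end_append[of A u P r] True r(1,3) P(1) by simp
    show ?thesis
    proof (cases "v = z")
      case vz: True
      have RT: "(w, R @ T) \<in> paths A" using A.path_append[OF r(2) T(2)] r(3) vz by simp
      show ?thesis
        using True PR vz NN_concat[OF P(2) _ RT, of g] NN_concat[OF r(2) r(3) T(2)[folded vz], of g]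
        by (simp add: P(1) T(1) r(1) pmult_single_single)
    next
      case False
      then show ?thesis using True PR by (simp add: P(1) T(1) r(1) pmult_single_single lin_zero[OF lin_Ng])
    qed
  next
    case False
    then show ?thesis by (simp add: P(1) T(1) r(1) pmult_single_single lin_zero[OF lin_Ng])
  qed
qed (intro lin_intros)

text \<open>Rotating a relation multiplies its image by elements \<open>tau\<close> on both sides, hence one relation
  from each orbit is enough.\<close>
lemma Ng_rho_act:
  assumes a: "a \<in> arcs A" and mem: "Ng 0 (rho a) \<in> ID"
  shows "Ng 0 (rho (act_arr h a)) \<in> ID"
proof -
  let ?w = "head A a" and ?v = "tail A a"
  have s: "?w \<in> simplex s" "?v \<in> simplex s"
    using A.head_in[OF a] A.tail_in[OF a] by (simp_all add: quiverA_simps(1))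
  have "Ng 0 (rho (act_arr h a)) = pmult D (tau h ?w) (Ng (- h) (rho a))"
    using Ng_tau_left[OF rho_between[OF a], of h "- h"] by (simp add: act_rho[OF a])
  also have "Ng (- h) (rho a) = pmult D (Ng 0 (rho a)) (tau (- h) ?v)"
    using Ng_tau_right[OF rho_between[OF a], of 0 "- h"] by simp
  also have "pmult D (tau h ?w) (pmult D (Ng 0 (rho a)) (tau (- h) ?v)) \<in> ID"
    using mem s tau_closed by (intro ID.ideal_left ID.ideal_right)
  finally show ?thesis .
qed

text \<open>Each arrow is rotated to the position for which the image of its relation is known. At the
  fixed point the image is the sum of its three components at the copies.\<close>
lemma Ng_rho_ID:
  assumes "a \<in> arcs A"
  shows "Ng 0 (rho a) \<in> ID"
proof -
  obtain v l where a: "a = (v, l)" by (cases a)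
  have arc: "(v, l) \<in> arcs A" using assms by (simp add: a)
  have l: "l \<in> Ix" using arc by (simp add: quiverA_simps)
  have "\<exists>h a0. a0 \<in> arcs A \<and> a = act_arr h a0 \<and> Ng 0 (rho a0) \<in> ID"
    using arc
  proof (cases rule: arc_cases)
    case off
    define h where "h = level (v + fvec l)"
    define a0 where "a0 = act_arr (- h) (v, l)"
    have a0: "a0 \<in> arcs A" using act_arr_arcs[OF arc] by (simp only: a0_def)
    have undo: "a = act_arr h a0" using act_arr_0[OF arc] by (simp add: a0_def act_arr_add a)
    have pair: "a0 = (omega_pow (- h) v, (l + h) mod 3)" by (simp add: a0_def act_arr_pair)
    have head: "omega_pow (- h) v + fvec ((l + h) mod 3) = rep (v + fvec l)"
      using act_head[of "- h" v l] by (simp add: rep_def h_def)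
    have off0: "omega (omega_pow (- h) v) \<noteq> omega_pow (- h) v"
      "omega (omega_pow (- h) v + fvec ((l + h) mod 3)) \<noteq> omega_pow (- h) v + fvec ((l + h) mod 3)"
      "level (omega_pow (- h) v + fvec ((l + h) mod 3)) = 0"
      unfolding head using off by (simp_all add: fixed_rep level_rep)
    have "Ng 0 (rho a0) = delta (twist a0)"
      using relation_Alpha[OF a0[unfolded pair] off0] by (simp only: pair)
    moreover have "twist a0 \<in> arcs D"
      using twist_arc[OF a0[unfolded pair] off0(1,2)] by (simp only: pair)
    ultimately have "Ng 0 (rho a0) \<in> ID" by (simp add: delta_ID)
    then show ?thesis using a0 undo by blast
  next
    case out
    have X2: "(X, 2) \<in> arcs A" using arc_X[OF out(1), of 2] by simp
    have mem: "pmult D (Ng 0 (rho (X, 2))) (basis (Copy k, [])) \<in> ID" if "k \<in> Ix" for k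
      using that out(1) by (simp add: relation_Gamma delta_ID nonAlpha_arc)
    have "Ng 0 (rho (X, 2)) = pmult D (Ng 0 (rho (X, 2))) (tau 0 X)"
      using Ng_tau_right[OF rho_between[OF X2], of 0 0] by (simp add: quiverA_simps(2))
    also have "\<dots> = (\<Sum>k\<in>Ix. pmult D (Ng 0 (rho (X, 2))) (basis (Copy k, [])))"
      by (simp add: tau_fixed pmult_sum_right)
    also have "\<dots> \<in> ID" using mem by (intro subspace_sum ID.subspace_ideal)
    finally have "Ng 0 (rho (X, 2)) \<in> ID" .
    moreover have "a = act_arr (2 - l) (X, 2)"
      using l by (simp add: a out(2) act_arr_pair omega_pow_fixed Ix_mod)
    ultimately show ?thesis using X2 by blast
  next
    case into
    have mem: "pmult D (basis (Copy k, [])) (Ng 0 (rho (Y, 0))) \<in> ID" if "k \<in> Ix" for k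
      using that into(1) by (simp add: relation_Beta delta_ID nonAlpha_arc)
    have Y0: "(Y, 0) \<in> arcs A" by (rule arc_Y[OF into(1)])
    have "Ng 0 (rho (Y, 0)) = pmult D (tau 0 X) (Ng 0 (rho (Y, 0)))"
      using Ng_tau_left[OF rho_between[OF Y0], of 0 0] act_zero[OF deriv_A_closed, of "(Y, 0)"]
      by (simp add: quiverA_simps(2,3))
    also have "\<dots> = (\<Sum>k\<in>Ix. pmult D (basis (Copy k, [])) (Ng 0 (rho (Y, 0))))"
      by (simp add: tau_fixed pmult_sum_left)
    also have "\<dots> \<in> ID" using mem by (intro subspace_sum ID.subspace_ideal)
    finally have "Ng 0 (rho (Y, 0)) \<in> ID" .
    moreover have "a = act_arr (- l) (Y, 0)"
      using l into_X(1)[OF into(1,2)] by (simp only: a act_arr_pair) (simp add: Ix_mod)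
    ultimately show ?thesis using Y0 by blast
  qed
  then obtain h a0 where "a0 \<in> arcs A" "a = act_arr h a0" "Ng 0 (rho a0) \<in> ID" by blast
  then show ?thesis using Ng_rho_act[of a0 h] by (simp only:)
qed

text \<open>Paths of type A that are not composable may have composable images, so the preimage of an
  ideal need not be an ideal; closing under multiplication by paths on both sides repairs this.\<close>
definition pullback :: "((triple, arrA) path \<Rightarrow>\<^sub>0 complex) set" where
  "pullback = {a \<in> supported (paths A). \<forall>p\<in>paths A. \<forall>q\<in>paths A. \<forall>g.
     Ng g (pmult A (pmult A (basis p) a) (basis q)) \<in> ID}"

lemma IA_pullback: "IA \<subseteq> pullback"
proof (rule IA_minimal)
  show "ideal pullback (path_algebra A)"
  proof (rule A.ideal_path_algebraI)
    show "pullback \<subseteq> supported (paths A)" by (auto simp: pullback_def)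
    show "subspace pullback"
      using subspace_supported[of "paths A"] ID.subspace_ideal
      by (simp add: subspace_def pullback_def pmult_add_left pmult_add_right pmult_scale_left pmult_scale_right
          lin_zero[OF lin_Ng] lin_add[OF lin_Ng] lin_scale[OF lin_Ng])
  next
    fix a x assume a: "a \<in> pullback" and x: "x \<in> supported (paths A)"
    have as: "a \<in> supported (paths A)" using a by (simp add: pullback_def)
    have mem: "Ng g (pmult A (pmult A (basis p) a) (basis q)) \<in> ID" if "p \<in> paths A" "q \<in> paths A" for p q g
      using a that by (simp add: pullback_def)
    have path: "(fst p, snd p @ snd r) \<in> paths A" if "p \<in> paths A" "r \<in> paths A" "path_end A p = fst r" for p r
      using A.path_append that by blast
    show "pmult A x a \<in> pullback"
      unfolding pullback_def
    proof (intro CollectI conjI ballI allI)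
      show "pmult A x a \<in> supported (paths A)" using x as by (rule A.pmult_closed)
      fix p q g assume p: "p \<in> paths A" and q: "q \<in> paths A"
      show "Ng g (pmult A (pmult A (basis p) (pmult A x a)) (basis q)) \<in> ID"
      proof (rule lin_mem[where F = "\<lambda>x. Ng g (pmult A (pmult A (basis p) (pmult A x a)) (basis q))" and a = x])
        fix r assume "r \<in> Poly_Mapping.keys x"
        then have r: "r \<in> paths A" using x by (auto simp: supported_def)
        have "pmult A (basis p) (pmult A (basis r) a) = pmult A (pconcat A p r) a"
          by (simp only: pmult_assoc[symmetric] pmult_basis)
        then show "Ng g (pmult A (pmult A (basis p) (pmult A (basis r) a)) (basis q)) \<in> ID"
          using mem[OF path[OF p r] q, of g] ID.subspace_ideal
          by (auto simp: pconcat_def lin_zero[OF lin_Ng] subspace_def)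
      qed (intro lin_intros ID.subspace_ideal)+
    qed
    show "pmult A a x \<in> pullback"
      unfolding pullback_def
    proof (intro CollectI conjI ballI allI)
      show "pmult A a x \<in> supported (paths A)" using as x by (rule A.pmult_closed)
      fix p q g assume p: "p \<in> paths A" and q: "q \<in> paths A"
      show "Ng g (pmult A (pmult A (basis p) (pmult A a x)) (basis q)) \<in> ID"
      proof (rule lin_mem[where F = "\<lambda>x. Ng g (pmult A (pmult A (basis p) (pmult A a x)) (basis q))" and a = x])
        fix r assume "r \<in> Poly_Mapping.keys x"
        then have r: "r \<in> paths A" using x by (auto simp: supported_def)
        have "pmult A (pmult A (basis p) (pmult A a (basis r))) (basis q) = pmult A (pmult A (basis p) a) (pconcat A r q)"
          by (simp only: pmult_assoc pmult_basis)
        then show "Ng g (pmult A (pmult A (basis p) (pmult A a (basis r))) (basis q)) \<in> ID"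
          using mem[OF p path[OF r q], of g] ID.subspace_ideal
          by (auto simp: pconcat_def lin_zero[OF lin_Ng] subspace_def)
      qed (intro lin_intros ID.subspace_ideal)+
    qed
  qed
next
  fix a assume a: "a \<in> arcs A"
  have "Ng g (pmult A (pmult A (basis p) (rho a)) (basis q)) \<in> ID" if p: "p \<in> paths A" and q: "q \<in> paths A" for p q g
  proof (cases "path_end A p = head A a \<and> tail A a = fst q")
    case True
    have "Ng 0 (basis p) \<in> supported (paths D)" "Ng g (basis q) \<in> supported (paths D)"
      using p q by (simp_all add: Ng_closed)
    then have "pmult D (Ng 0 (basis p)) (pmult D (Ng 0 (rho a)) (Ng g (basis q))) \<in> ID"
      using Ng_rho_ID[OF a] by (intro ID.ideal_left ID.ideal_right)
    then show ?thesis using Ng_sandwich[OF rho_between[OF a] p q, of g] True by (simp only: if_True simp_thms)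
  next
    case False
    then have "Ng g (pmult A (pmult A (basis p) (rho a)) (basis q)) = 0"
      using Ng_sandwich[OF rho_between[OF a] p q, of g] by (simp only: if_False)
    then show ?thesis using ID.subspace_ideal by (simp add: subspace_def)
  qed
  then show "rho a \<in> pullback" using deriv_A_closed by (simp add: pullback_def)
qed

text \<open>Sandwiching by trivial paths recovers an element from the condition in \<open>pullback\<close>.\<close>
lemma Ng_IA:
  assumes "a \<in> IA"
  shows "Ng g a \<in> ID"
proof -
  have a: "a \<in> supported (paths A)" using assms IA.ideal_subset by blast
  have "a = pmult A (pmult A A.unit a) A.unit" using a by (simp add: A.unit_left A.unit_right)
  also have "\<dots> = (\<Sum>w\<in>verts A. \<Sum>v\<in>verts A. pmult A (pmult A (basis (v, [])) a) (basis (w, [])))"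
    by (simp only: pmult_sum_left pmult_sum_right)
  finally have "Ng g a = (\<Sum>w\<in>verts A. \<Sum>v\<in>verts A. Ng g (pmult A (pmult A (basis (v, [])) a) (basis (w, []))))"
    by (metis (no_types, lifting) lin_sum[OF lin_Ng] sum.cong)
  moreover have "Ng g (pmult A (pmult A (basis (v, [])) a) (basis (w, []))) \<in> ID" if "v \<in> verts A" "w \<in> verts A" for v w
    using IA_pullback assms that by (auto simp: pullback_def simp del: split_paired_All split_paired_Ex)
  ultimately show ?thesis by (simp add: subspace_sum ID.subspace_ideal)
qed

end

section \<open>The isomorphism\<close>

context covering
begin

lemma Theta_corner:
  assumes "a \<in> supported (paths D)"
  shows "corner_element (\<lambda>g. Theta g a)" "Psi (\<lambda>g. Theta g a) = a"
proof -
  obtain u where u: "corner_element u" "a = Psi u" using assms by (rule Psi_surj)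
  have eq: "Theta g a = u g" if "g \<in> Ix" for g using Theta_Psi[OF u(1) that] u(2) by simp
  show "corner_element (\<lambda>g. Theta g a)" using u(1) eq by (simp add: corner_element_def)
  show "Psi (\<lambda>g. Theta g a) = a" unfolding u(2) Psi_def using eq[unfolded u(2) Psi_def] by (intro sum.cong refl) simp
qed

lemma Theta_closed: "a \<in> supported (paths D) \<Longrightarrow> g \<in> Ix \<Longrightarrow> Theta g a \<in> supported (paths A)"
  using Theta_corner(1) KP_paths by (auto simp: corner_element_def)

text \<open>\<open>Theta\<close> is a two-sided inverse of \<open>Psi\<close>, hence multiplicative because \<open>Psi\<close> is.\<close>
lemma Theta_pmult:
  assumes "a \<in> supported (paths D)" "b \<in> supported (paths D)" "g \<in> Ix"
  shows "Theta g (pmult D a b) = star (\<lambda>g. Theta g a) (\<lambda>g. Theta g b) g"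
proof -
  note a = Theta_corner[OF assms(1)] and b = Theta_corner[OF assms(2)]
  have "pmult D a b = Psi (star (\<lambda>g. Theta g a) (\<lambda>g. Theta g b))"
    by (simp only: Psi_star[OF a(1) b(1)] a(2) b(2))
  then show ?thesis using Theta_Psi[OF corner_element_star[OF a(1) b(1)] assms(3)] by simp
qed

lemma star_IA_left:
  assumes "\<And>k. k \<in> Ix \<Longrightarrow> u k \<in> supported (paths A)" "\<And>k. k \<in> Ix \<Longrightarrow> v k \<in> IA"
  shows "star u v g \<in> IA"
  unfolding star_def
  by (intro subspace_sum IA.subspace_ideal IA.ideal_left IA_act assms mod3_Ix)

lemma star_IA_right:
  assumes "\<And>k. k \<in> Ix \<Longrightarrow> u k \<in> IA" "\<And>k. k \<in> Ix \<Longrightarrow> v k \<in> supported (paths A)"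
  shows "star u v g \<in> IA"
  unfolding star_def
  by (intro subspace_sum IA.subspace_ideal IA.ideal_right act_closed assms mod3_Ix)

lemma rho_KP:
  assumes "a \<in> arcs A" "level (head A a) = 0" "level (omega_pow (- g) (tail A a)) = 0"
  shows "rho a \<in> supported (KP g)"
proof -
  have "between (head A a) (tail A a) \<subseteq> KP g" using assms(2,3) by (auto simp: between_def KP_def)
  then show ?thesis using rho_between[OF assms(1)] by (auto simp: supported_def)
qed

lemma Theta_rho:
  assumes "a \<in> arcs A" "rho a \<in> supported (KP g)"
  shows "Theta k (Ng g (rho a)) \<in> IA"
  using assms rho_IA IA.subspace_ideal by (simp add: Theta_Ng subspace_def)

text \<open>The relations of type D are images of elements of degree \<open>j\<close> or 0 of the corner, and on
  images \<open>Theta\<close> returns these elements.\<close>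
lemma Theta_delta:
  assumes "b \<in> arcs D" "g \<in> Ix"
  shows "Theta g (delta b) \<in> IA"
proof (cases b)
  case (Alpha x i j)
  define v where "v = omega_pow j x"
  have b: "x \<in> simplex s" "dominant x" "i \<in> Ix" "j \<in> Ix" "dominant (v + fvec i)"
    using assms(1) by (simp_all add: Alpha Alpha_arc v_def)
  have x: "omega x \<noteq> x" "level x = 0" "rep x = x"
    using b(2) not_dominant_fixed level_dominant rep_level_0 by blast+
  have v: "v \<in> simplex s" "omega v \<noteq> v" "rep v = x" "level v = j"
    using b x by (simp_all add: v_def omega_pow_simplex level_omega_pow Ix_mod)
  have l: "(i + j - level v) mod 3 = i" using b(3) by (simp add: v(4) Ix_mod)
  note lift = lift_arrow[OF v(1,2), of i j, unfolded v(3) l, OF assms(1)[unfolded Alpha]]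
  have level: "level (v + fvec i) = 0" using b(5) by (rule level_dominant)
  \<comment> \<open>The tail of the lifted arrow is the \<open>j\<close>-th rotation of \<open>x\<close>, so its relation has degree \<open>j\<close>. The
    end of the relation is off the fixed point, where \<open>tau\<close> does not depend on the degree.\<close>
  have KP: "rho (v, i) \<in> supported (KP j)"
    using lift(1) level by (intro rho_KP) (simp_all add: quiverA_simps(2,3) v_def x(2))
  have "delta b = Ng 0 (rho (v, i))"
    using relation_Alpha[OF lift(1) v(2) lift(2) level] lift(5) by (simp only: Alpha)
  also have "\<dots> = pmult D (Ng 0 (rho (v, i))) (tau 0 v)"
    using Ng_tau_right[OF rho_between[OF lift(1)], of 0 0] by (simp add: quiverA_simps(2))
  also have "tau 0 v = tau j v" using v(2) by (simp add: tau_off)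
  also have "pmult D (Ng 0 (rho (v, i))) (tau j v) = Ng j (rho (v, i))"
    using Ng_tau_right[OF rho_between[OF lift(1)], of 0 j] by (simp add: quiverA_simps(2))
  finally show ?thesis using Theta_rho[OF lift(1) KP] by simp
next
  case (Beta k)
  then have k: "k \<in> Ix" and s: "s mod 3 = 1" using assms(1) by (simp_all add: nonAlpha_arc)
  have Y0: "(Y, 0) \<in> arcs A" by (rule arc_Y[OF s])
  have KP: "rho (Y, 0) \<in> supported (KP 0)"
    using Y0 neighbours_X(4)[OF s] by (intro rho_KP) (simp_all add: quiverA_simps(2,3) level_fixed level_dominant)
  have e: "basis (Copy k, []) \<in> supported (paths D)" using k s by (simp add: quiverD_simps)
  have n: "Ng 0 (rho (Y, 0)) \<in> supported (paths D)" by (rule Ng_closed[OF deriv_A_closed])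
  have "Theta g (delta b) = star (\<lambda>g. Theta g (basis (Copy k, []))) (\<lambda>g. Theta g (Ng 0 (rho (Y, 0)))) g"
    unfolding Beta relation_Beta[OF s k, symmetric] by (rule Theta_pmult[OF e n assms(2)])
  then show ?thesis
    using Theta_rho[OF Y0 KP] Theta_closed[OF e] by (simp add: star_IA_left)
next
  case (Gamma k)
  then have k: "k \<in> Ix" and s: "s mod 3 = 1" using assms(1) by (simp_all add: nonAlpha_arc)
  have X2: "(X, 2) \<in> arcs A" using arc_X[OF s, of 2] by simp
  have KP: "rho (X, 2) \<in> supported (KP 0)"
    using X2 neighbours_X(5)[OF s] by (intro rho_KP) (simp_all add: quiverA_simps(2,3) level_fixed level_dominant)
  have e: "basis (Copy k, []) \<in> supported (paths D)" using k s by (simp add: quiverD_simps)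
  have n: "Ng 0 (rho (X, 2)) \<in> supported (paths D)" by (rule Ng_closed[OF deriv_A_closed])
  have "Theta g (delta b) = star (\<lambda>g. Theta g (Ng 0 (rho (X, 2)))) (\<lambda>g. Theta g (basis (Copy k, []))) g"
    unfolding Gamma relation_Gamma[OF s k, symmetric] by (rule Theta_pmult[OF n e assms(2)])
  then show ?thesis
    using Theta_rho[OF X2 KP] Theta_closed[OF e] by (simp add: star_IA_right)
qed

lemma Theta_ID:
  assumes "b \<in> ID" "g \<in> Ix"
  shows "Theta g b \<in> IA"
proof -
  let ?J = "{b \<in> supported (paths D). \<forall>g\<in>Ix. Theta g b \<in> IA}"
  have "ideal ?J (path_algebra D)"
  proof (rule D.ideal_path_algebraI)
    show "?J \<subseteq> supported (paths D)" by blast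
    show "subspace ?J"
      using subspace_supported[of "paths D"] IA.subspace_ideal
      by (simp add: subspace_def lin_zero[OF lin_Theta] lin_add[OF lin_Theta] lin_scale[OF lin_Theta])
    show "pmult D x a \<in> ?J" if "a \<in> ?J" "x \<in> supported (paths D)" for a x
      using that Theta_closed by (simp add: D.pmult_closed Theta_pmult star_IA_left)
    show "pmult D a x \<in> ?J" if "a \<in> ?J" "x \<in> supported (paths D)" for a x
      using that Theta_closed by (simp add: D.pmult_closed Theta_pmult star_IA_right)
  qed
  then have "ID \<subseteq> ?J" using deriv_D_closed Theta_delta by (intro ID_minimal) auto
  then show ?thesis using assms by blast
qed

text \<open>One direction is \<open>Theta_ID\<close>; for the other, the element is the image under \<open>Psi\<close> of its
  components.\<close>
lemma ID_iff:
  assumes "a \<in> supported (paths D)"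
  shows "a \<in> ID \<longleftrightarrow> (\<forall>g\<in>Ix. Theta g a \<in> IA)"
proof
  assume *: "\<forall>g\<in>Ix. Theta g a \<in> IA"
  have "Psi (\<lambda>g. Theta g a) \<in> ID"
    unfolding Psi_def using * by (intro subspace_sum ID.subspace_ideal Ng_IA) blast
  then show "a \<in> ID" using Theta_corner(2)[OF assms] by simp
qed (use Theta_ID in blast)

text \<open>On the quotient, the group acts by taking images of cosets. That the image is a whole coset
  uses the inverse rotation.\<close>
lemma act_coset:
  assumes "b \<in> supported (paths A)"
  shows "act_path_algebra g ` IA.coset b = IA.coset (act_path_algebra g b)"
proof (intro equalityI subsetI)
  fix y assume "y \<in> act_path_algebra g ` IA.coset b"
  then obtain x where x: "x - b \<in> IA" "y = act_path_algebra g x" by (auto simp: IA.coset_mem)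
  then have "y - act_path_algebra g b = act_path_algebra g (x - b)" by (simp add: lin_diff[OF lin_act])
  then show "y \<in> IA.coset (act_path_algebra g b)" using IA_act[OF x(1)] by (simp add: IA.coset_mem)
next
  fix y assume "y \<in> IA.coset (act_path_algebra g b)"
  then have y: "y - act_path_algebra g b \<in> IA" by (simp add: IA.coset_mem)
  then have "(y - act_path_algebra g b) + act_path_algebra g b \<in> supported (paths A)"
    using act_closed[OF assms, of g] IA.ideal_subset subspace_supported[of "paths A"] unfolding subspace_def by blast
  then have ys: "y \<in> supported (paths A)" by simp
  have "act_path_algebra (- g) y - b = act_path_algebra (- g) (y - act_path_algebra g b)"
    using act_zero[OF assms] by (simp add: lin_diff[OF lin_act] act_act)
  then have "act_path_algebra (- g) y \<in> IA.coset b" using IA_act[OF y] by (simp add: IA.coset_mem)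
  moreover have "y = act_path_algebra g (act_path_algebra (- g) y)" using act_zero[OF ys] by (simp add: act_act)
  ultimately show "y \<in> act_path_algebra g ` IA.coset b" by (rule rev_image_eqI)
qed

abbreviation S where "S \<equiv> PiA_skew_Z3 s"

text \<open>Elements of the skew group algebra over the Jacobian algebra are families of cosets on
  \<open>{0, 1, 2}\<close>, undefined elsewhere. They are represented by families of elements of the path
  algebra.\<close>
definition cosets :: "(int \<Rightarrow> (triple, arrA) path \<Rightarrow>\<^sub>0 complex) \<Rightarrow> int \<Rightarrow> ((triple, arrA) path \<Rightarrow>\<^sub>0 complex) set" where
  "cosets u = (\<lambda>k\<in>Ix. IA.coset (u k))"

lemma PiA_eq: "PiA s = IA.quotient"
  by (simp add: PiA_def jacobian_algebra_def IA_def)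

lemma PiD_eq: "PiD s = ID.quotient"
  by (simp add: PiD_def jacobian_algebra_def ID_def)

lemma carrier_Z3: "carrier (integer_mod_group 3) = Ix"
  by (auto simp: carrier_integer_mod_group Ix_def)

lemma skew_carrier: "carrier S = Ix \<rightarrow>\<^sub>E carrier IA.quotient"
  by (simp add: PiA_skew_Z3_def skew_group_algebra_def carrier_Z3 PiA_eq)

lemma cosets_carrier: "(\<And>k. k \<in> Ix \<Longrightarrow> u k \<in> supported (paths A)) \<Longrightarrow> cosets u \<in> carrier S"
  by (simp add: skew_carrier cosets_def IA.quotient_carrier)

lemma carrier_cosets:
  assumes "w \<in> carrier S"
  shows "\<exists>u. (\<forall>k\<in>Ix. u k \<in> supported (paths A)) \<and> w = cosets u"
proof -
  have w: "w \<in> Ix \<rightarrow>\<^sub>E IA.coset ` supported (paths A)" using assms by (simp add: skew_carrier IA.quotient_carrier)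
  then have "\<forall>k\<in>Ix. \<exists>a. a \<in> supported (paths A) \<and> w k = IA.coset a" by (auto simp: PiE_iff)
  then obtain u where u: "\<forall>k\<in>Ix. u k \<in> supported (paths A) \<and> w k = IA.coset (u k)" by (metis bchoice)
  have "w = cosets u"
    by (rule PiE_ext[OF w]) (use u in \<open>auto simp: cosets_def\<close>)
  then show ?thesis using u by blast
qed

lemma skew_mult:
  assumes u: "\<And>k. k \<in> Ix \<Longrightarrow> u k \<in> supported (paths A)" and v: "\<And>k. k \<in> Ix \<Longrightarrow> v k \<in> supported (paths A)"
  shows "cosets u \<otimes>\<^bsub>S\<^esub> cosets v = cosets (star u v)"
proof -
  have "(\<Oplus>\<^bsub>IA.quotient\<^esub>g\<in>Ix. cosets u g \<otimes>\<^bsub>IA.quotient\<^esub>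
        act_path_algebra g ` cosets v (inv\<^bsub>integer_mod_group 3\<^esub> g \<otimes>\<^bsub>integer_mod_group 3\<^esub> k))
      = IA.coset (star u v k)" if k: "k \<in> Ix" for k
    unfolding star_def
  proof (rule IA.finsum_coset)
    fix g assume g: "g \<in> Ix"
    have idx: "inv\<^bsub>integer_mod_group 3\<^esub> g \<otimes>\<^bsub>integer_mod_group 3\<^esub> k = (k - g) mod 3"
      using g by (simp add: carrier_Z3 mod_add_left_eq)
    have vk: "v ((k - g) mod 3) \<in> supported (paths A)" by (intro v mod3_Ix)
    show "pmult A (u g) (act_path_algebra g (v ((k - g) mod 3))) \<in> supported (paths A)"
      by (intro A.pmult_closed act_closed vk u g)
    show "cosets u g \<otimes>\<^bsub>IA.quotient\<^esub> act_path_algebra g ` cosets v (inv\<^bsub>integer_mod_group 3\<^esub> g \<otimes>\<^bsub>integer_mod_group 3\<^esub> k)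
        = IA.coset (pmult A (u g) (act_path_algebra g (v ((k - g) mod 3))))"
      unfolding idx cosets_def restrict_apply'[OF g] restrict_apply'[OF mod3_Ix] act_coset[OF vk]
      by (rule IA.quotient_mult[OF u[OF g] act_closed[OF vk]])
  qed simp
  then show ?thesis
    unfolding PiA_skew_Z3_def PiA_eq skew_group_algebra_def
    by (simp add: carrier_Z3 cosets_def cong: restrict_cong)
qed

lemma skew_add:
  assumes "\<And>k. k \<in> Ix \<Longrightarrow> u k \<in> supported (paths A)" "\<And>k. k \<in> Ix \<Longrightarrow> v k \<in> supported (paths A)"
  shows "cosets u \<oplus>\<^bsub>S\<^esub> cosets v = cosets (\<lambda>k. u k + v k)"
  unfolding PiA_skew_Z3_def PiA_eq skew_group_algebra_def
  using assms by (simp add: carrier_Z3 cosets_def IA.quotient_add cong: restrict_cong)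

lemma skew_smult: "z \<odot>\<^bsub>S\<^esub> cosets u = cosets (\<lambda>k. scale z (u k))"
  unfolding PiA_skew_Z3_def PiA_eq skew_group_algebra_def
  by (simp add: carrier_Z3 cosets_def IA.quotient_smult cong: restrict_cong)

lemma cosets_cong: "(\<And>k. k \<in> Ix \<Longrightarrow> u k = v k) \<Longrightarrow> cosets u = cosets v"
  unfolding cosets_def by (rule restrict_ext) simp

lemma cosets_eq_iff: "cosets u = cosets v \<longleftrightarrow> (\<forall>k\<in>Ix. u k - v k \<in> IA)"
proof
  assume eq: "cosets u = cosets v"
  show "\<forall>k\<in>Ix. u k - v k \<in> IA"
  proof
    fix k assume "k \<in> Ix"
    then have "IA.coset (u k) = IA.coset (v k)"
      using fun_cong[OF eq, of k] unfolding cosets_def by (simp only: restrict_apply')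
    then show "u k - v k \<in> IA" by (rule iffD1[OF IA.coset_eq_iff])
  qed
next
  assume "\<forall>k\<in>Ix. u k - v k \<in> IA"
  then show "cosets u = cosets v"
    unfolding cosets_def by (intro restrict_ext iffD2[OF IA.coset_eq_iff]) blast
qed

text \<open>Multiplication by an element of the corner from the left forces paths to start at level 0,
  and multiplication from the right forces them to end at a rotation of such a vertex.\<close>
lemma corner_element_sandwich:
  assumes e: "corner_element e" and b: "\<And>k. k \<in> Ix \<Longrightarrow> b k \<in> supported (paths A)"
  shows "corner_element (star (star e b) e)"
proof -
  define U where "U = {p \<in> paths A. level (fst p) = 0}"
  have left: "pmult A x y \<in> supported U" if "x \<in> supported U" "y \<in> supported (paths A)" for x y
  proof (rule lin_mem[where F = "\<lambda>x. pmult A x y" and a = x])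
    fix p assume "p \<in> Poly_Mapping.keys x"
    then have p: "p \<in> U" using that by (auto simp: supported_def)
    show "pmult A (basis p) y \<in> supported U"
    proof (rule lin_mem[where F = "pmult A (basis p)" and a = y])
      fix q assume "q \<in> Poly_Mapping.keys y"
      then have "q \<in> paths A" using that by (auto simp: supported_def)
      then show "pmult A (basis p) (basis q) \<in> supported U"
        using p A.path_append[of p q] by (simp add: pmult_basis pconcat_def U_def zero_supported)
    qed (intro lin_intros subspace_supported)+
  qed (intro lin_intros subspace_supported)+
  have right: "pmult A x (act_path_algebra g y) \<in> supported (KP (g + h))"
    if "x \<in> supported U" "y \<in> supported (KP h)" for x y g h
  proof (rule lin_mem[where F = "\<lambda>x. pmult A x (act_path_algebra g y)" and a = x])
    fix p assume "p \<in> Poly_Mapping.keys x"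
    then have p: "p \<in> U" using that by (auto simp: supported_def)
    show "pmult A (basis p) (act_path_algebra g y) \<in> supported (KP (g + h))"
    proof (rule lin_mem[where F = "\<lambda>y. pmult A (basis p) (act_path_algebra g y)" and a = y])
      fix q assume "q \<in> Poly_Mapping.keys y"
      then have "q \<in> KP h" using that by (auto simp: supported_def)
      then have q: "q \<in> paths A" "level (omega_pow (- h) (path_end A q)) = 0" by (simp_all add: KP_def)
      let ?q = "act_path g q"
      have q': "?q \<in> paths A" "path_end A ?q = omega_pow g (path_end A q)" using act_path_in[OF q(1)] by blast+
      have "omega_pow (- (g + h)) (omega_pow g (path_end A q)) = omega_pow (- h) (path_end A q)"
        by (simp add: omega_pow_add)
      then have "(fst p, snd p @ snd ?q) \<in> KP (g + h)" if "path_end A p = fst ?q"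
        using A.path_append[of p ?q] path_end_append[of A "fst p" "snd p" ?q] that p q q'
        by (simp add: KP_def U_def)
      then show "pmult A (basis p) (act_path_algebra g (basis q)) \<in> supported (KP (g + h))"
        by (simp add: pmult_basis pconcat_def zero_supported)
    qed (intro lin_intros subspace_supported)+
  qed (intro lin_intros subspace_supported)+
  have e': "e k \<in> supported (KP k)" if "k \<in> Ix" for k using e that by (simp add: corner_element_def)
  have "supported (KP k) \<subseteq> supported U" for k by (auto simp: supported_def KP_def U_def)
  then have eb: "star e b k \<in> supported U" for k
    unfolding star_def using e' b mod3_Ix
    by (intro subspace_sum subspace_supported left act_closed) blast+
  have "pmult A (star e b g) (act_path_algebra g (e ((k - g) mod 3))) \<in> supported (KP k)" for g k
  proof -
    have "KP (g + (k - g) mod 3) = KP k"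
      using KP_mod[of "g + (k - g) mod 3"] KP_mod[of k] by (simp add: mod_add_right_eq)
    then show ?thesis using right[OF eb e'[OF mod3_Ix], of g g "k - g"] by simp
  qed
  then show ?thesis
    unfolding corner_element_def star_def[of "star e b" e] by (intro ballI subspace_sum subspace_supported)
qed

definition Phi :: "((vertD, arrD) path \<Rightarrow>\<^sub>0 complex) \<Rightarrow> int \<Rightarrow> ((triple, arrA) path \<Rightarrow>\<^sub>0 complex) set" where
  "Phi a = cosets (\<lambda>g. Theta g a)"

lemma Phi_mult:
  assumes "a \<in> supported (paths D)" "b \<in> supported (paths D)"
  shows "Phi (pmult D a b) = Phi a \<otimes>\<^bsub>S\<^esub> Phi b"
proof -
  have "Phi a \<otimes>\<^bsub>S\<^esub> Phi b = cosets (star (\<lambda>g. Theta g a) (\<lambda>g. Theta g b))"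
    unfolding Phi_def by (rule skew_mult) (simp_all add: Theta_closed assms)
  also have "\<dots> = Phi (pmult D a b)"
    unfolding Phi_def by (rule cosets_cong) (simp add: Theta_pmult[OF assms])
  finally show ?thesis by simp
qed

lemma Phi_carrier: "a \<in> supported (paths D) \<Longrightarrow> Phi a \<in> carrier S"
  unfolding Phi_def by (rule cosets_carrier) (rule Theta_closed)

text \<open>The idempotent is the class of the unit of the path algebra of type D, transported by
  \<open>Theta\<close>.\<close>
theorem PiD_iso_corner:
  "\<exists>\<eta>. idempotent_in S \<eta> \<and> algebra_iso (PiD s) (corner_algebra S \<eta>)"
proof (intro exI conjI)
  let ?e = "Phi D.unit"
  let ?B = "corner_algebra S ?e"
  note unit = D.unit_closed
  show "idempotent_in S ?e"
    using Phi_mult[OF unit unit] by (simp add: idempotent_in_def Phi_carrier[OF unit] D.unit_left[OF unit])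
  have B: "carrier ?B = {?e \<otimes>\<^bsub>S\<^esub> a \<otimes>\<^bsub>S\<^esub> ?e | a. a \<in> carrier S}" "monoid.mult ?B = monoid.mult S"
    "ring.add ?B = ring.add S" "smult ?B = smult S" "monoid.one ?B = ?e"
    by (simp_all add: corner_algebra_def)
  show "algebra_iso (PiD s) ?B"
    unfolding PiD_eq
  proof (rule ID.quotient_iso[where \<Phi> = Phi])
    show "Phi ` supported (paths D) = carrier ?B"
    proof (intro equalityI subsetI)
      fix w assume "w \<in> Phi ` supported (paths D)"
      then obtain a where a: "a \<in> supported (paths D)" "w = Phi a" by blast
      have "Phi a = Phi (pmult D (pmult D D.unit a) D.unit)"
        using a(1) by (simp add: D.unit_left D.unit_right)
      also have "\<dots> = ?e \<otimes>\<^bsub>S\<^esub> Phi a \<otimes>\<^bsub>S\<^esub> ?e"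
        using a(1) unit by (simp only: Phi_mult D.pmult_closed)
      finally show "w \<in> carrier ?B" unfolding B(1) a(2) using Phi_carrier[OF a(1)] by blast
    next
      fix w assume "w \<in> carrier ?B"
      then obtain a where a: "a \<in> carrier S" "w = ?e \<otimes>\<^bsub>S\<^esub> a \<otimes>\<^bsub>S\<^esub> ?e" unfolding B(1) by blast
      obtain b where b': "\<forall>k\<in>Ix. b k \<in> supported (paths A)" and ab: "a = cosets b"
        using carrier_cosets[OF a(1)] by blast
      have b: "\<And>k. k \<in> Ix \<Longrightarrow> b k \<in> supported (paths A)" using b' by blast
      let ?t = "\<lambda>g. Theta g D.unit"
      have t: "\<And>k. k \<in> Ix \<Longrightarrow> ?t k \<in> supported (paths A)" using Theta_closed[OF unit] by blast
      have "star ?t b k \<in> supported (paths A)" for k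
        unfolding star_def by (intro subspace_sum subspace_supported A.pmult_closed act_closed t b mod3_Ix)
      then have w: "w = cosets (star (star ?t b) ?t)"
        unfolding a(2) ab Phi_def by (simp add: skew_mult t b)
      \<comment> \<open>An arbitrary element between two idempotents comes from the corner of the path algebra,
        and \<open>Psi\<close> supplies a preimage.\<close>
      have corner: "corner_element (star (star ?t b) ?t)"
        using Theta_corner(1)[OF unit] b by (rule corner_element_sandwich)
      have "Phi (Psi (star (star ?t b) ?t)) = w"
        unfolding w Phi_def by (rule cosets_cong) (rule Theta_Psi[OF corner])
      moreover have "Psi (star (star ?t b) ?t) \<in> supported (paths D)"
        unfolding Psi_def using corner KP_paths
        by (intro subspace_sum subspace_supported Ng_closed) (auto simp: corner_element_def)
      ultimately show "w \<in> Phi ` supported (paths D)" by blast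
    qed
    fix a b :: "(vertD, arrD) path \<Rightarrow>\<^sub>0 complex"
    assume a: "a \<in> supported (paths D)"
    have "Phi (scale z a) = z \<odot>\<^bsub>S\<^esub> Phi a" for z
      unfolding Phi_def skew_smult by (rule cosets_cong) (rule lin_scale[OF lin_Theta])
    then show "Phi (scale z a) = z \<odot>\<^bsub>?B\<^esub> Phi a" for z by (simp only: B)
    assume b: "b \<in> supported (paths D)"
    show "Phi (pmult D a b) = Phi a \<otimes>\<^bsub>?B\<^esub> Phi b" unfolding B by (rule Phi_mult[OF a b])
    have "Phi a \<oplus>\<^bsub>S\<^esub> Phi b = cosets (\<lambda>k. Theta k a + Theta k b)"
      unfolding Phi_def by (rule skew_add) (simp_all add: Theta_closed a b)
    then show "Phi (a + b) = Phi a \<oplus>\<^bsub>?B\<^esub> Phi b"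
      unfolding B by (simp add: Phi_def lin_add[OF lin_Theta])
    have "scale (- 1) b \<in> supported (paths D)" using b subspace_supported[of "paths D"] by (simp add: subspace_def)
    then have "a - b \<in> supported (paths D)"
      using a subspace_supported[of "paths D"] unfolding subspace_def
      by (metis scale_minus_one add_uminus_conv_diff)
    then show "Phi a = Phi b \<longleftrightarrow> a - b \<in> ID"
      unfolding Phi_def cosets_eq_iff by (simp add: ID_iff lin_diff[OF lin_Theta])
  qed (simp add: B)
qed

end

section \<open>Equality of the quivers with potential\<close>

context covering
begin

lemma V1_A_iff: "x \<in> V1_A s \<longleftrightarrow> x \<in> simplex s \<and> dominant x"
  by (simp add: V1_A_def quiverA_simps(1) dominant_def)

text \<open>Rotating an arrow preserves the property of not meeting the fixed point, so the condition on
  the whole orbit reduces to its member with head in \<open>V1_A\<close>.\<close>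
lemma tilde_alphas_eq: "tilde_alphas s = Q1_D s"
proof (intro equalityI subsetI)
  fix b assume "b \<in> tilde_alphas s"
  then obtain x i j a where b: "b = Alpha x i j" and a: "a \<in> arcs A" "(omega_pow j x, i) \<in> arr_orbit a"
    and V: "head A (omega_pow j x, i) \<in> V1_A s" "x \<in> V1_A s" "j \<in> Ix"
    unfolding tilde_alphas_def by blast
  obtain g where "(omega_pow j x, i) = act_arr g a" using a(2) unfolding arr_orbit_def by blast
  then have "(omega_pow j x, i) \<in> arcs A" using act_arr_arcs[OF a(1)] by metis
  then have "i \<in> Ix" by (simp add: quiverA_simps)
  then show "b \<in> Q1_D s"
    using V unfolding b Q1_D_def Q0_D_iff V1_A_iff quiverA_simps(3) by blast
next
  fix b assume "b \<in> Q1_D s"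
  then obtain x i j where b: "b = Alpha x i j" and x: "x \<in> Q0_D s" "i \<in> Ix" "j \<in> Ix" "omega_pow j x + fvec i \<in> Q0_D s"
    unfolding Q1_D_def by blast
  let ?a = "(omega_pow j x, i)"
  have a: "?a \<in> arcs A" using x by (simp add: quiverA_simps Q0_D_iff omega_pow_simplex)
  have orb: "?a \<in> arr_orbit ?a"
    unfolding arr_orbit_def
    by (rule image_eqI[where x = 0]) (simp_all only: act_arr_0[OF a], simp add: Ix_def)
  have "omega x \<noteq> x" "omega (omega_pow j x + fvec i) \<noteq> omega_pow j x + fvec i"
    using x(1,4) not_dominant_fixed unfolding Q0_D_iff by blast+
  then have off: "omega (omega_pow j x) \<noteq> omega_pow j x" "omega (omega_pow j x + fvec i) \<noteq> omega_pow j x + fvec i"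
    by (simp_all only: fixed_omega_pow not_False_eq_True)
  have "omega (tail A c) \<noteq> tail A c \<and> omega (head A c) \<noteq> head A c" if c: "c \<in> arr_orbit ?a" for c
  proof -
    obtain g where "c = act_arr g ?a" using c unfolding arr_orbit_def by blast
    then have "tail A c = omega_pow g (omega_pow j x)" "head A c = omega_pow g (omega_pow j x + fvec i)"
      using act_arr_arcs[OF a, of g] by (simp_all add: quiverA_simps(2,3))
    then show ?thesis using off by simp
  qed
  moreover have "head A ?a \<in> V1_A s" "x \<in> V1_A s" using x by (simp_all add: quiverA_simps(3) V1_A_iff Q0_D_iff)
  ultimately show "b \<in> tilde_alphas s"
    unfolding b tilde_alphas_def using a orb x(3) by blast
qed

lemma tilde_quiver_eq: "tilde_quiverA s = D"
proof -
  have "V1_A s = Q0_D s" by (auto simp: V1_A_iff Q0_D_iff)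
  then show ?thesis by (simp add: tilde_quiverA_def quiverD_def tilde_alphas_eq)
qed

subsection \<open>Cycles avoiding the fixed point\<close>

lemma dominant_shift: "omega v \<noteq> v \<Longrightarrow> dominant (omega_pow j v) \<longleftrightarrow> (level v + j) mod 3 = 0"
  using level_0_iff[of "omega_pow j v"] by (simp add: level_omega_pow)

lemma THE_shift:
  assumes "v \<in> simplex s" "omega v \<noteq> v"
  shows "(THE j. j \<in> Ix \<and> omega_pow j v \<in> V1_A s) = (- level v) mod 3"
    "(THE j. j \<in> Ix \<and> omega_pow (- j) v \<in> V1_A s) = level v"
proof -
  have iff: "omega_pow j v \<in> V1_A s \<longleftrightarrow> (level v + j) mod 3 = 0" for j
    using assms by (simp add: V1_A_iff omega_pow_simplex dominant_shift)
  have unique: "j = (- level v) mod 3" if "j \<in> Ix" "(level v + j) mod 3 = 0" for j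
  proof -
    have "level v = 0 \<or> level v = 1 \<or> level v = 2" using level_Ix[of v] by (simp add: Ix_def)
    moreover have "j = 0 \<or> j = 1 \<or> j = 2" using that(1) by (simp add: Ix_def)
    ultimately show ?thesis using that(2) by (elim disjE) simp_all
  qed
  show "(THE j. j \<in> Ix \<and> omega_pow j v \<in> V1_A s) = (- level v) mod 3"
  proof (rule the_equality)
    show "(- level v) mod 3 \<in> Ix \<and> omega_pow ((- level v) mod 3) v \<in> V1_A s"
      unfolding iff using mod3_Ix by (simp add: mod_add_right_eq)
  qed (use unique iff in blast)
  show "(THE j. j \<in> Ix \<and> omega_pow (- j) v \<in> V1_A s) = level v"
  proof (rule the_equality)
    show "level v \<in> Ix \<and> omega_pow (- level v) v \<in> V1_A s"
      unfolding iff using level_Ix by simp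
    fix j assume j: "j \<in> Ix \<and> omega_pow (- j) v \<in> V1_A s"
    then have "(level v - j) mod 3 = 0" by (simp add: iff)
    then have "3 dvd level v - j" by (simp only: mod_eq_0_iff_dvd)
    then have "level v mod 3 = j mod 3" by (simp only: mod_eq_dvd_iff)
    then show "j = level v" using j by (simp add: Ix_mod)
  qed
qed

text \<open>The two exponents that the construction defines by a unique-existence condition are
  \<open>- level w\<close> and \<open>level z\<close>, and with them its formulas for labels and exponents are those of
  \<open>twist\<close>.\<close>
lemma tilde_cycle_eq:
  assumes c: "c \<in> walksA v" and v: "dominant v"
  shows "tilde_cycle s c = map twist c"
proof -
  obtain l w m z n where c': "c = [(v, l), (w, m), (z, n)]" "(v, l) \<in> arcs A" "(w, m) \<in> arcs A" "(z, n) \<in> arcs A"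
    "w = v + fvec l" "z = w + fvec m" "v = z + fvec n" "omega v \<noteq> v" "omega w \<noteq> w" "omega z \<noteq> z"
    using c by (rule walksAE)
  have s: "w \<in> simplex s" "z \<in> simplex s" using c'(3,4) by (simp_all add: quiverA_simps)
  have lv: "level v = 0" "rep v = v" using v level_dominant rep_level_0 by blast+
  have twists: "twist (v, l) = Alpha v ((l + level w) mod 3) ((- level w) mod 3)"
    "twist (w, m) = Alpha (rep w) ((m + level z) mod 3) ((level w - level z) mod 3)"
    "twist (z, n) = Alpha (rep z) (n mod 3) (level z)"
    using lv by (simp_all add: twist_def flip: c'(5,6,7))
  have arith: "(l - (- level w) mod 3) mod 3 = (l + level w) mod 3"
    "(- ((- level w) mod 3 + level z)) mod 3 = (level w - level z) mod 3"
  proof -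
    show "(l - (- level w) mod 3) mod 3 = (l + level w) mod 3" by (simp add: mod_diff_right_eq)
    have neg: "- (p + q) = - q - p" for p q :: int by simp
    have "(- ((- level w) mod 3 + level z)) mod 3 = (- level z - (- level w) mod 3) mod 3" by (simp only: neg)
    also have "\<dots> = (- level z - - level w) mod 3" by (rule mod_diff_right_eq)
    finally show "(- ((- level w) mod 3 + level z)) mod 3 = (level w - level z) mod 3" by (simp add: algebra_simps)
  qed
  have pows: "omega_pow ((- level w) mod 3) w = rep w" "omega_pow (- level z) z = rep z"
    by (simp_all add: rep_def)
  show ?thesis
    unfolding c'(1) tilde_cycle.simps THE_shift(1)[OF s(1) c'(9)] THE_shift(2)[OF s(2) c'(10)] Let_def list.map
      twists arith pows ..
qed

definition walks_off :: "arrA list set" where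
  "walks_off = {c \<in> closed_3_walks A. \<forall>a\<in>set c. omega (fst a) \<noteq> fst a}"

lemma finite_walks_off: "finite walks_off"
  unfolding walks_off_def using A.finite_closed_3_walks by simp

lemma through_X_iff:
  assumes "c \<in> closed_3_walks A"
  shows "through_X s c \<longleftrightarrow> c \<notin> walks_off"
proof -
  have "s mod 3 = 1 \<and> fst a = X \<longleftrightarrow> omega (fst a) = fst a" if "a \<in> set c" for a
  proof -
    have "a \<in> arcs A" using that closed_arcs[OF assms] by blast
    then have simplex: "fst a \<in> simplex s" using A.tail_in by (simp add: quiverA_simps(1,2))
    show ?thesis
    proof
      assume "s mod 3 = 1 \<and> fst a = X"
      then show "omega (fst a) = fst a" by (simp only: X_fixed)
    qed (rule fixed_simplex[OF simplex])
  qed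
  note fixed = this
  have "through_X s c \<longleftrightarrow> (\<exists>a\<in>set c. s mod 3 = 1 \<and> fst a = X)"
    unfolding through_X_def quiverA_simps(2) by blast
  also have "\<dots> \<longleftrightarrow> (\<exists>a\<in>set c. omega (fst a) = fst a)"
    by (rule bex_cong[OF refl fixed])
  also have "\<dots> \<longleftrightarrow> c \<notin> walks_off" using assms unfolding walks_off_def by blast
  finally show ?thesis .
qed

lemma fst_act_arr: "fst (act_arr g a) = omega_pow g (fst a)"
  by (cases a) (simp add: act_arr_pair)

lemma walks_off_act:
  assumes "c \<in> walks_off"
  shows "map (act_arr g) c \<in> walks_off"
proof -
  have "omega (fst (act_arr g a)) \<noteq> fst (act_arr g a)" if "a \<in> set c" for a
    unfolding fst_act_arr fixed_omega_pow using that assms unfolding walks_off_def by blast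
  then have "\<forall>b\<in>act_arr g ` set c. omega (fst b) \<noteq> fst b" by blast
  moreover have "map (act_arr g) c \<in> closed_3_walks A" using assms unfolding walks_off_def by (intro closed_act) blast
  ultimately show ?thesis unfolding walks_off_def by (simp only: mem_Collect_eq set_map simp_thms)
qed

lemma walks_off_rot:
  assumes "c \<in> walks_off" "d \<in> rot_class c"
  shows "d \<in> walks_off"
proof -
  have "set d = set c" using assms(2) by (auto simp: rot_class_def)
  moreover have "d \<in> closed_3_walks A" using assms A.closed_3_rot_class unfolding walks_off_def by blast
  ultimately show ?thesis using assms(1) unfolding walks_off_def by simp
qed

text \<open>The closed walks that a single element of \<open>C\<^sub>1\<close> stands for: all rotations of all its
  translates.\<close>
definition orbit_walks :: "arrA list \<Rightarrow> arrA list set" where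
  "orbit_walks c = \<Union> (cycle_orbit (rot_class c))"

lemma orbit_walksE:
  assumes "d \<in> orbit_walks c"
  obtains g where "d \<in> rot_class (map (act_arr g) c)"
  using assms by (auto simp: orbit_walks_def orbit_UNIV)

lemma card_orbit_walks:
  assumes c: "c \<in> walks_off"
  shows "card (orbit_walks c) = 3 * card (cycle_orbit (rot_class c))"
proof -
  have classes: "\<exists>d\<in>walks_off. C = rot_class d" if "C \<in> cycle_orbit (rot_class c)" for C
    using that walks_off_act[OF c] by (auto simp: orbit_UNIV)
  have card: "card (rot_class d) = 3" if "d \<in> walks_off" for d
    using that by (intro card_rot_class_A) (simp add: walks_off_def)
  have len: "length d = 3" if "d \<in> walks_off" for d using that A.closed_3_length by (simp add: walks_off_def)
  have "card (\<Union> (cycle_orbit (rot_class c))) = sum card (cycle_orbit (rot_class c))"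
  proof (rule card_Union_disjoint)
    show "pairwise disjnt (cycle_orbit (rot_class c))"
    proof (rule pairwiseI)
      fix C E assume "C \<in> cycle_orbit (rot_class c)" "E \<in> cycle_orbit (rot_class c)" "C \<noteq> E"
      then obtain d e where "d \<in> walks_off" "C = rot_class d" "e \<in> walks_off" "E = rot_class e" using classes by metis
      then show "disjnt C E"
        using \<open>C \<noteq> E\<close> rot_class_eq[OF len[of d]] rot_class_eq[OF len[of e]] unfolding disjnt_iff by metis
    qed
    show "finite C" if "C \<in> cycle_orbit (rot_class c)" for C
    proof -
      obtain d where "d \<in> walks_off" "C = rot_class d" using classes[OF \<open>C \<in> _\<close>] by blast
      then have "card C \<noteq> 0" using card by simp
      then show ?thesis by (rule card_ge_0_finite[OF neq0_conv[THEN iffD1]])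
    qed
  qed
  also have "\<dots> = (\<Sum>C\<in>cycle_orbit (rot_class c). 3)"
    by (rule sum.cong[OF refl]) (use classes card in blast)
  finally show ?thesis by (simp add: orbit_walks_def)
qed

lemma twist_orbit:
  assumes c: "c \<in> walks_off" and d: "d \<in> orbit_walks c"
  shows "rot_class (map twist d) = rot_class (map twist c)" "lamA d = lamA c" "d \<in> walks_off"
proof -
  obtain g where g: "d \<in> rot_class (map (act_arr g) c)" using d by (rule orbit_walksE)
  show "d \<in> walks_off" using walks_off_rot[OF walks_off_act[OF c] g] .
  have cc: "c \<in> closed_3_walks A" using c by (simp add: walks_off_def)
  show "lamA d = lamA c"
    using rot_class_invariant[of lamA, OF lamA_rotate1 g] lamA_act[OF cc, of g] by simp
  obtain a b e where abe: "c = [a, b, e]" using cc by (rule A.closed_3E)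
  obtain v l w m z n where vs: "a = (v, l)" "b = (w, m)" "e = (z, n)" by (cases a, cases b, cases e)
  have heads: "w = v + fvec l" "z = w + fvec m" "v = z + fvec n"
    using cc by (simp_all add: abe vs A.closed_3_iff quiverA_simps(2,3))
  have off: "omega v \<noteq> v" "omega w \<noteq> w" "omega z \<noteq> z" using c by (simp_all add: walks_off_def abe vs)
  have "map twist (map (act_arr g) c) = map twist c"
    using twist_act[of v l g] twist_act[of w m g] twist_act[of z n g] off
    by (simp add: abe vs flip: heads)
  moreover obtain k where "d = rotate k (map (act_arr g) c)" using g by (auto simp: rot_class_def)
  ultimately have "map twist d = rotate k (map twist c)" by (simp only: rotate_map[symmetric])
  then have "map twist d \<in> rot_class (map twist c)" by (auto simp: rot_class_def)
  then show "rot_class (map twist d) = rot_class (map twist c)"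
    by (rule rot_class_eq[rotated]) (simp add: abe)
qed

text \<open>Grouping the closed walks of type A off the fixed point by the element of \<open>C\<^sub>1\<close> that
  represents them. There are three times as many walks in a group as there are rotation classes in
  the orbit, and \<open>3 / 9\<close> is the factor \<open>1/3\<close> of the potential.\<close>
lemma sum_C1:
  assumes C1: "is_C1 s C1"
  shows "(\<Sum>c\<in>C1. Poly_Mapping.single (rot_class (tilde_cycle s c)) (lamA c * of_nat (card (cycle_orbit (rot_class c))) / 3))
    = (\<Sum>c\<in>walks_off. Poly_Mapping.single (rot_class (map twist c)) (lamA c / 9))"
proof -
  let ?T = "\<lambda>c. Poly_Mapping.single (rot_class (map twist c)) (lamA c / 9)"
  have sub: "c \<in> walks_off" "c \<in> walksA (fst (hd c))" "dominant (fst (hd c))" if "c \<in> C1" for c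
  proof -
    have c: "c \<in> closed_3_walks A" "\<not> through_X s c" "tail A (hd c) \<in> V1_A s"
      using C1 that unfolding is_C1_def by blast+
    then show "c \<in> walks_off" using through_X_iff by blast
    then show "c \<in> walksA (fst (hd c))" by (simp add: walks_off_def walksA_def)
    show "dominant (fst (hd c))" using c(3) by (simp add: quiverA_simps(2) V1_A_iff)
  qed
  have fin: "finite C1" using sub(1) finite_walks_off by (meson finite_subset subsetI)
  have unique: "\<exists>!c. c \<in> C1 \<and> d \<in> orbit_walks c" if d: "d \<in> walks_off" for d
  proof -
    have dc: "d \<in> closed_3_walks A" using d by (simp add: walks_off_def)
    have "\<forall>c\<in>rot_class d. \<not> through_X s c"
      using walks_off_rot[OF d] A.closed_3_rot_class[OF dc] through_X_iff by blast
    moreover have "rot_class d \<in> three_cycles A" using dc by (simp add: three_cycles_def)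
    ultimately have ex: "\<exists>!c. c \<in> C1 \<and> rot_class c \<in> cycle_orbit (rot_class d)"
      using C1 unfolding is_C1_def by blast
    have self: "rot_class c \<in> cycle_orbit (rot_class c)" if "c \<in> walks_off" for c
    proof -
      have "map (act_arr 0) c = c"
        using that closed_arcs[of c] by (intro map_idI) (auto simp: walks_off_def act_arr_0)
      then show ?thesis unfolding orbit_UNIV by (metis rangeI)
    qed
    have "d \<in> orbit_walks c \<longleftrightarrow> rot_class c \<in> cycle_orbit (rot_class d)" if "c \<in> C1" for c
    proof
      assume "d \<in> orbit_walks c"
      then obtain g where g: "d \<in> rot_class (map (act_arr g) c)" by (rule orbit_walksE)
      have "length (map (act_arr g) c) = 3"
        using A.closed_3_length sub(1)[OF \<open>c \<in> C1\<close>] by (simp add: walks_off_def)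
      then have "rot_class d \<in> cycle_orbit (rot_class c)" using rot_class_eq[OF _ g] by (auto simp: orbit_UNIV)
      then have "cycle_orbit (rot_class d) = cycle_orbit (rot_class c)" by (rule orbit_eq)
      then show "rot_class c \<in> cycle_orbit (rot_class d)" using self[OF sub(1)[OF \<open>c \<in> C1\<close>]] by simp
    next
      assume "rot_class c \<in> cycle_orbit (rot_class d)"
      then have "cycle_orbit (rot_class c) = cycle_orbit (rot_class d)" by (rule orbit_eq)
      then have "rot_class d \<in> cycle_orbit (rot_class c)" using self[OF d] by simp
      then show "d \<in> orbit_walks c" unfolding orbit_walks_def using rot_class_self by blast
    qed
    then show ?thesis using ex by metis
  qed
  \<comment> \<open>The map \<open>k\<close> sends a walk to its representative in \<open>C1\<close>.\<close>
  define k where "k d = (THE c. c \<in> C1 \<and> d \<in> orbit_walks c)" for d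
  have k: "k d \<in> C1 \<and> d \<in> orbit_walks (k d)" if "d \<in> walks_off" for d
    unfolding k_def by (rule theI'[OF unique[OF that]])
  have fibre: "{d \<in> walks_off. k d = c} = orbit_walks c" if c: "c \<in> C1" for c
  proof (intro equalityI subsetI)
    fix d assume "d \<in> {d \<in> walks_off. k d = c}"
    then show "d \<in> orbit_walks c" using k by blast
  next
    fix d assume d: "d \<in> orbit_walks c"
    then have "d \<in> walks_off" by (rule twist_orbit(3)[OF sub(1)[OF c]])
    then show "d \<in> {d \<in> walks_off. k d = c}" using d c k unique by blast
  qed
  have "(\<Sum>d\<in>walks_off. ?T d) = (\<Sum>c\<in>C1. \<Sum>d\<in>{d \<in> walks_off. k d = c}. ?T d)"
    by (rule sum.group[symmetric, OF finite_walks_off fin]) (use k in blast)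
  also have "\<dots> = (\<Sum>c\<in>C1. Poly_Mapping.single (rot_class (tilde_cycle s c)) (lamA c * of_nat (card (cycle_orbit (rot_class c))) / 3))"
  proof (rule sum.cong[OF refl])
    fix c assume c: "c \<in> C1"
    have "(\<Sum>d\<in>{d \<in> walks_off. k d = c}. ?T d) = (\<Sum>d\<in>orbit_walks c. ?T c)"
      unfolding fibre[OF c] by (rule sum.cong[OF refl]) (simp only: twist_orbit[OF sub(1)[OF c]])
    also have "\<dots> = scale (of_nat (card (orbit_walks c))) (?T c)"
      by (rule poly_mapping_eqI) (simp add: lookup_sum lookup_single when_def)
    also have "\<dots> = Poly_Mapping.single (rot_class (tilde_cycle s c)) (lamA c * of_nat (card (cycle_orbit (rot_class c))) / 3)"
      by (simp add: card_orbit_walks[OF sub(1)[OF c]] tilde_cycle_eq[OF sub(2,3)[OF c]])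
    finally show "(\<Sum>d\<in>{d \<in> walks_off. k d = c}. ?T d)
      = Poly_Mapping.single (rot_class (tilde_cycle s c)) (lamA c * of_nat (card (cycle_orbit (rot_class c))) / 3)" .
  qed
  finally show ?thesis by simp
qed

definition walks_degree0 :: "arrD list set" where
  "walks_degree0 = {c \<in> closed_3_walks D. degree0 c}"

text \<open>The start vertex of a walk of type D can be lifted in three ways.\<close>
lemma card_rep_fibre:
  assumes "x \<in> simplex s" "dominant x"
  shows "card {v \<in> simplex s. omega v \<noteq> v \<and> rep v = x} = 3"
proof -
  have x: "omega x \<noteq> x" "level x = 0" "rep x = x"
    using assms(2) not_dominant_fixed level_dominant rep_level_0 by blast+
  have "{v \<in> simplex s. omega v \<noteq> v \<and> rep v = x} = (\<lambda>j. omega_pow j x) ` Ix"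
  proof (intro equalityI subsetI)
    fix v assume v: "v \<in> {v \<in> simplex s. omega v \<noteq> v \<and> rep v = x}"
    then have "v = omega_pow (level v) x" using omega_pow_rep[of v] by simp
    then show "v \<in> (\<lambda>j. omega_pow j x) ` Ix" using level_Ix by (rule image_eqI)
  next
    fix v assume "v \<in> (\<lambda>j. omega_pow j x) ` Ix"
    then obtain j where "v = omega_pow j x" by blast
    then show "v \<in> {v \<in> simplex s. omega v \<noteq> v \<and> rep v = x}" using x assms(1) by (simp add: omega_pow_simplex)
  qed
  moreover have "inj_on (\<lambda>j. omega_pow j x) Ix"
  proof (rule inj_onI)
    fix i j assume ij: "i \<in> Ix" "j \<in> Ix" and "omega_pow i x = omega_pow j x"
    then have "level (omega_pow i x) = level (omega_pow j x)" by (simp only:)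
    then show "i = j" using ij by (simp add: level_omega_pow[OF x(1)] x(2) Ix_mod)
  qed
  moreover have "card Ix = 3" by (simp add: Ix_def)
  ultimately show ?thesis by (simp add: card_image)
qed

text \<open>Grouping the walks of type A by their start vertex and then by the representative of that
  vertex. The three lifts of a walk turn the denominator 9 into 3.\<close>
lemma sum_walks_off:
  "(\<Sum>c\<in>walks_off. Poly_Mapping.single (rot_class (map twist c)) (lamA c / 9))
    = (\<Sum>c\<in>walks_degree0. Poly_Mapping.single (rot_class c) (weight lamD c / 3))"
proof -
  let ?N = "{v \<in> simplex s. omega v \<noteq> v}" and ?V = "{x \<in> simplex s. dominant x}"
  let ?T = "\<lambda>c. Poly_Mapping.single (rot_class (map twist c)) (lamA c / 9)"
  define H where "H x = (\<Sum>c\<in>walksD x. Poly_Mapping.single (rot_class c) (weight lamD c / 9))" for x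
  have fin: "finite (simplex s)" using A.finite_verts by (simp add: quiverA_simps)
  have start: "fst (hd c) \<in> ?N" if "c \<in> walks_off" for c
  proof -
    have c: "c \<in> closed_3_walks A" using that by (simp add: walks_off_def)
    then have hd: "hd c \<in> set c" using A.closed_3_length[OF c] by (cases c) simp_all
    then have "fst (hd c) \<in> simplex s"
      using closed_arcs[OF c] A.tail_in[of "hd c"] by (auto simp: quiverA_simps(1,2))
    then show ?thesis using that hd by (simp add: walks_off_def)
  qed
  have fibre: "{c \<in> walks_off. fst (hd c) = v} = walksA v" for v
    by (auto simp: walks_off_def walksA_def)
  have "(\<Sum>c\<in>walks_off. ?T c) = (\<Sum>v\<in>?N. \<Sum>c\<in>{c \<in> walks_off. fst (hd c) = v}. ?T c)"
    by (rule sum.group[symmetric, OF finite_walks_off]) (use fin start in auto)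
  also have "\<dots> = (\<Sum>v\<in>?N. H (rep v))"
  proof (rule sum.cong[OF refl])
    fix v assume v: "v \<in> ?N"
    have "H (rep v) = (\<Sum>c\<in>walksA v. Poly_Mapping.single (rot_class (map twist c)) (weight lamD (map twist c) / 9))"
      unfolding H_def using v by (intro sum.reindex_bij_betw[symmetric] twist_walk_bij) simp_all
    then show "(\<Sum>c\<in>{c \<in> walks_off. fst (hd c) = v}. ?T c) = H (rep v)"
      unfolding fibre by (simp add: weightD_twist)
  qed
  also have "\<dots> = (\<Sum>x\<in>?V. \<Sum>v\<in>{v \<in> ?N. rep v = x}. H (rep v))"
    by (rule sum.group[symmetric]) (use fin dominant_rep in auto)
  also have "\<dots> = (\<Sum>x\<in>?V. scale 3 (H x))"
  proof (rule sum.cong[OF refl])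
    fix x assume x: "x \<in> ?V"
    have "(\<Sum>v\<in>{v \<in> ?N. rep v = x}. H (rep v)) = (\<Sum>v\<in>{v \<in> simplex s. omega v \<noteq> v \<and> rep v = x}. H x)"
      by (rule sum.cong) auto
    also have "\<dots> = scale 3 (H x)"
      using x by (intro poly_mapping_eqI) (simp add: lookup_sum card_rep_fibre)
    finally show "(\<Sum>v\<in>{v \<in> ?N. rep v = x}. H (rep v)) = scale 3 (H x)" .
  qed
  also have "\<dots> = (\<Sum>x\<in>?V. \<Sum>c\<in>{c \<in> walks_degree0. tailD s (hd c) = Pt x}. Poly_Mapping.single (rot_class c) (weight lamD c / 3))"
    by (intro sum.cong refl) (simp add: H_def scale_sum walks_degree0_def walksD_def conj_assoc)
  also have "\<dots> = (\<Sum>y\<in>Pt ` ?V. \<Sum>c\<in>{c \<in> walks_degree0. tailD s (hd c) = y}. Poly_Mapping.single (rot_class c) (weight lamD c / 3))"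
    by (rule sum.reindex_cong[symmetric, of Pt]) (simp_all add: inj_on_def)
  also have "\<dots> = (\<Sum>c\<in>walks_degree0. Poly_Mapping.single (rot_class c) (weight lamD c / 3))"
  proof (rule sum.group)
    show "finite walks_degree0" using D.finite_closed_3_walks by (simp add: walks_degree0_def)
    show "finite (Pt ` ?V)" using fin by simp
    show "(\<lambda>c. tailD s (hd c)) ` walks_degree0 \<subseteq> Pt ` ?V"
    proof (rule image_subsetI)
      fix c assume "c \<in> walks_degree0"
      then have c: "c \<in> closed_3_walks D" "degree0 c" by (simp_all add: walks_degree0_def)
      obtain x0 i0 j0 x1 i1 j1 x2 i2 j2 where "c = [Alpha x0 i0 j0, Alpha x1 i1 j1, Alpha x2 i2 j2]"
        using c(2) by (rule degree0E)
      then show "tailD s (hd c) \<in> Pt ` ?V" using c(1) by (simp add: D.closed_3_iff Alpha_arc)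
    qed
  qed
  finally show ?thesis .
qed

subsection \<open>Cycles through the fixed point\<close>

text \<open>One walk from each rotation class through a copy of the fixed point.\<close>
definition walks_X :: "arrD list set" where
  "walks_X = {c \<in> closed_3_walks D. \<exists>x i j k. c = [Alpha x i j, Beta k, Gamma k]}"

lemma walk_trichotomy:
  assumes c: "c \<in> closed_3_walks D"
  shows "c \<in> walks_degree0 \<or> weight lamD c = 0 \<or> c \<in> walks_X \<or> rotate1 c \<in> walks_X \<or> rotate1 (rotate1 c) \<in> walks_X"
proof -
  obtain a b d where abd: "c = [a, b, d]" using c by (rule D.closed_3E)
  have heads: "headD s a = tailD s b" "headD s b = tailD s d" "headD s d = tailD s a"
    using c by (simp_all add: abd D.closed_3_iff quiverD_simps(2,3))
  show ?thesis
  proof (cases a)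
    case (Alpha x i j)
    have "hd c = Alpha x i j" by (simp add: abd Alpha)
    with c show ?thesis
    proof (cases rule: walkD_cases)
      case 1
      then show ?thesis by (simp add: walksD_def walks_degree0_def)
    next
      case 2
      then show ?thesis by blast
    next
      case (3 k)
      then show ?thesis using c unfolding walks_X_def by blast
    qed
  next
    case (Beta k)
    have b: "b = Gamma k" using heads(1) by (cases b) (simp_all add: Beta)
    obtain x i j where d: "d = Alpha x i j" using heads(2,3) by (cases d) (simp_all add: Beta b)
    have "rotate1 (rotate1 c) \<in> closed_3_walks D" using c by (simp only: D.closed_3_rotate1)
    moreover have "rotate1 (rotate1 c) = [Alpha x i j, Beta k, Gamma k]" by (simp add: abd Beta b d)
    ultimately have "rotate1 (rotate1 c) \<in> walks_X" unfolding walks_X_def by blast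
    then show ?thesis by blast
  next
    case (Gamma k)
    have d: "d = Beta k" using heads(3) by (cases d) (simp_all add: Gamma)
    obtain x i j where b: "b = Alpha x i j" using heads(1,2) by (cases b) (simp_all add: Gamma d)
    have "rotate1 c \<in> closed_3_walks D" using c by (simp only: D.closed_3_rotate1)
    moreover have "rotate1 c = [Alpha x i j, Beta k, Gamma k]" by (simp add: abd Gamma b d)
    ultimately have "rotate1 c \<in> walks_X" unfolding walks_X_def by blast
    then show ?thesis by blast
  qed
qed

lemma potentialD_split:
  "potentialD s = (\<Sum>c\<in>walks_degree0. Poly_Mapping.single (rot_class c) (weight lamD c / 3))
    + (\<Sum>c\<in>walks_X. Poly_Mapping.single (rot_class c) (weight lamD c))"
proof -
  let ?F = "\<lambda>c. Poly_Mapping.single (rot_class c) (weight lamD c / 3)"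
  \<comment> \<open>The two further rotations of the walks through a copy of the fixed point.\<close>
  define X1 where "X1 = {c \<in> closed_3_walks D. rotate1 c \<in> walks_X}"
  define X2 where "X2 = {c \<in> closed_3_walks D. rotate1 (rotate1 c) \<in> walks_X}"
  have fin: "finite walks_degree0" "finite walks_X" "finite X1" "finite X2"
    using D.finite_closed_3_walks by (simp_all add: walks_degree0_def walks_X_def X1_def X2_def)
  have shape: "\<exists>x i j k. c = [Alpha x i j, Beta k, Gamma k]" if "c \<in> walks_X" for c
    using that unfolding walks_X_def by blast
  have shape1: "\<exists>x i j k. c = [Gamma k, Alpha x i j, Beta k]" if "c \<in> X1" for c
  proof -
    have c: "c \<in> closed_3_walks D" "rotate1 c \<in> walks_X" using that by (simp_all add: X1_def)
    obtain a b d where abd: "c = [a, b, d]" using c(1) by (rule D.closed_3E)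
    obtain x i j k where "rotate1 c = [Alpha x i j, Beta k, Gamma k]" using shape[OF c(2)] by blast
    then have "c = [Gamma k, Alpha x i j, Beta k]" by (simp add: abd)
    then show ?thesis by blast
  qed
  have shape2: "\<exists>x i j k. c = [Beta k, Gamma k, Alpha x i j]" if "c \<in> X2" for c
  proof -
    have c: "c \<in> closed_3_walks D" "rotate1 (rotate1 c) \<in> walks_X" using that by (simp_all add: X2_def)
    obtain a b d where abd: "c = [a, b, d]" using c(1) by (rule D.closed_3E)
    obtain x i j k where "rotate1 (rotate1 c) = [Alpha x i j, Beta k, Gamma k]" using shape[OF c(2)] by blast
    then have "c = [Beta k, Gamma k, Alpha x i j]" by (simp add: abd)
    then show ?thesis by blast
  qed
  have disj: "walks_degree0 \<inter> (walks_X \<union> X1 \<union> X2) = {}" "walks_X \<inter> X1 = {}" "(walks_X \<union> X1) \<inter> X2 = {}"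
  proof -
    have "\<not> degree0 c" if "c \<in> walks_X \<union> X1 \<union> X2" for c
      using that shape[of c] shape1[of c] shape2[of c] by (elim UnE) (erule meta_impE, assumption, elim exE, simp)+
    then show "walks_degree0 \<inter> (walks_X \<union> X1 \<union> X2) = {}" unfolding walks_degree0_def by blast
    show "walks_X \<inter> X1 = {}" using shape shape1 by (metis (no_types, lifting) arrD.distinct disjoint_iff list.inject)
    show "(walks_X \<union> X1) \<inter> X2 = {}"
      using shape shape1 shape2 by (metis (no_types, lifting) UnE arrD.distinct disjoint_iff list.inject)
  qed
  have sub: "walks_degree0 \<union> (walks_X \<union> X1 \<union> X2) \<subseteq> closed_3_walks D"
    by (auto simp: walks_degree0_def walks_X_def X1_def X2_def)
  have rot: "?F (rotate1 c) = ?F c" if "c \<in> closed_3_walks D" for c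
  proof -
    have "rotate1 c \<in> rot_class c" unfolding rot_class_def by (rule range_eqI[of _ _ 1]) simp
    then show ?thesis
      using rot_class_eq[OF D.closed_3_length[OF that]] weight_rotate1[where lam = lamD, OF D.closed_3_length[OF that] lamD_rotate1]
      by simp
  qed
  have rot3: "rotate1 (rotate1 (rotate1 c)) = c" if "c \<in> closed_3_walks D" for c
    using that by (rule D.closed_3E) simp
  have sums: "(\<Sum>c\<in>X1. ?F c) = (\<Sum>c\<in>walks_X. ?F c)" "(\<Sum>c\<in>X2. ?F c) = (\<Sum>c\<in>X1. ?F c)"
  proof -
    have "bij_betw rotate1 X1 walks_X"
      by (rule bij_betwI[where g = "\<lambda>c. rotate1 (rotate1 c)"])
        (auto simp: X1_def walks_X_def D.closed_3_rotate1 rot3 simp del: rotate1.simps)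
    then have "(\<Sum>c\<in>X1. ?F (rotate1 c)) = (\<Sum>c\<in>walks_X. ?F c)" by (rule sum.reindex_bij_betw)
    moreover have "(\<Sum>c\<in>X1. ?F (rotate1 c)) = (\<Sum>c\<in>X1. ?F c)" by (rule sum.cong[OF refl rot]) (simp add: X1_def)
    ultimately show "(\<Sum>c\<in>X1. ?F c) = (\<Sum>c\<in>walks_X. ?F c)" by simp
    have "bij_betw rotate1 X2 X1"
      by (rule bij_betwI[where g = "\<lambda>c. rotate1 (rotate1 c)"])
        (auto simp: X1_def X2_def D.closed_3_rotate1 rot3 simp del: rotate1.simps)
    then have "(\<Sum>c\<in>X2. ?F (rotate1 c)) = (\<Sum>c\<in>X1. ?F c)" by (rule sum.reindex_bij_betw)
    moreover have "(\<Sum>c\<in>X2. ?F (rotate1 c)) = (\<Sum>c\<in>X2. ?F c)" by (rule sum.cong[OF refl rot]) (simp add: X2_def)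
    ultimately show "(\<Sum>c\<in>X2. ?F c) = (\<Sum>c\<in>X1. ?F c)" by simp
  qed
  have "potentialD s = (\<Sum>c\<in>closed_3_walks D. ?F c)" by (simp add: potentialD_walks walk_potential_def)
  also have "\<dots> = (\<Sum>c\<in>walks_degree0 \<union> (walks_X \<union> X1 \<union> X2). ?F c)"
  proof (rule sum.mono_neutral_right[OF D.finite_closed_3_walks sub])
    show "\<forall>c\<in>closed_3_walks D - (walks_degree0 \<union> (walks_X \<union> X1 \<union> X2)). ?F c = 0"
    proof
      fix c assume "c \<in> closed_3_walks D - (walks_degree0 \<union> (walks_X \<union> X1 \<union> X2))"
      then have "weight lamD c = 0" using walk_trichotomy[of c] unfolding X1_def X2_def by blast
      then show "?F c = 0" by simp
    qed
  qed
  also have "\<dots> = (\<Sum>c\<in>walks_degree0. ?F c) + ((\<Sum>c\<in>walks_X. ?F c) + (\<Sum>c\<in>X1. ?F c) + (\<Sum>c\<in>X2. ?F c))"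
    using fin disj by (simp add: sum.union_disjoint)
  also have "(\<Sum>c\<in>walks_X. ?F c) + (\<Sum>c\<in>X1. ?F c) + (\<Sum>c\<in>X2. ?F c) = (\<Sum>c\<in>walks_X. scale 3 (?F c))"
    unfolding sums scale_sum[symmetric] by (rule poly_mapping_eqI) (simp add: lookup_add)
  also have "\<dots> = (\<Sum>c\<in>walks_X. Poly_Mapping.single (rot_class c) (weight lamD c))" by simp
  finally show ?thesis .
qed

lemma sum_walks_X:
  "(\<Sum>c\<in>walks_X. Poly_Mapping.single (rot_class c) (weight lamD c))
    = (\<Sum>c\<in>cycles_C2 s. \<Sum>k\<in>Ix. Poly_Mapping.single (rot_class (tilde_cycle_X s c k)) (lamA c * zeta powi (- p_exp s c * k)))"
proof (cases "s mod 3 = 1")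
  case False
  have "walks_X = {}" using False by (auto simp: walks_X_def D.closed_3_iff nonAlpha_arc)
  then show ?thesis using False by (simp add: cycles_C2_def)
next
  case s: True
  let ?p = "\<lambda>k. [Alpha Z 1 0, Beta k, Gamma k]" and ?q = "\<lambda>k. [Alpha Z 2 1, Beta k, Gamma k]"
  have set: "walks_X = ?p ` Ix \<union> ?q ` Ix"
  proof (intro equalityI subsetI)
    fix c assume c: "c \<in> walks_X"
    then obtain x i j k where c': "c = [Alpha x i j, Beta k, Gamma k]" by (auto simp: walks_X_def)
    have "c \<in> closed_3_walks D" using c by (simp add: walks_X_def)
    then have arcs: "Alpha x i j \<in> arcs D" "k \<in> Ix" and heads: "Pt (omega_pow j x + fvec i) = Pt Y" "Pt Z = Pt x"
      unfolding c' D.closed_3_iff quiverD_simps(2,3) nonAlpha_arc headD.simps tailD.simps by blast+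
    have x: "x = Z" using heads(2) by simp
    have "omega_pow j Z + fvec i = Y" using heads(1) unfolding x by (simp only: vertD.inject)
    then have "(i, j) = (1, 0) \<or> (i, j) = (2, 1)" using arrows_Z_Y_arc[OF s] arcs(1) unfolding x by blast
    then show "c \<in> ?p ` Ix \<union> ?q ` Ix" using arcs(2) unfolding c' x by blast
  next
    fix c assume "c \<in> ?p ` Ix \<union> ?q ` Ix"
    then show "c \<in> walks_X"
      using X_walksD(1)[OF s arcs_Z_Y(1,3)[OF s]] X_walksD(1)[OF s arcs_Z_Y(2,4)[OF s]] unfolding walks_X_def by blast
  qed
  have "(\<Sum>c\<in>walks_X. Poly_Mapping.single (rot_class c) (weight lamD c))
      = (\<Sum>c\<in>?p ` Ix. Poly_Mapping.single (rot_class c) (weight lamD c)) + (\<Sum>c\<in>?q ` Ix. Poly_Mapping.single (rot_class c) (weight lamD c))"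
    unfolding set by (rule sum.union_disjoint) auto
  also have "(\<Sum>c\<in>?p ` Ix. Poly_Mapping.single (rot_class c) (weight lamD c)) = (\<Sum>k\<in>Ix. Poly_Mapping.single (rot_class (?p k)) (- 1))"
    by (subst sum.reindex) (simp_all add: inj_on_def weight_3 lamD_X_def)
  also have "(\<Sum>c\<in>?q ` Ix. Poly_Mapping.single (rot_class c) (weight lamD c)) = (\<Sum>k\<in>Ix. Poly_Mapping.single (rot_class (?q k)) (zeta powi k))"
    by (subst sum.reindex) (simp_all add: inj_on_def weight_3 lamD_X_def)
  finally have lhs: "(\<Sum>c\<in>walks_X. Poly_Mapping.single (rot_class c) (weight lamD c))
    = (\<Sum>k\<in>Ix. Poly_Mapping.single (rot_class (?p k)) (- 1)) + (\<Sum>k\<in>Ix. Poly_Mapping.single (rot_class (?q k)) (zeta powi k))" .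
  have ne: "c_minus s \<noteq> c_plus s" by (simp add: c_minus_def c_plus_def)
  have lam: "lamA (c_minus s) = - 1" "lamA (c_plus s) = 1"
    by (simp_all add: c_minus_def c_plus_def index_sign_def rot_sim_def)
  show ?thesis
    unfolding lhs cycles_C2_def if_P[OF s] sum_pair[OF ne]
    using ne by (simp add: tilde_cycle_X_def p_exp_def lam)
qed

theorem tilde_potential_eq: "is_C1 s C1 \<Longrightarrow> tilde_potentialA s C1 = potentialD s"
  unfolding tilde_potentialA_def potentialD_split sum_walks_X[symmetric]
  by (simp only: sum_C1 sum_walks_off)

end

theorem theorem3p8:
  fixes s :: int
  assumes "s \<ge> 2"
  shows "(\<forall>C1. is_C1 s C1 \<longrightarrow>
            (tilde_quiverA s, tilde_potentialA s C1) = (quiverD s, potentialD s))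
       \<and> (\<exists>\<eta>. idempotent_in (PiA_skew_Z3 s) \<eta>
            \<and> algebra_iso (PiD s) (corner_algebra (PiA_skew_Z3 s) \<eta>))"
proof -
  interpret covering s by unfold_locales (rule assms)
  show ?thesis using tilde_quiver_eq tilde_potential_eq PiD_iso_corner by blast
qed

end
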